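(* In the DCSMD-SW setting described in the context, let the noise assumption, the network assumption, the boundedness assumption and the Bregman assumption hold, with tail parameter $\theta\ge \frac12$. Let the stepsizes be $\alpha_t=1/\sqrt{t+1}$, and for $\ell\in\mathcal V$ let $\widetilde x_\ell^T=\frac1T\sum_{t=1}^T x_{\ell,t}$. Then for any $\ell\in\mathcal V$ and any $0<\delta<1$, with probability at least $1-\delta$, $$F(\widetilde x_{\ell}^T)-F(x^* )\leq \mathcal O\left(\Big(\log\frac{T}{\delta}\Big)^{2\theta}\frac{(\log T)^2}{\sqrt{T}}+\Big(\log\frac{1}{\delta}\Big)^2\Big(\log\frac{T}{\delta}\Big)^{2\max\{0,\theta-1\}}\frac{1}{\sqrt{T}}\right),$$ where $\mathcal O(\cdot)$ hides a positive constant factor independent of $T$ and $\delta$ (it may depend on the problem, network, noise and initialization data).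
   Context: Setting. $n,m$ are positive integers, $\mathcal V=\{1,\dots,m\}$, $\|\cdot\|$ is an arbitrary norm on $\mathbb R^n$, $\langle\cdot,\cdot\rangle$ the Euclidean inner product, and $\|z\|_*=\sup_{\|u\|\le1}|\langle z,u\rangle|$ the dual norm. $\mathcal X\subset\mathbb R^n$ is closed and convex (possibly unbounded); $f_i,\psi_i:\mathcal X\to\mathbb R$, $i\in\mathcal V$, are convex and possibly nonsmooth; $f=\sum_{i=1}^m f_i$, $\psi=\sum_{i=1}^m\psi_i$, $F=f+\psi$. A point $x^*\in\mathcal X$ with $F(x)\ge F(x^* )$ for all $x\in\mathcal X$ exists and is fixed. Bregman divergence. $D_\Phi(x\|y)=\Phi(x)-\Phi(y)-\langle\nabla\Phi(y),x-y\rangle$ for a distance-generating function $\Phi:\mathcal X\to\mathbb R$. Algorithm (DCSMD-SW). Given $m\times m$ communication matrices $W_t$ with nonnegative entries, edge sets $\mathcal E_t=\{(j,i):[W_t]_{ij}>0\}$, stepsizes $\alpha_t>0$ and deterministic initial points $x_{i,1}\in\mathcal X$, for $t\ge1$ and $i\in\mathcal V$: $$y_{i,t}=\sum_{j=1}^m[W_t]_{ij}x_{j,t},\qquad x_{i,t+1}=\arg\min_{x\in\mathcal X}\Big\{\langle\widehat g_{i,t}^{SW},x\rangle+\tfrac1{\alpha_t}D_\Phi(x\|y_{i,t})+\psi_i(x)\Big\},$$ where $\widehat g_{i,t}^{SW}=g_{i,t}-\xi_{i,t}$, $g_{i,t}\in\partial f_i(x_{i,t})$, $\mathbb E[\xi_{i,t}|\mathcal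 F_{t-1}]=0$, and $\mathcal F_t$ is the $\sigma$-field generated by the entire history of the randomness up to step $t$ (so $x_{i,t},y_{i,t},g_{i,t}$ are $\mathcal F_{t-1}$-measurable). Noise assumption: for some $\theta\ge\frac12$ there is $\kappa>0$ such that $\mathbb E[\exp\{(\|\xi_{i,t}\|_*/\kappa)^{1/\theta}\}\,|\,\mathcal F_{t-1}]\le2$ for all $t\ge1$, $i\in\mathcal V$. Network assumption: (a) each $W_t$ is doubly stochastic; (b) there is an integer $B\ge1$ such that the graph $(\mathcal V,\mathcal E_{kB+1}\cup\dots\cup\mathcal E_{(k+1)B})$ is strongly connected for every $k\ge0$; (c) there is $0<\eta<1$ with $[W_t]_{ii}\ge\eta$ for all $i,t$ and $[W_t]_{ij}\ge\eta$ whenever $(j,i)\in\mathcal E_t$. Boundedness assumption: there is $G>0$ with $\|g\|_*\le G$ for all $x\in\mathcal X$, $g\in\partial f_i(x)$, $i\in\mathcal V$; and there is $G_\psi>0$ such that every $\psi_i$ is convex with $|\psi_i(x)-\psi_i(y)|\le G_\psi\|x-y\|$ on $\mathcal X$. Bregman assumption: $\Phi$ is differentiable and $\sigma_\Phi$-strongly convex ($\sigma_\Phi>0$) with respect to $\|\cdot\|$ on $\mathcal X$, and $D_\Phi(x\|\sum_{j=1}^m a_jy_j)\le\sum_{j=1}^m a_jD_\Phi(x\|y_j)$ for all $x,y_j\in\mathcal X$, $a_j\ge0$, $\sum_{j=1}^m a_j=1$. Convention: the horizon $T$ is an integer with $T\ge10$. *)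

theory Defs
  imports "HOL-Probability.Probability"
begin

definition is_norm :: "(real^'n \<Rightarrow> real) \<Rightarrow> bool" where
  "is_norm nrm \<longleftrightarrow>
     (\<forall>z. 0 \<le> nrm z) \<and> (\<forall>z. nrm z = 0 \<longleftrightarrow> z = 0) \<and>
     (\<forall>c z. nrm (c *\<^sub>R z) = \<bar>c\<bar> * nrm z) \<and>
     (\<forall>z w. nrm (z + w) \<le> nrm z + nrm w)"

definition dual_norm :: "(real^'n \<Rightarrow> real) \<Rightarrow> real^'n \<Rightarrow> real" where
  "dual_norm nrm z = (SUP u\<in>{u. nrm u \<le> 1}. \<bar>z \<bullet> u\<bar>)"

text \<open>
  Subdifferential of a function whose effective domain is \<open>U\<close>. The functions \<open>f i\<close> below are
  convex on a convex set \<open>U\<close> that contains the feasible set \<open>X\<close>, and the subgradient inequality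
  ranges over \<open>U\<close>. Both common readings are instances: \<open>U = X\<close> (subgradients relative to \<open>X\<close>)
  and \<open>U = UNIV\<close> (convex functions on the whole space). With \<open>U = X\<close> only, a uniform bound on all
  subgradients would exclude iterates on the boundary of \<open>X\<close>, since there the subdifferential
  absorbs the normal cone.
\<close>

definition subdifferential :: "(real^'n) set \<Rightarrow> (real^'n \<Rightarrow> real) \<Rightarrow> real^'n \<Rightarrow> (real^'n) set" where
  "subdifferential U h x = {v. \<forall>y\<in>U. h x + v \<bullet> (y - x) \<le> h y}"

text \<open>
  The gradient map \<open>dPhi\<close> is passed explicitly. It is only required to represent the derivative
  of \<open>Phi\<close> within the convex set \<open>X\<close>; for \<open>x\<close>, \<open>y\<close> in \<open>X\<close> the divergence does not depend on the
  choice of \<open>dPhi\<close>.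
\<close>

definition bregman_div ::
  "(real^'n \<Rightarrow> real) \<Rightarrow> (real^'n \<Rightarrow> real^'n) \<Rightarrow> real^'n \<Rightarrow> real^'n \<Rightarrow> real" where
  "bregman_div Phi dPhi x y = Phi x - Phi y - dPhi y \<bullet> (x - y)"

definition objective ::
  "('m::finite \<Rightarrow> real^'n \<Rightarrow> real) \<Rightarrow> ('m \<Rightarrow> real^'n \<Rightarrow> real) \<Rightarrow> real^'n \<Rightarrow> real" where
  "objective f \<psi> x = (\<Sum>i\<in>UNIV. f i x) + (\<Sum>i\<in>UNIV. \<psi> i x)"

definition doubly_stochastic :: "real^'m^'m \<Rightarrow> bool" where
  "doubly_stochastic A \<longleftrightarrow>
     (\<forall>i j. 0 \<le> A $ i $ j) \<and>
     (\<forall>i. (\<Sum>j\<in>UNIV. A $ i $ j) = 1) \<and> (\<forall>j. (\<Sum>i\<in>UNIV. A $ i $ j) = 1)"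

definition edges :: "real^'m^'m \<Rightarrow> ('m \<times> 'm) set" where
  "edges A = {(j, i). A $ i $ j > 0}"

definition strongly_connected :: "('v \<times> 'v) set \<Rightarrow> bool" where
  "strongly_connected E \<longleftrightarrow> (\<forall>u v. (u, v) \<in> E\<^sup>*)"

definition network_assumption :: "(nat \<Rightarrow> real^'m^'m) \<Rightarrow> nat \<Rightarrow> real \<Rightarrow> bool" where
  "network_assumption W B \<eta> \<longleftrightarrow>
     (\<forall>t\<ge>1. doubly_stochastic (W t)) \<and>
     1 \<le> B \<and> (\<forall>k. strongly_connected (\<Union>t\<in>{k * B + 1..(k + 1) * B}. edges (W t))) \<and>
     0 < \<eta> \<and> \<eta> < 1 \<and>
     (\<forall>t\<ge>1. \<forall>i. \<eta> \<le> W t $ i $ i) \<and>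
     (\<forall>t\<ge>1. \<forall>i j. (j, i) \<in> edges (W t) \<longrightarrow> \<eta> \<le> W t $ i $ j)"

definition boundedness_assumption ::
  "(real^'n \<Rightarrow> real) \<Rightarrow> (real^'n) set \<Rightarrow> (real^'n) set \<Rightarrow>
   ('m::finite \<Rightarrow> real^'n \<Rightarrow> real) \<Rightarrow> ('m \<Rightarrow> real^'n \<Rightarrow> real) \<Rightarrow> real \<Rightarrow> real \<Rightarrow> bool" where
  "boundedness_assumption nrm X U f \<psi> G G\<psi> \<longleftrightarrow>
     0 < G \<and> (\<forall>i. \<forall>x\<in>X. \<forall>v\<in>subdifferential U (f i) x. dual_norm nrm v \<le> G) \<and>
     0 < G\<psi> \<and> (\<forall>i. convex_on X (\<psi> i)) \<and>
     (\<forall>i. \<forall>x\<in>X. \<forall>y\<in>X. \<bar>\<psi> i x - \<psi> i y\<bar> \<le> G\<psi> * nrm (x - y))"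

text \<open>
  The index type \<open>'m\<close> of the agents also indexes the convex combinations in the separate
  convexity condition.
\<close>

definition bregman_assumption ::
  "'m::finite itself \<Rightarrow> (real^'n \<Rightarrow> real) \<Rightarrow> (real^'n) set \<Rightarrow>
   (real^'n \<Rightarrow> real) \<Rightarrow> (real^'n \<Rightarrow> real^'n) \<Rightarrow> real \<Rightarrow> bool" where
  "bregman_assumption (_ :: 'm itself) nrm X Phi dPhi \<sigma> \<longleftrightarrow>
     (\<forall>x\<in>X. (Phi has_derivative (\<lambda>h. dPhi x \<bullet> h)) (at x within X)) \<and>
     0 < \<sigma> \<and>
     (\<forall>x\<in>X. \<forall>y\<in>X. Phi y + dPhi y \<bullet> (x - y) + \<sigma> / 2 * (nrm (x - y))\<^sup>2 \<le> Phi x) \<and>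
     (\<forall>x\<in>X. \<forall>(y :: 'm \<Rightarrow> real^'n) (a :: 'm \<Rightarrow> real).
        (\<forall>j. y j \<in> X) \<and> (\<forall>j. 0 \<le> a j) \<and> (\<Sum>j\<in>UNIV. a j) = 1 \<longrightarrow>
        bregman_div Phi dPhi x (\<Sum>j\<in>UNIV. a j *\<^sub>R y j)
          \<le> (\<Sum>j\<in>UNIV. a j * bregman_div Phi dPhi x (y j)))"

text \<open>
  One run of the algorithm on the probability space \<open>M\<close>. The history is modelled by an arbitrary
  filtration \<open>Fil\<close> of sub-sigma-algebras of \<open>M\<close> to which the noise is adapted and for which the
  quantities of step \<open>t\<close> that precede the noise are predictable; the generated filtration is the
  minimal instance. Time starts at 1, so \<open>t - 1\<close> is never truncated.
\<close>

definition dcsmd_run ::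
  "(real^'n) set \<Rightarrow> (real^'n) set \<Rightarrow>
   ('m::finite \<Rightarrow> real^'n \<Rightarrow> real) \<Rightarrow> ('m \<Rightarrow> real^'n \<Rightarrow> real) \<Rightarrow>
   (real^'n \<Rightarrow> real) \<Rightarrow> (real^'n \<Rightarrow> real^'n) \<Rightarrow>
   (nat \<Rightarrow> real^'m^'m) \<Rightarrow> (nat \<Rightarrow> real) \<Rightarrow> ('m \<Rightarrow> real^'n) \<Rightarrow>
   'w measure \<Rightarrow> (nat \<Rightarrow> 'w measure) \<Rightarrow>
   ('m \<Rightarrow> nat \<Rightarrow> 'w \<Rightarrow> real^'n) \<Rightarrow> ('m \<Rightarrow> nat \<Rightarrow> 'w \<Rightarrow> real^'n) \<Rightarrow>
   ('m \<Rightarrow> nat \<Rightarrow> 'w \<Rightarrow> real^'n) \<Rightarrow> ('m \<Rightarrow> nat \<Rightarrow> 'w \<Rightarrow> real^'n) \<Rightarrow> bool" where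
  "dcsmd_run X U f \<psi> Phi dPhi W \<alpha> x1 M Fil x y g \<xi> \<longleftrightarrow>
     prob_space M \<and> filtration (space M) Fil \<and> (\<forall>t. subalgebra M (Fil t)) \<and>
     (\<forall>i. \<forall>\<omega>\<in>space M. x i 1 \<omega> = x1 i) \<and>
     (\<forall>t\<ge>1. \<forall>i.
        x i t \<in> borel_measurable (Fil (t - 1)) \<and>
        g i t \<in> borel_measurable (Fil (t - 1)) \<and>
        \<xi> i t \<in> borel_measurable (Fil t) \<and>
        (\<forall>k. integrable M (\<lambda>\<omega>. \<xi> i t \<omega> $ k) \<and>
             (AE \<omega> in M. real_cond_exp M (Fil (t - 1)) (\<lambda>\<omega>. \<xi> i t \<omega> $ k) \<omega> = 0)) \<and>
        (\<forall>\<omega>\<in>space M.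
           y i t \<omega> = (\<Sum>j\<in>UNIV. W t $ i $ j *\<^sub>R x j t \<omega>) \<and>
           g i t \<omega> \<in> subdifferential U (f i) (x i t \<omega>) \<and>
           is_arg_min
             (\<lambda>z. (g i t \<omega> - \<xi> i t \<omega>) \<bullet> z
                  + 1 / \<alpha> t * bregman_div Phi dPhi z (y i t \<omega>) + \<psi> i z)
             (\<lambda>z. z \<in> X) (x i (t + 1) \<omega>)))"

definition noise_assumption ::
  "(real^'n \<Rightarrow> real) \<Rightarrow> real \<Rightarrow> real \<Rightarrow> 'w measure \<Rightarrow> (nat \<Rightarrow> 'w measure) \<Rightarrow>
   ('m::finite \<Rightarrow> nat \<Rightarrow> 'w \<Rightarrow> real^'n) \<Rightarrow> bool" where
  "noise_assumption nrm \<theta> \<kappa> M Fil \<xi> \<longleftrightarrow>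
     (\<forall>t\<ge>1. \<forall>i. AE \<omega> in M.
        nn_cond_exp M (Fil (t - 1))
          (\<lambda>\<omega>. ennreal (exp ((dual_norm nrm (\<xi> i t \<omega>) / \<kappa>) powr (1 / \<theta>)))) \<omega> \<le> 2)"

end

theory Submission
  imports Defs
begin

text \<open>
  Let \<open>Z t\<close> be the sum over the agents \<open>i\<close> of the divergences from \<open>xstar\<close> to \<open>x i t\<close>. Since the
  communication matrices are doubly stochastic and the divergence is convex in its second argument,
  averaging does not increase \<open>Z\<close>, and one mirror descent step (\<open>Z_step\<close>) gives
  \[ Z_{t+1} \le Z_t - \alpha_t (F(x_{l,t}) - F(x^*)) + \alpha_t N_t + b_t, \]
  where \<open>N t\<close> is the sum of the inner products of the noise \<open>\<xi> i t\<close> with \<open>y i t - xstar\<close>, and \<open>b t\<close>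
  collects the squared stepsize and the disagreement between the agents. Two things have to be
  controlled: the sum of the \<open>b t\<close>, and the martingale of the \<open>\<alpha> t * N t\<close>, whose increments are
  unbounded when the feasible set or the noise is.

  The unbounded domain is dealt with by passing from \<open>Z\<close> to \<open>H t = sqrt (Z t + A)\<close>. As
  \<open>y i t - xstar\<close> has norm at most a constant times \<open>H t\<close> (\<open>y_distance\<close>), the concavity of the square
  root turns the recursion into one for \<open>H\<close> in which the noise enters through \<open>N t / H t\<close> only. The
  coefficient of the noise is now bounded by a constant, whatever the iterates do. If the partial sums
  of \<open>\<alpha> t * (N t / H t)\<close> stay below \<open>a\<close>, the recursion bounds both \<open>H\<close> and the sum of \<open>\<alpha> t * gap l t / (2 * H t)\<close> by the same \<open>Q\<close>, and the product is
  \<open>weighted_gap_bound\<close>: the weighted gaps sum to at most \<open>2 * Q\<^sup>2\<close>. Jensen's inequality then yields the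
  rate \<open>Q\<^sup>2 / sqrt T\<close>. This explains the shape of the theorem: its two terms are the squares of the two
  parts of \<open>Q\<close>, one coming from \<open>sqrt A\<close>, with \<open>A\<close> chosen to balance the sum of the \<open>b t\<close>, and one
  from the dependence of \<open>a\<close> on \<open>\<delta>\<close>.

  The heavy tails are dealt with by clipping each inner product from above, at the level which, with
  high probability, it does not exceed in the first \<open>T\<close> steps. One-sided clipping can only lower the
  mean, so that the clipped increments have conditional mean at most zero and need no recentring. At
  the same time clipping at \<open>L powr \<theta>\<close> makes a variable with \<open>\<theta>\<close>-sub-Weibull tails subexponential at
  scale \<open>L powr max 0 (\<theta> - 1)\<close> (\<open>exp_truncated_le\<close>, \<open>truncated_noise_mgf\<close>). A Chernoff bound
  with a single, stepsize-independent exponent (\<open>large_deviation_prob\<close>) gives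
  \<open>a\<close> of order \<open>L powr max 0 (\<theta> - 1) * (ln T + ln (1 / \<delta>))\<close>.

  The disagreement is summed without an explicit geometric rate. Over a window of fixed length the
  product of the communication matrices is entrywise positive (\<open>trans_mat_positive\<close>), hence the spread
  of the iterates contracts up to the accumulated drift, and
  \<open>weighted_sum_of_window_contraction\<close> sums this contraction directly against the stepsizes.

  Finally, the subgradient bound is only assumed at points of \<open>X\<close> where subgradients over \<open>U\<close> exist. It
  forces the iterates into the interior of \<open>U\<close> (\<open>bounded_subdifferential_imp_interior\<close>), where
  all \<open>f i\<close> are subdifferentiable and continuous. This provides the Lipschitz estimate between the
  iterates of different agents and the measurability of the objective along the run.
\<close>

section \<open>Norms and dual norms\<close>

context
  fixes nrm :: "real^'n \<Rightarrow> real"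
  assumes nrm: "is_norm nrm"
begin

lemma nrm_nonneg: "0 \<le> nrm z"
  using nrm by (auto simp: is_norm_def)

lemma nrm_eq_0_iff: "nrm z = 0 \<longleftrightarrow> z = 0"
  using nrm by (auto simp: is_norm_def)

lemma nrm_pos: "z \<noteq> 0 \<Longrightarrow> 0 < nrm z"
  using nrm_nonneg[of z] nrm_eq_0_iff[of z] by linarith

lemma nrm_scaleR: "nrm (c *\<^sub>R z) = \<bar>c\<bar> * nrm z"
  using nrm by (auto simp: is_norm_def)

lemma nrm_triangle: "nrm (z + w) \<le> nrm z + nrm w"
  using nrm by (auto simp: is_norm_def)

lemma nrm_zero: "nrm 0 = 0"
  by (simp add: nrm_eq_0_iff)

lemma nrm_minus: "nrm (- z) = nrm z"
  using nrm_scaleR[of "-1" z] by simp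

lemma nrm_minus_commute: "nrm (z - w) = nrm (w - z)"
  using nrm_minus[of "z - w"] by simp

lemma nrm_triangle_via: "nrm (z - w) \<le> nrm (z - v) + nrm (v - w)"
  using nrm_triangle[of "z - v" "v - w"] by simp

lemma nrm_sum: "nrm (\<Sum>i\<in>I. h i) \<le> (\<Sum>i\<in>I. nrm (h i))"
proof (induction I rule: infinite_finite_induct)
  case (insert i I)
  then show ?case using nrm_triangle[of "h i" "\<Sum>i\<in>I. h i"] by simp
qed (simp_all add: nrm_zero)

lemma nrm_upper: "\<exists>K>0. \<forall>z. nrm z \<le> K * norm z"
proof (intro exI conjI allI)
  let ?K = "1 + (\<Sum>i\<in>UNIV. nrm (axis i 1))"
  show "0 < ?K" using sum_nonneg[of UNIV "\<lambda>i. nrm (axis i (1::real))"] nrm_nonneg by (smt (verit))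
  fix z :: "real^'n"
  have "nrm z = nrm (\<Sum>i\<in>UNIV. (z $ i) *\<^sub>R axis i 1)"
    using basis_expansion[of z] by (simp add: scalar_mult_eq_scaleR)
  also have "\<dots> \<le> (\<Sum>i\<in>UNIV. \<bar>z $ i\<bar> * nrm (axis i 1))"
    using nrm_sum[of "\<lambda>i. (z $ i) *\<^sub>R axis i 1" UNIV] by (simp add: nrm_scaleR)
  also have "\<dots> \<le> (\<Sum>i\<in>UNIV. norm z * nrm (axis i 1))"
    by (intro sum_mono mult_right_mono component_le_norm_cart nrm_nonneg)
  also have "\<dots> \<le> ?K * norm z"
    by (simp add: sum_distrib_left[symmetric] algebra_simps)
  finally show "nrm z \<le> ?K * norm z" .
qed

lemma continuous_on_nrm: "continuous_on S nrm"
proof -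
  obtain K where K: "K > 0" "\<And>z. nrm z \<le> K * norm z" using nrm_upper by auto
  have "\<bar>nrm z - nrm w\<bar> \<le> K * dist z w" for z w
    using nrm_triangle[of "z - w" w] nrm_triangle[of "w - z" z] K(2)[of "z - w"]
      nrm_minus_commute[of z w] by (simp add: dist_norm)
  then have "K-lipschitz_on S nrm"
    by (intro lipschitz_onI) (use K in \<open>auto simp: dist_real_def\<close>)
  then show ?thesis by (rule lipschitz_on_continuous_on)
qed

text \<open>
  The norm is continuous and positive on the Euclidean unit sphere, which is compact, and
  therefore attains a positive minimum there. The bound keeps the unit ball of the norm, and
  with it the supremum that defines the dual norm, bounded.
\<close>

lemma nrm_lower: "\<exists>c>0. \<forall>z. c * norm z \<le> nrm z"
proof -
  let ?S = "sphere (0 :: real^'n) 1"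
  have "?S \<noteq> {}" by simp
  then obtain w where w: "w \<in> ?S" "\<And>z. z \<in> ?S \<Longrightarrow> nrm w \<le> nrm z"
    using continuous_attains_inf[OF compact_sphere _ continuous_on_nrm] by blast
  have "w \<noteq> 0" using w(1) by auto
  have "nrm w * norm z \<le> nrm z" for z :: "real^'n"
  proof (cases "z = 0")
    case False
    have "nrm w \<le> nrm ((1 / norm z) *\<^sub>R z)" using False by (intro w(2)) simp
    then show ?thesis using False by (simp add: nrm_scaleR field_simps)
  qed (simp add: nrm_zero)
  then show ?thesis using nrm_pos[OF \<open>w \<noteq> 0\<close>] by blast
qed

lemma dual_norm_bdd: "bdd_above ((\<lambda>u. \<bar>z \<bullet> u\<bar>) ` {u. nrm u \<le> 1})"
proof -
  obtain c where c: "c > 0" "\<And>z. c * norm z \<le> nrm z" using nrm_lower by auto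
  have "\<bar>z \<bullet> u\<bar> \<le> norm z / c" if "nrm u \<le> 1" for u
  proof -
    have "norm u \<le> 1 / c" using c(2)[of u] that c(1) by (simp add: field_simps)
    then have "norm z * norm u \<le> norm z * (1 / c)" by (intro mult_left_mono) auto
    then show ?thesis using Cauchy_Schwarz_ineq2[of z u] by simp
  qed
  then show ?thesis by (intro bdd_aboveI2[where M = "norm z / c"]) auto
qed

lemma dual_norm_ge: "nrm u \<le> 1 \<Longrightarrow> \<bar>z \<bullet> u\<bar> \<le> dual_norm nrm z"
  unfolding dual_norm_def by (rule cSUP_upper[OF _ dual_norm_bdd]) auto

lemma dual_norm_le: "(\<And>u. nrm u \<le> 1 \<Longrightarrow> \<bar>z \<bullet> u\<bar> \<le> b) \<Longrightarrow> dual_norm nrm z \<le> b"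
  unfolding dual_norm_def by (rule cSUP_least) (auto intro: exI[of _ 0] simp: nrm_zero)

lemma dual_norm_nonneg: "0 \<le> dual_norm nrm z"
  using dual_norm_ge[of 0 z] by (simp add: nrm_zero)

lemma dual_norm_holder: "\<bar>z \<bullet> u\<bar> \<le> dual_norm nrm z * nrm u"
proof (cases "u = 0")
  case False
  have "\<bar>z \<bullet> ((1 / nrm u) *\<^sub>R u)\<bar> \<le> dual_norm nrm z"
    using nrm_pos[OF False] by (intro dual_norm_ge) (simp add: nrm_scaleR)
  then show ?thesis using nrm_pos[OF False] by (simp add: field_simps abs_mult)
qed (simp add: nrm_zero)

lemma dual_norm_diff: "dual_norm nrm (z - w) \<le> dual_norm nrm z + dual_norm nrm w"
proof (rule dual_norm_le)
  fix u assume "nrm u \<le> 1"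
  then show "\<bar>(z - w) \<bullet> u\<bar> \<le> dual_norm nrm z + dual_norm nrm w"
    using dual_norm_ge[of u z] dual_norm_ge[of u w] by (simp add: inner_diff_left)
qed

lemma continuous_on_dual_norm: "continuous_on S (dual_norm nrm)"
proof -
  obtain c where c: "c > 0" "\<And>z. c * norm z \<le> nrm z" using nrm_lower by auto
  have ub: "dual_norm nrm z \<le> norm z / c" for z
  proof (rule dual_norm_le)
    fix u assume "nrm u \<le> 1"
    then have "norm u \<le> 1 / c" using c(2)[of u] c(1) by (simp add: field_simps)
    then have "norm z * norm u \<le> norm z * (1 / c)" by (intro mult_left_mono) auto
    then show "\<bar>z \<bullet> u\<bar> \<le> norm z / c" using Cauchy_Schwarz_ineq2[of z u] by simp
  qed
  have 1: "dual_norm nrm z \<le> dual_norm nrm w + norm (z - w) / c" for z w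
  proof -
    have "dual_norm nrm z \<le> dual_norm nrm (z - w) + dual_norm nrm w"
    proof (rule dual_norm_le)
      fix u assume "nrm u \<le> 1"
      then show "\<bar>z \<bullet> u\<bar> \<le> dual_norm nrm (z - w) + dual_norm nrm w"
        using dual_norm_ge[of u "z - w"] dual_norm_ge[of u w] by (simp add: inner_diff_left)
    qed
    then show ?thesis using ub[of "z - w"] by simp
  qed
  have "\<bar>dual_norm nrm z - dual_norm nrm w\<bar> \<le> (1 / c) * dist z w" for z w
    using 1[of z w] 1[of w z] by (simp add: dist_norm norm_minus_commute abs_le_iff)
  then have "(1 / c)-lipschitz_on S (dual_norm nrm)"
    by (intro lipschitz_onI) (use c in \<open>auto simp: dist_real_def\<close>)
  then show ?thesis by (rule lipschitz_on_continuous_on)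
qed

end

section \<open>Bounded subdifferentials and the interior of the domain\<close>

text \<open>
  The case of empty interior is included: then \<open>U\<close> lies in a hyperplane, and a normal of the hyperplane
  serves at every point.
\<close>

lemma outer_normal_exists:
  fixes x :: "'a::euclidean_space"
  assumes "convex U" "x \<in> U" "x \<notin> interior U"
  shows "\<exists>p. p \<noteq> 0 \<and> (\<forall>y\<in>U. p \<bullet> (y - x) \<le> 0)"
proof (cases "interior U = {}")
  case True
  obtain a b where ab: "a \<noteq> 0" "U \<subseteq> {y. a \<bullet> y = b}"
    using empty_interior_subset_hyperplane[OF assms(1) True] by blast
  then show ?thesis using assms(2)
    by (intro exI[of _ a]) (auto simp: inner_diff_right subset_eq)
next
  case False
  obtain a b where ab: "a \<noteq> 0" "\<And>y. y \<in> interior U \<Longrightarrow> a \<bullet> y \<le> b" "b \<le> a \<bullet> x"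
    using separating_hyperplane_sets[of "interior U" "{x}"] assms False
    by (auto simp: convex_interior)
  have "closure (interior U) \<subseteq> {y. a \<bullet> y \<le> b}"
    by (rule closure_minimal) (use ab closed_halfspace_le in auto)
  then have "a \<bullet> y \<le> b" if "y \<in> U" for y
    using that closure_subset[of U] convex_closure_interior[OF assms(1) False] by auto
  then show ?thesis using ab by (intro exI[of _ a]) (fastforce simp: inner_diff_right)
qed

text \<open>
  At a boundary point of \<open>U\<close> a nonempty subdifferential contains a ray in the direction of an outer
  normal of \<open>U\<close>, and is therefore unbounded.
\<close>

lemma bounded_subdifferential_imp_interior:
  fixes x :: "real^'n"
  assumes nrm: "is_norm nrm" and "convex U" "x \<in> U"
    and v: "v \<in> subdifferential U h x"
    and bound: "\<And>w. w \<in> subdifferential U h x \<Longrightarrow> dual_norm nrm w \<le> G"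
  shows "x \<in> interior U"
proof (rule ccontr)
  assume "x \<notin> interior U"
  then obtain p where p: "p \<noteq> 0" "\<And>y. y \<in> U \<Longrightarrow> p \<bullet> (y - x) \<le> 0"
    using outer_normal_exists[OF assms(2,3)] by auto
  have ray: "v + c *\<^sub>R p \<in> subdifferential U h x" if "c \<ge> 0" for c
    unfolding subdifferential_def
  proof (intro CollectI ballI)
    fix y assume "y \<in> U"
    then have "h x + v \<bullet> (y - x) \<le> h y" "c * (p \<bullet> (y - x)) \<le> 0"
      using v p(2) that by (auto simp: subdifferential_def intro: mult_nonneg_nonpos)
    then show "h x + (v + c *\<^sub>R p) \<bullet> (y - x) \<le> h y" by (simp add: inner_add_left)
  qed
  \<comment> \<open>chosen so that the pairing of the ray point with \<open>p\<close> exceeds \<open>G * nrm p\<close>\<close>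
  define c where "c = (G * nrm p + \<bar>v \<bullet> p\<bar> + 1) / (p \<bullet> p)"
  have pp: "p \<bullet> p > 0" using p(1) by simp
  have G: "0 \<le> G" using bound[OF v] dual_norm_nonneg[OF nrm, of v] by linarith
  have c: "c \<ge> 0" "c * (p \<bullet> p) = G * nrm p + \<bar>v \<bullet> p\<bar> + 1"
    using pp G nrm_nonneg[OF nrm, of p] by (auto simp: c_def)
  have "(v + c *\<^sub>R p) \<bullet> p \<le> G * nrm p"
    using dual_norm_holder[OF nrm, of "v + c *\<^sub>R p" p]
      mult_right_mono[OF bound[OF ray[OF c(1)]] nrm_nonneg[OF nrm, of p]] by linarith
  then show False using c(2) by (simp add: inner_add_left)
qed

text \<open>
  A hyperplane that separates the strict epigraph from the point \<open>(x, h x)\<close> cannot be vertical,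
  because \<open>x\<close> is an interior point; its slope is a subgradient.
\<close>

lemma subgradient_exists_interior:
  fixes x :: "real^'n"
  assumes h: "convex_on U h" and x: "x \<in> interior U"
  shows "\<exists>v. v \<in> subdifferential U h x"
proof -
  define E where "E = {(y, r). y \<in> U \<and> h y < r}"
  have U: "convex U" using h by (simp add: convex_on_def)
  have xU: "x \<in> U" using x interior_subset by blast
  have "convex E"
  proof (rule convexI)
    fix p q :: "(real^'n) \<times> real" and u v :: real
    assume pq: "p \<in> E" "q \<in> E" and uv: "0 \<le> u" "0 \<le> v" "u + v = 1"
    obtain y r z s where [simp]: "p = (y, r)" "q = (z, s)" by (cases p, cases q) auto
    have *: "y \<in> U" "z \<in> U" "h y < r" "h z < s" using pq by (auto simp: E_def)
    have "h (u *\<^sub>R y + v *\<^sub>R z) \<le> u * h y + v * h z"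
      using h uv * by (auto simp: convex_on_def)
    also have "\<dots> < u * r + v * s"
    proof (cases "u = 0")
      case True then show ?thesis using uv * by simp
    next
      case False
      then have "u * h y < u * r" using uv * by simp
      moreover have "v * h z \<le> v * s" using uv * by (intro mult_left_mono) auto
      ultimately show ?thesis by linarith
    qed
    finally show "u *\<^sub>R p + v *\<^sub>R q \<in> E"
      using U uv * by (auto simp: E_def convex_def)
  qed
  moreover have "(x, h x + 1) \<in> E" using xU by (auto simp: E_def)
  moreover have "E \<inter> {(x, h x)} = {}" by (auto simp: E_def)
  ultimately obtain a b where ab: "a \<noteq> 0" "\<And>p. p \<in> {(x, h x)} \<Longrightarrow> a \<bullet> p \<le> b"
      "\<And>p. p \<in> E \<Longrightarrow> b \<le> a \<bullet> p"
    using separating_hyperplane_sets[of "{(x, h x)}" E] by blast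
  obtain p q where a: "a = (p, q)" by (cases a)
  have sep: "p \<bullet> x + q * h x \<le> p \<bullet> y + q * r" if "y \<in> U" "h y < r" for y r
    using ab(2)[of "(x, h x)"] ab(3)[of "(y, r)"] that by (auto simp: E_def a)
  have "q \<ge> 0" using sep[OF xU, of "h x + 1"] by (simp add: algebra_simps)
  have sep': "p \<bullet> x + q * h x \<le> p \<bullet> y + q * h y" if "y \<in> U" for y
  proof (rule field_le_epsilon)
    fix e :: real assume e: "e > 0"
    have "p \<bullet> x + q * h x \<le> p \<bullet> y + q * (h y + e / (q + 1))"
      using e \<open>q \<ge> 0\<close> by (intro sep that) auto
    also have "q * (e / (q + 1)) \<le> e" using e \<open>q \<ge> 0\<close> by (simp add: field_simps)
    then have "p \<bullet> y + q * (h y + e / (q + 1)) \<le> p \<bullet> y + q * h y + e"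
      by (simp add: distrib_left)
    finally show "p \<bullet> x + q * h x \<le> p \<bullet> y + q * h y + e" .
  qed
  \<comment> \<open>a vertical hyperplane would support \<open>U\<close> at \<open>x\<close>, against the interior ball\<close>
  have "q \<noteq> 0"
  proof
    assume q: "q = 0"
    then have p: "p \<noteq> 0" using ab(1) a by (auto simp: zero_prod_def)
    obtain e where e: "e > 0" "ball x e \<subseteq> U" using x by (auto simp: mem_interior)
    let ?y = "x - (e / 2 / norm p) *\<^sub>R p"
    have "?y \<in> U" using e p by (intro subsetD[OF e(2)]) (simp add: dist_norm)
    then have "p \<bullet> x \<le> p \<bullet> ?y" using sep'[of ?y] q by simp
    moreover have "0 < (e / 2 / norm p) * (p \<bullet> p)" using e p by simp
    ultimately show False by (simp add: inner_diff_right)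
  qed
  then have "q > 0" using \<open>q \<ge> 0\<close> by simp
  have "- (1 / q) *\<^sub>R p \<in> subdifferential U h x"
    unfolding subdifferential_def
  proof (intro CollectI ballI)
    fix y assume "y \<in> U"
    from sep'[OF this] have "q * h x - p \<bullet> (y - x) \<le> q * h y" by (simp add: inner_diff_right)
    then have "(q * h x - p \<bullet> (y - x)) / q \<le> h y" using \<open>q > 0\<close> by (simp add: divide_le_eq mult.commute)
    then show "h x + - (1 / q) *\<^sub>R p \<bullet> (y - x) \<le> h y"
      using \<open>q > 0\<close> by (simp add: diff_divide_distrib)
  qed
  then show ?thesis ..
qed

text \<open>
  Agents hold subgradients of their own function at their own iterate. Comparing \<open>f i\<close> at the iterates
  of two agents requires a subgradient of \<open>f i\<close> at the iterate of the other one.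
\<close>

lemma subgradient_lipschitz_interior:
  fixes x :: "real^'n"
  assumes nrm: "is_norm nrm" and h: "convex_on U h" and x: "x \<in> interior U" and y: "y \<in> U"
    and bound: "\<And>w. w \<in> subdifferential U h x \<Longrightarrow> dual_norm nrm w \<le> G"
  shows "h x - G * nrm (y - x) \<le> h y"
proof -
  obtain v where v: "v \<in> subdifferential U h x"
    using subgradient_exists_interior[OF h x] by blast
  have "\<bar>v \<bullet> (y - x)\<bar> \<le> G * nrm (y - x)"
    using dual_norm_holder[OF nrm, of v "y - x"]
      mult_right_mono[OF bound[OF v] nrm_nonneg[OF nrm, of "y - x"]] by linarith
  moreover have "h x + v \<bullet> (y - x) \<le> h y" using v y by (auto simp: subdifferential_def)
  ultimately show ?thesis by linarith
qed

section \<open>Consensus\<close>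

primrec trans_mat :: "(nat \<Rightarrow> real^'m^'m) \<Rightarrow> nat \<Rightarrow> nat \<Rightarrow> real^'m^'m" where
  "trans_mat W s 0 = mat 1"
| "trans_mat W s (Suc k) = W (s + k) ** trans_mat W s k"

lemma trans_mat_stochastic:
  assumes "\<And>t. s \<le> t \<Longrightarrow> doubly_stochastic (W t)"
  shows "0 \<le> trans_mat W s k $ i $ j" "(\<Sum>j\<in>UNIV. trans_mat W s k $ i $ j) = 1"
proof (induction k arbitrary: i j)
  case 0
  { case 1 show ?case by (simp add: mat_def) }
  { case 2 show ?case by (simp add: mat_def) }
next
  case (Suc k)
  { case 1 show ?case using Suc assms[of "s + k"]
      by (auto simp: matrix_matrix_mult_def doubly_stochastic_def intro!: sum_nonneg) }
  { case 2
    have "(\<Sum>j\<in>UNIV. trans_mat W s (Suc k) $ i $ j)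
        = (\<Sum>l\<in>UNIV. \<Sum>j\<in>UNIV. W (s + k) $ i $ l * trans_mat W s k $ l $ j)"
      by (subst sum.swap) (simp add: matrix_matrix_mult_def)
    also have "\<dots> = 1"
      using Suc assms[of "s + k"] by (simp add: sum_distrib_left[symmetric] doubly_stochastic_def)
    finally show ?case . }
qed

text \<open>
  The agents that the value of \<open>j\<close> at time \<open>s\<close> has reached after \<open>k\<close> rounds. Each round contributes
  a weight of at least \<open>\<eta>\<close>, so that membership is measured against \<open>\<eta> ^ k\<close>.
\<close>

definition reached :: "(nat \<Rightarrow> real^'m^'m) \<Rightarrow> real \<Rightarrow> nat \<Rightarrow> 'm \<Rightarrow> nat \<Rightarrow> 'm set" where
  "reached W \<eta> s j k = {i. \<eta> ^ k \<le> trans_mat W s k $ i $ j}"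

context
  fixes W :: "nat \<Rightarrow> real^'m^'m" and B :: nat and \<eta> :: real
  assumes net: "network_assumption W B \<eta>"
begin

lemma net_stochastic: "1 \<le> t \<Longrightarrow> doubly_stochastic (W t)"
  using net by (simp add: network_assumption_def)

lemma net_params: "1 \<le> B" "0 < \<eta>" "\<eta> < 1"
  using net by (auto simp: network_assumption_def)

lemma reached_step:
  assumes s: "1 \<le> s" and l: "l \<in> reached W \<eta> s j k" and li: "l = i \<or> (l, i) \<in> edges (W (s + k))"
  shows "i \<in> reached W \<eta> s j (Suc k)"
proof -
  have w: "\<eta> \<le> W (s + k) $ i $ l" using li net s by (auto simp: network_assumption_def)
  have "\<eta> * \<eta> ^ k \<le> W (s + k) $ i $ l * trans_mat W s k $ l $ j"
    using l w net_params by (intro mult_mono) (auto simp: reached_def)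
  also have "\<dots> \<le> (\<Sum>l\<in>UNIV. W (s + k) $ i $ l * trans_mat W s k $ l $ j)"
    using net_stochastic s trans_mat_stochastic(1)[of s W k]
    by (intro member_le_sum) (auto simp: doubly_stochastic_def)
  finally show ?thesis by (simp add: reached_def matrix_matrix_mult_def)
qed

lemma reached_mono: "1 \<le> s \<Longrightarrow> k \<le> k' \<Longrightarrow> reached W \<eta> s j k \<subseteq> reached W \<eta> s j k'"
  by (rule lift_Suc_mono_le) (use reached_step in blast)+

lemma reached_self: "1 \<le> s \<Longrightarrow> j \<in> reached W \<eta> s j k"
  using reached_mono[of s 0 k j] by (auto simp: reached_def mat_def)

text \<open>
  Over a window whose union graph is strongly connected, some edge leaves the reached set, and
  the set can only grow before that edge becomes active.
\<close>

lemma reached_block: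
  assumes s: "1 \<le> s" and b: "s \<le> b * B + 1"
    and ne: "reached W \<eta> s j (b * B + 1 - s) \<noteq> UNIV"
  shows "reached W \<eta> s j (b * B + 1 - s) \<subset> reached W \<eta> s j ((b + 1) * B + 1 - s)"
    (is "?R \<subset> ?R'")
proof -
  let ?E = "\<Union>t\<in>{b * B + 1..(b + 1) * B}. edges (W t)"
  obtain w where w: "w \<notin> ?R" using ne by blast
  have "(j, w) \<in> ?E\<^sup>*" using net by (auto simp: network_assumption_def strongly_connected_def)
  then have "\<exists>u v. (u, v) \<in> ?E \<and> u \<in> ?R \<and> v \<notin> ?R"
    using w
  proof (induction rule: rtrancl_induct)
    case base then show ?case using reached_self[OF s] by blast
  next
    case (step y z) then show ?case by blast
  qed
  then obtain u v t where t: "b * B + 1 \<le> t" "t \<le> (b + 1) * B" "(u, v) \<in> edges (W t)"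
    and u: "u \<in> ?R" and v: "v \<notin> ?R" by auto
  have "u \<in> reached W \<eta> s j (t - s)"
    using reached_mono[OF s diff_le_mono[OF t(1)]] u by blast
  then have "v \<in> reached W \<eta> s j (Suc (t - s))"
    using reached_step[OF s, of u j "t - s" v] t b by auto
  moreover have "Suc (t - s) \<le> (b + 1) * B + 1 - s" using t b by auto
  ultimately have "v \<in> ?R'" using reached_mono[OF s] by blast
  moreover have "?R \<subseteq> ?R'" using reached_mono[OF s] t by (intro reached_mono[OF s]) auto
  ultimately show ?thesis using v by blast
qed

text \<open>
  Each of the connected windows adds at least one agent to the reached set, so that \<open>CARD('m)\<close> of them
  suffice. The windows are aligned to multiples of \<open>B\<close>, while \<open>s\<close> is arbitrary; one more block covers
  the wait for the first aligned window.
\<close>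

lemma trans_mat_positive:
  assumes s: "1 \<le> s"
  shows "\<eta> ^ ((CARD('m) + 1) * B) \<le> trans_mat W s ((CARD('m) + 1) * B) $ i $ j"
proof -
  define b where "b = (s - 1) div B + 1"
  have B: "1 \<le> B" using net_params by simp
  have "(s - 1) div B * B + (s - 1) mod B = s - 1" by (rule div_mult_mod_eq)
  moreover have "(s - 1) mod B < B" using B by simp
  moreover have "b * B = (s - 1) div B * B + B" by (simp add: b_def)
  ultimately have b: "s \<le> b * B + 1" "b * B + 1 \<le> s + B" using s by linarith+
  define R where "R q = reached W \<eta> s j ((b + q) * B + 1 - s)" for q
  have grow: "R q \<noteq> UNIV \<Longrightarrow> R q \<subset> R (Suc q)" for q
    using reached_block[OF s, of "b + q" j] b(1) by (auto simp: R_def algebra_simps)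
  have "R q = UNIV \<or> q < card (R q)" for q
  proof (induction q)
    case 0 
    have "j \<in> R 0" using reached_self[OF s] by (simp add: R_def)
    then show ?case by (auto simp: card_gt_0_iff)
  next
    case (Suc q)
    show ?case
    proof (cases "R q = UNIV")
      case True
      have "R q \<subseteq> R (Suc q)"
        unfolding R_def by (rule reached_mono[OF s]) (auto simp: algebra_simps)
      then show ?thesis using True by auto
    next
      case False
      then have "card (R q) < card (R (Suc q))" using grow by (intro psubset_card_mono) auto
      then show ?thesis using Suc False by auto
    qed
  qed
  moreover have "card (R q) \<le> CARD('m)" for q by (rule card_mono) auto
  ultimately have "R (CARD('m)) = UNIV" by (meson not_le)
  moreover have "R (CARD('m)) \<subseteq> reached W \<eta> s j ((CARD('m) + 1) * B)"
    unfolding R_def by (rule reached_mono[OF s]) (use b in \<open>auto simp: algebra_simps\<close>)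
  ultimately show ?thesis by (auto simp: reached_def)
qed

end

definition spread :: "(real^'n \<Rightarrow> real) \<Rightarrow> ('m::finite \<Rightarrow> real^'n) \<Rightarrow> real" where
  "spread nrm z = Max (range (\<lambda>(i, j). nrm (z i - z j)))"

lemma spread_ge: "nrm (z i - z j) \<le> spread nrm z"
  unfolding spread_def by (rule Max_ge) auto

lemma spread_le: "(\<And>i j. nrm (z i - z j) \<le> b) \<Longrightarrow> spread nrm z \<le> b"
  unfolding spread_def by (subst Max_le_iff) auto

context
  fixes nrm :: "real^'n \<Rightarrow> real"
  assumes nrm: "is_norm nrm"
begin

lemma spread_nonneg: "0 \<le> spread nrm z"
  using spread_ge[of nrm z undefined undefined] by (simp add: nrm_zero[OF nrm])

text \<open>
  Both weight vectors put mass \<open>\<epsilon>\<close> on \<open>j\<close>, and the common part cancels. What remains are two measures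
  of mass \<open>1 - \<epsilon>\<close>, whose averages are compared through the product coupling.
\<close>

lemma averages_contract:
  fixes p q :: "'m::finite \<Rightarrow> real"
  assumes p: "\<And>k. 0 \<le> p k" "(\<Sum>k\<in>UNIV. p k) = 1" and q: "\<And>k. 0 \<le> q k" "(\<Sum>k\<in>UNIV. q k) = 1"
    and \<epsilon>: "\<epsilon> \<le> p j" "\<epsilon> \<le> q j" "0 \<le> \<epsilon>" "\<epsilon> < 1"
  shows "nrm ((\<Sum>k\<in>UNIV. p k *\<^sub>R z k) - (\<Sum>k\<in>UNIV. q k *\<^sub>R z k)) \<le> (1 - \<epsilon>) * spread nrm z"
proof -
  define p' q' where "p' k = p k - (if k = j then \<epsilon> else 0)"
    and "q' k = q k - (if k = j then \<epsilon> else 0)" for k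
  have p': "0 \<le> p' k" and q': "0 \<le> q' k" for k using p q \<epsilon> by (auto simp: p'_def q'_def)
  have sp: "(\<Sum>k\<in>UNIV. p' k) = 1 - \<epsilon>" and sq: "(\<Sum>k\<in>UNIV. q' k) = 1 - \<epsilon>"
    by (simp_all add: p'_def q'_def sum_subtractf p q)
  have red: "(\<Sum>k\<in>UNIV. p k *\<^sub>R z k) - (\<Sum>k\<in>UNIV. q k *\<^sub>R z k)
      = (\<Sum>k\<in>UNIV. p' k *\<^sub>R z k) - (\<Sum>k\<in>UNIV. q' k *\<^sub>R z k)" (is "?D = _")
    by (simp add: p'_def q'_def scaleR_diff_left sum_subtractf)
  have "(1 - \<epsilon>) *\<^sub>R ?D = (\<Sum>l\<in>UNIV. q' l) *\<^sub>R (\<Sum>k\<in>UNIV. p' k *\<^sub>R z k)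
      - (\<Sum>k\<in>UNIV. p' k) *\<^sub>R (\<Sum>l\<in>UNIV. q' l *\<^sub>R z l)"
    unfolding red sp sq by (simp add: scaleR_diff_right)
  also have "\<dots> = (\<Sum>k\<in>UNIV. \<Sum>l\<in>UNIV. (p' k * q' l) *\<^sub>R z k)
      - (\<Sum>k\<in>UNIV. \<Sum>l\<in>UNIV. (p' k * q' l) *\<^sub>R z l)"
  proof -
    have "(\<Sum>l\<in>UNIV. q' l) *\<^sub>R (\<Sum>k\<in>UNIV. p' k *\<^sub>R z k)
        = (\<Sum>k\<in>UNIV. \<Sum>l\<in>UNIV. (p' k * q' l) *\<^sub>R z k)"
      by (simp add: scaleR_sum_right scaleR_sum_left[symmetric] sum_distrib_left[symmetric] mult.commute)
    moreover have "(\<Sum>k\<in>UNIV. p' k) *\<^sub>R (\<Sum>l\<in>UNIV. q' l *\<^sub>R z l)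
        = (\<Sum>k\<in>UNIV. \<Sum>l\<in>UNIV. (p' k * q' l) *\<^sub>R z l)"
      by (subst sum.swap) (simp add: scaleR_sum_right scaleR_sum_left[symmetric] sum_distrib_right[symmetric])
    ultimately show ?thesis by simp
  qed
  also have "\<dots> = (\<Sum>k\<in>UNIV. \<Sum>l\<in>UNIV. (p' k * q' l) *\<^sub>R (z k - z l))"
    by (simp add: scaleR_diff_right sum_subtractf)
  finally have "(1 - \<epsilon>) * nrm ?D = nrm (\<Sum>k\<in>UNIV. \<Sum>l\<in>UNIV. (p' k * q' l) *\<^sub>R (z k - z l))"
    using nrm_scaleR[OF nrm, of "1 - \<epsilon>" ?D] \<epsilon> by simp
  also have "\<dots> \<le> (\<Sum>k\<in>UNIV. \<Sum>l\<in>UNIV. nrm ((p' k * q' l) *\<^sub>R (z k - z l)))"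
    by (intro order.trans[OF nrm_sum[OF nrm]] sum_mono nrm_sum[OF nrm])
  also have "\<dots> \<le> (\<Sum>k\<in>UNIV. \<Sum>l\<in>UNIV. p' k * q' l * spread nrm z)"
    using p' q' by (intro sum_mono) (auto simp: nrm_scaleR[OF nrm] intro!: mult_left_mono spread_ge)
  also have "\<dots> = (1 - \<epsilon>) * ((1 - \<epsilon>) * spread nrm z)"
    by (simp add: sum_distrib_right[symmetric] sum_distrib_left[symmetric] sp sq)
  finally show ?thesis using \<epsilon> by simp
qed

text \<open>
  Averaging is nonexpansive, so that errors made along the way are carried forward without amplification.
\<close>

lemma perturbed_consensus_unroll:
  fixes x :: "nat \<Rightarrow> 'm::finite \<Rightarrow> real^'n"
  assumes W: "\<And>t. s \<le> t \<Longrightarrow> doubly_stochastic (W t)"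
    and e: "\<And>t i. s \<le> t \<Longrightarrow> t < s + k \<Longrightarrow>
      nrm (x (t + 1) i - (\<Sum>j\<in>UNIV. W t $ i $ j *\<^sub>R x t j)) \<le> e t"
  shows "nrm (x (s + k) i - (\<Sum>l\<in>UNIV. trans_mat W s k $ i $ l *\<^sub>R x s l)) \<le> (\<Sum>t=s..<s+k. e t)"
  using e
proof (induction k arbitrary: i)
  case 0
  have "(\<Sum>l\<in>UNIV. (mat 1 :: real^'m^'m) $ i $ l *\<^sub>R x s l)
      = (\<Sum>l\<in>UNIV. if l = i then x s i else 0)"
    by (intro sum.cong) (auto simp: mat_def)
  then show ?case by (simp add: nrm_zero[OF nrm])
next
  case (Suc k)
  let ?W = "W (s + k)" and ?P = "trans_mat W s k"
  have "(\<Sum>l\<in>UNIV. trans_mat W s (Suc k) $ i $ l *\<^sub>R x s l)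
      = (\<Sum>j\<in>UNIV. ?W $ i $ j *\<^sub>R (\<Sum>l\<in>UNIV. ?P $ j $ l *\<^sub>R x s l))"
    by (simp add: matrix_matrix_mult_def scaleR_sum_left scaleR_sum_right) (rule sum.swap)
  then have "nrm (x (s + Suc k) i - (\<Sum>l\<in>UNIV. trans_mat W s (Suc k) $ i $ l *\<^sub>R x s l))
      \<le> nrm (x (s + k + 1) i - (\<Sum>j\<in>UNIV. ?W $ i $ j *\<^sub>R x (s + k) j))
        + nrm (\<Sum>j\<in>UNIV. ?W $ i $ j *\<^sub>R (x (s + k) j - (\<Sum>l\<in>UNIV. ?P $ j $ l *\<^sub>R x s l)))"
    using nrm_triangle_via[OF nrm, of "x (s + k + 1) i" _ "\<Sum>j\<in>UNIV. ?W $ i $ j *\<^sub>R x (s + k) j"]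
    by (simp add: scaleR_diff_right sum_subtractf)
  also have "nrm (\<Sum>j\<in>UNIV. ?W $ i $ j *\<^sub>R (x (s + k) j - (\<Sum>l\<in>UNIV. ?P $ j $ l *\<^sub>R x s l)))
      \<le> (\<Sum>j\<in>UNIV. ?W $ i $ j * (\<Sum>t=s..<s+k. e t))"
    using W[of "s + k"] Suc
    by (intro order.trans[OF nrm_sum[OF nrm]] sum_mono)
      (auto simp: nrm_scaleR[OF nrm] doubly_stochastic_def intro!: mult_left_mono)
  also have "\<dots> = (\<Sum>t=s..<s+k. e t)"
    using W[of "s + k"] by (simp add: sum_distrib_right[symmetric] doubly_stochastic_def)
  also have "nrm (x (s + k + 1) i - (\<Sum>j\<in>UNIV. ?W $ i $ j *\<^sub>R x (s + k) j)) \<le> e (s + k)"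
    using Suc.prems[of "s + k" i] by simp
  finally show ?case by simp
qed

text \<open>
  With \<open>\<epsilon> = 0\<close> this is the growth bound for windows that are too short to mix.
\<close>

lemma spread_after_mixing:
  fixes x :: "nat \<Rightarrow> 'm::finite \<Rightarrow> real^'n"
  assumes W: "\<And>t. s \<le> t \<Longrightarrow> doubly_stochastic (W t)"
    and e: "\<And>t i. s \<le> t \<Longrightarrow> t < s + k \<Longrightarrow>
      nrm (x (t + 1) i - (\<Sum>j\<in>UNIV. W t $ i $ j *\<^sub>R x t j)) \<le> e t"
    and \<epsilon>: "\<And>i. \<epsilon> \<le> trans_mat W s k $ i $ j" "0 \<le> \<epsilon>" "\<epsilon> < 1"
  shows "spread nrm (x (s + k)) \<le> (1 - \<epsilon>) * spread nrm (x s) + 2 * (\<Sum>t=s..<s+k. e t)"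
proof (rule spread_le)
  fix a b
  let ?A = "\<lambda>i. \<Sum>l\<in>UNIV. trans_mat W s k $ i $ l *\<^sub>R x s l"
  note u = perturbed_consensus_unroll[where x = x and W = W and s = s and k = k and e = e, OF W e]
  have "nrm (?A a - ?A b) \<le> (1 - \<epsilon>) * spread nrm (x s)"
    by (rule averages_contract[where j = j]) (use trans_mat_stochastic[OF W] \<epsilon> in auto)
  moreover have "nrm (x (s + k) a - x (s + k) b)
      \<le> nrm (x (s + k) a - ?A a) + nrm (?A a - ?A b) + nrm (?A b - x (s + k) b)"
    using nrm_triangle_via[OF nrm, of "x (s + k) a" "x (s + k) b" "?A a"]
      nrm_triangle_via[OF nrm, of "?A a" "x (s + k) b" "?A b"] by linarith
  moreover have "nrm (?A b - x (s + k) b) = nrm (x (s + k) b - ?A b)"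
    by (rule nrm_minus_commute[OF nrm])
  ultimately show "nrm (x (s + k) a - x (s + k) b)
      \<le> (1 - \<epsilon>) * spread nrm (x s) + 2 * (\<Sum>t=s..<s+k. e t)"
    using u[of a] u[of b] by linarith
qed

end

text \<open>
  A contraction over every window of length \<open>N\<close> is summed against a nonincreasing weight: shifting
  by \<open>N\<close> costs nothing, since \<open>a (u + N) \<le> a u\<close>, and each error enters at most \<open>N\<close> windows.
\<close>

lemma weighted_sum_of_window_contraction:
  fixes V e a :: "nat \<Rightarrow> real"
  assumes V: "\<And>t. 0 \<le> V t" and e: "\<And>t. 0 \<le> e t" and a: "\<And>t. 0 \<le> a t"
    and anti: "\<And>s t. 1 \<le> s \<Longrightarrow> s \<le> t \<Longrightarrow> a t \<le> a s"
    and \<epsilon>: "0 \<le> \<epsilon>" "\<epsilon> \<le> 1"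
    and contr: "\<And>s. 1 \<le> s \<Longrightarrow> s + N \<le> T \<Longrightarrow> V (s + N) \<le> (1 - \<epsilon>) * V s + 2 * (\<Sum>t=s..<s+N. e t)"
    and growth: "\<And>k. 1 + k \<le> T \<Longrightarrow> V (1 + k) \<le> V 1 + 2 * (\<Sum>t=1..<1+k. e t)"
  shows "\<epsilon> * (\<Sum>t=1..T. a t * V t) \<le> real N * (a 1 * V 1) + 4 * real N * (\<Sum>t=1..<T. a t * e t)"
proof -
  define S where "S = (\<Sum>t=1..<T. a t * e t)"
  have S: "(\<Sum>t\<in>I. a t * e t) \<le> S" if "I \<subseteq> {1..<T}" for I
    unfolding S_def using that a e by (intro sum_mono2) auto
  have S0: "0 \<le> S" using S[of "{}"] by simp
  have weigh: "a t * (\<Sum>r=s..<t. e r) \<le> (\<Sum>r=s..<t. a r * e r)" if "1 \<le> s" for s t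
    unfolding sum_distrib_left using anti that e by (intro sum_mono mult_right_mono) auto
  have head: "a t * V t \<le> a 1 * V 1 + 2 * S" if "t \<in> {1..min N T}" for t
  proof -
    have t: "1 + (t - 1) = t" "1 \<le> t" "t \<le> T" using that by auto
    have "a t * V t \<le> a t * (V 1 + 2 * (\<Sum>r=1..<t. e r))"
      using growth[of "t - 1"] t a by (intro mult_left_mono) auto
    also have "\<dots> \<le> a 1 * V 1 + 2 * (\<Sum>r=1..<t. a r * e r)"
      using weigh[of 1 t] mult_right_mono[OF anti[of 1 t] V[of 1]] t by (simp add: algebra_simps)
    also have "(\<Sum>r=1..<t. a r * e r) \<le> S" using t by (intro S) auto
    finally show ?thesis by simp
  qed
  have tail: "a (u + N) * V (u + N) \<le> (1 - \<epsilon>) * (a u * V u) + 2 * (\<Sum>r<N. a (u + r) * e (u + r))"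
    if "u \<in> {1..T - N}" for u
  proof -
    have u: "1 \<le> u" "u + N \<le> T" using that by auto
    have "a (u + N) * V (u + N) \<le> a (u + N) * ((1 - \<epsilon>) * V u + 2 * (\<Sum>r=u..<u+N. e r))"
      using contr[OF u] a by (intro mult_left_mono) auto
    also have "\<dots> = (1 - \<epsilon>) * (a (u + N) * V u) + 2 * (a (u + N) * (\<Sum>r=u..<u+N. e r))"
      by (simp add: algebra_simps)
    also have "\<dots> \<le> (1 - \<epsilon>) * (a u * V u) + 2 * (\<Sum>r=u..<u+N. a r * e r)"
      using weigh[OF u(1), of "u + N"] mult_right_mono[OF anti[OF u(1), of "u + N"] V[of u]] \<epsilon>
      by (intro add_mono mult_left_mono) auto
    also have "(\<Sum>r=u..<u+N. a r * e r) = (\<Sum>r<N. a (u + r) * e (u + r))"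
      using sum.shift_bounds_nat_ivl[of "\<lambda>r. a r * e r" 0 u N]
      by (simp add: add.commute atLeast0LessThan)
    finally show ?thesis .
  qed
  have split: "{1..T} = {1..min N T} \<union> (\<lambda>u. u + N) ` {1..T - N}"
  proof (intro set_eqI iffI)
    fix t assume "t \<in> {1..T}"
    then show "t \<in> {1..min N T} \<union> (\<lambda>u. u + N) ` {1..T - N}"
      by (cases "t \<le> N") (auto intro!: image_eqI[of _ _ "t - N"])
  qed auto
  have total: "(\<Sum>t=1..T. a t * V t)
      = (\<Sum>t=1..min N T. a t * V t) + (\<Sum>u=1..T - N. a (u + N) * V (u + N))"
    unfolding split by (subst sum.union_disjoint, simp, simp, fastforce, subst sum.reindex) simp_all
  have "(\<Sum>t=1..min N T. a t * V t) \<le> real (min N T) * (a 1 * V 1 + 2 * S)"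
    using sum_bounded_above[of "{1..min N T}" "\<lambda>t. a t * V t", OF head] by simp
  also have "\<dots> \<le> real N * (a 1 * V 1 + 2 * S)"
    using a V S0 by (intro mult_right_mono) auto
  finally have first: "(\<Sum>t=1..min N T. a t * V t) \<le> real N * (a 1 * V 1 + 2 * S)" .
  have "(\<Sum>u=1..T - N. a (u + N) * V (u + N))
      \<le> (\<Sum>u=1..T - N. (1 - \<epsilon>) * (a u * V u) + 2 * (\<Sum>r<N. a (u + r) * e (u + r)))"
    by (intro sum_mono tail)
  also have "\<dots> = (1 - \<epsilon>) * (\<Sum>u=1..T - N. a u * V u)
      + 2 * (\<Sum>r<N. \<Sum>u=1..T - N. a (u + r) * e (u + r))"
    by (simp add: sum.distrib sum_distrib_left sum.swap[of _ "{..<N}"])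
  finally have rest: "(\<Sum>u=1..T - N. a (u + N) * V (u + N))
      \<le> (1 - \<epsilon>) * (\<Sum>u=1..T - N. a u * V u)
        + 2 * (\<Sum>r<N. \<Sum>u=1..T - N. a (u + r) * e (u + r))" .
  have shifted: "(1 - \<epsilon>) * (\<Sum>u=1..T - N. a u * V u) \<le> (1 - \<epsilon>) * (\<Sum>u=1..T. a u * V u)"
    using a V \<epsilon> by (intro mult_left_mono sum_mono2) auto
  have "(\<Sum>r<N. \<Sum>u=1..T - N. a (u + r) * e (u + r)) \<le> (\<Sum>r<N. S)"
  proof (intro sum_mono)
    fix r assume "r \<in> {..<N}"
    have "(\<Sum>u=1..T - N. a (u + r) * e (u + r)) = (\<Sum>t\<in>(\<lambda>u. u + r) ` {1..T - N}. a t * e t)"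
      by (subst sum.reindex) simp_all
    also have "\<dots> \<le> S" using \<open>r \<in> {..<N}\<close> by (intro S) auto
    finally show "(\<Sum>u=1..T - N. a (u + r) * e (u + r)) \<le> S" .
  qed
  then have errors: "(\<Sum>r<N. \<Sum>u=1..T - N. a (u + r) * e (u + r)) \<le> real N * S" by simp
  have "(\<Sum>t=1..T. a t * V t) \<le> real N * (a 1 * V 1 + 2 * S)
      + (1 - \<epsilon>) * (\<Sum>t=1..T. a t * V t) + 2 * (real N * S)"
    using total first rest shifted errors by linarith
  then show ?thesis by (simp add: S_def algebra_simps)
qed

section \<open>The mirror descent step\<close>

lemma directional_derivative_within_convex:
  fixes Phi :: "real^'n \<Rightarrow> real"
  assumes "convex X" "p \<in> X" "x \<in> X"
    and "(Phi has_derivative (\<lambda>h. q \<bullet> h)) (at p within X)"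
  shows "((\<lambda>s. (Phi (p + s *\<^sub>R (x - p)) - Phi p) / s) \<longlongrightarrow> q \<bullet> (x - p)) (at_right 0)"
proof -
  let ?l = "\<lambda>s::real. p + s *\<^sub>R (x - p)"
  have seg: "?l ` {0..1} \<subseteq> X"
  proof clarify
    fix s :: real assume "s \<in> {0..1}"
    then have "(1 - s) *\<^sub>R p + s *\<^sub>R x \<in> X" using assms by (auto simp: convex_alt)
    then show "?l s \<in> X" by (simp add: algebra_simps)
  qed
  have "(?l has_derivative (\<lambda>s. s *\<^sub>R (x - p))) (at 0 within {0..1})"
    by (auto intro!: derivative_eq_intros)
  moreover have "(Phi has_derivative (\<lambda>h. q \<bullet> h)) (at (?l 0) within ?l ` {0..1})"
    using has_derivative_subset[OF assms(4) seg] by simp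
  ultimately have "((\<lambda>s. Phi (?l s)) has_derivative (\<lambda>s. q \<bullet> (s *\<^sub>R (x - p)))) (at 0 within {0..1})"
    by (rule has_derivative_in_compose)
  then have "((\<lambda>s. Phi (?l s)) has_field_derivative (q \<bullet> (x - p))) (at 0 within {0..1})"
    by (simp add: has_field_derivative_def mult_commute_abs)
  then show ?thesis
    by (simp add: has_field_derivative_iff at_within_Icc_at_right)
qed

lemma three_point_identity:
  "(dPhi p - dPhi y) \<bullet> (x - p)
    = bregman_div Phi dPhi x y - bregman_div Phi dPhi x p - bregman_div Phi dPhi p y"
  by (simp add: bregman_div_def algebra_simps)

text \<open>
  First-order optimality along the segment from the minimiser \<open>p\<close> to \<open>x\<close>: the convex part
  \<open>\<psi>\<close> is bounded by its chord, only the Bregman term is differentiated.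
\<close>

lemma mirror_step_optimality:
  fixes Phi \<psi> :: "real^'n \<Rightarrow> real"
  assumes X: "convex X" and \<psi>: "convex_on X \<psi>" and x: "x \<in> X" and a: "a > 0"
    and der: "(Phi has_derivative (\<lambda>h. dPhi p \<bullet> h)) (at p within X)"
    and min: "is_arg_min (\<lambda>z. w \<bullet> z + 1 / a * bregman_div Phi dPhi z y + \<psi> z) (\<lambda>z. z \<in> X) p"
  shows "a * (w \<bullet> (p - x) + \<psi> p - \<psi> x) \<le> (dPhi p - dPhi y) \<bullet> (x - p)"
proof -
  have p: "p \<in> X" using min by (simp add: is_arg_min_def)
  let ?c = "dPhi y \<bullet> (x - p) + a * (w \<bullet> (p - x) + \<psi> p - \<psi> x)"
  have "?c \<le> (Phi (p + s *\<^sub>R (x - p)) - Phi p) / s" if s: "0 < s" "s < 1" for s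
  proof -
    let ?z = "p + s *\<^sub>R (x - p)"
    have z: "?z = (1 - s) *\<^sub>R p + s *\<^sub>R x" by (simp add: algebra_simps)
    have "?z \<in> X" unfolding z using X p x s by (auto simp: convex_alt)
    then have "w \<bullet> p + 1 / a * bregman_div Phi dPhi p y + \<psi> p
        \<le> w \<bullet> ?z + 1 / a * bregman_div Phi dPhi ?z y + \<psi> ?z"
      using min by (auto simp: is_arg_min_def not_less)
    moreover have "\<psi> ?z \<le> (1 - s) * \<psi> p + s * \<psi> x"
      unfolding z using convex_onD[OF \<psi>, of s p x] s p x by simp
    ultimately have "0 \<le> s * (w \<bullet> (x - p)) + s * (\<psi> x - \<psi> p)
        + 1 / a * (bregman_div Phi dPhi ?z y - bregman_div Phi dPhi p y)"
      by (simp add: algebra_simps inner_add_right inner_diff_right)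
    also have "bregman_div Phi dPhi ?z y - bregman_div Phi dPhi p y
        = Phi ?z - Phi p - s * (dPhi y \<bullet> (x - p))"
      by (simp add: bregman_div_def inner_diff_right inner_add_right)
    finally have "0 \<le> a * (s * (w \<bullet> (x - p)) + s * (\<psi> x - \<psi> p)
        + 1 / a * (Phi ?z - Phi p - s * (dPhi y \<bullet> (x - p))))"
      using a by simp
    also have "\<dots> = a * s * (w \<bullet> (x - p)) + a * s * (\<psi> x - \<psi> p) + (Phi ?z - Phi p - s * (dPhi y \<bullet> (x - p)))"
      using a by (simp add: distrib_left)
    finally have "s * ?c \<le> Phi ?z - Phi p"
      by (simp add: algebra_simps inner_diff_right)
    then show ?thesis using s by (simp add: le_divide_eq mult.commute)
  qed
  then have "\<forall>\<^sub>F s in at_right 0. ?c \<le> (Phi (p + s *\<^sub>R (x - p)) - Phi p) / s"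
    using eventually_at_right[of 0 "1::real"] by (auto intro!: exI[of _ 1])
  then have "?c \<le> dPhi p \<bullet> (x - p)"
    by (intro tendsto_lowerbound[OF directional_derivative_within_convex[OF X p x der]]) auto
  then show ?thesis by (simp add: inner_diff_left)
qed

text \<open>
  Testing optimality against \<open>y\<close> itself, with strong convexity used at both ends of the segment, bounds
  the square of the displacement by a multiple of \<open>a\<close> times the displacement.
\<close>

lemma mirror_step_displacement:
  fixes Phi \<psi> :: "real^'n \<Rightarrow> real"
  assumes nrm: "is_norm nrm" and X: "convex X" and \<psi>: "convex_on X \<psi>" and y: "y \<in> X" and a: "a > 0"
    and der: "(Phi has_derivative (\<lambda>h. dPhi p \<bullet> h)) (at p within X)"
    and min: "is_arg_min (\<lambda>z. w \<bullet> z + 1 / a * bregman_div Phi dPhi z y + \<psi> z) (\<lambda>z. z \<in> X) p"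
    and \<sigma>: "\<sigma> > 0"
    and strong: "\<And>x z. x \<in> X \<Longrightarrow> z \<in> X \<Longrightarrow> Phi z + dPhi z \<bullet> (x - z) + \<sigma> / 2 * (nrm (x - z))\<^sup>2 \<le> Phi x"
    and lip: "\<bar>\<psi> p - \<psi> y\<bar> \<le> L * nrm (p - y)" "0 \<le> L"
    and w: "dual_norm nrm w \<le> b"
  shows "nrm (p - y) \<le> a * ((b + L) / \<sigma>)"
proof (cases "p = y")
  case True
  have "0 \<le> b" using dual_norm_nonneg[OF nrm, of w] w by linarith
  then show ?thesis using True lip a \<sigma> by (simp add: nrm_zero[OF nrm])
next
  case False
  then have pos: "0 < nrm (p - y)" by (intro nrm_pos[OF nrm]) simp
  have p: "p \<in> X" using min by (simp add: is_arg_min_def)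
  have "\<sigma> * (nrm (p - y))\<^sup>2 \<le> (dPhi p - dPhi y) \<bullet> (p - y)"
    using strong[OF p y] strong[OF y p] nrm_minus_commute[OF nrm, of p y]
    by (simp add: algebra_simps)
  also have "\<dots> \<le> - (a * (w \<bullet> (p - y) + \<psi> p - \<psi> y))"
    using mirror_step_optimality[OF X \<psi> y a der min]
    by (simp add: inner_diff_right)
  also have "\<dots> \<le> a * ((b + L) * nrm (p - y))"
  proof -
    have "\<bar>w \<bullet> (p - y)\<bar> \<le> b * nrm (p - y)"
      using dual_norm_holder[OF nrm, of w "p - y"]
        mult_right_mono[OF w nrm_nonneg[OF nrm, of "p - y"]] by linarith
    then have "- (w \<bullet> (p - y) + \<psi> p - \<psi> y) \<le> (b + L) * nrm (p - y)"
      using lip(1) by (simp add: distrib_right)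
    from mult_left_mono[OF this less_imp_le[OF a]] show ?thesis
      by (simp only: mult_minus_right)
  qed
  finally have "nrm (p - y) * (\<sigma> * nrm (p - y)) \<le> nrm (p - y) * (a * (b + L))"
    by (simp add: power2_eq_square algebra_simps)
  then have "\<sigma> * nrm (p - y) \<le> a * (b + L)" using pos by simp
  then show ?thesis using \<sigma> by (simp add: field_simps)
qed

lemma is_arg_min_mem: "is_arg_min h P z \<Longrightarrow> P z"
  by (simp add: is_arg_min_def)

section \<open>The problem and a single trajectory\<close>

locale dcsmd_problem =
  fixes nrm :: "real^'n \<Rightarrow> real"
    and X U :: "(real^'n) set"
    and f \<psi> :: "'m::finite \<Rightarrow> real^'n \<Rightarrow> real"
    and Phi :: "real^'n \<Rightarrow> real" and dPhi :: "real^'n \<Rightarrow> real^'n"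
    and W :: "nat \<Rightarrow> real^'m^'m"
    and xstar :: "real^'n" and B :: nat and \<eta> G G\<psi> \<sigma> :: real
  assumes nrm: "is_norm nrm"
    and convex_X: "convex X" and X_U: "X \<subseteq> U"
    and convex_f: "\<And>i. convex_on U (f i)"
    and xstar: "xstar \<in> X" and minimal: "\<And>z. z \<in> X \<Longrightarrow> objective f \<psi> z \<ge> objective f \<psi> xstar"
    and net: "network_assumption W B \<eta>"
    and bounded: "boundedness_assumption nrm X U f \<psi> G G\<psi>"
    and bregman: "bregman_assumption TYPE('m) nrm X Phi dPhi \<sigma>"
begin

abbreviation D :: "real^'n \<Rightarrow> real^'n \<Rightarrow> real" where
  "D \<equiv> bregman_div Phi dPhi"

lemma G_pos: "0 < G" and G\<psi>_pos: "0 < G\<psi>" and convex_\<psi>: "convex_on X (\<psi> i)"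
  and subgradient_bound: "x \<in> X \<Longrightarrow> v \<in> subdifferential U (f i) x \<Longrightarrow> dual_norm nrm v \<le> G"
  and \<psi>_lipschitz: "x \<in> X \<Longrightarrow> y \<in> X \<Longrightarrow> \<bar>\<psi> i x - \<psi> i y\<bar> \<le> G\<psi> * nrm (x - y)"
  using bounded by (auto simp: boundedness_assumption_def)

lemma \<sigma>_pos: "0 < \<sigma>"
  and derivative: "x \<in> X \<Longrightarrow> (Phi has_derivative (\<lambda>h. dPhi x \<bullet> h)) (at x within X)"
  and strongly_convex: "x \<in> X \<Longrightarrow> y \<in> X \<Longrightarrow>
      Phi y + dPhi y \<bullet> (x - y) + \<sigma> / 2 * (nrm (x - y))\<^sup>2 \<le> Phi x"
  using bregman by (auto simp: bregman_assumption_def)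

lemma bregman_average:
  fixes a :: "'m \<Rightarrow> real"
  assumes "z \<in> X" "\<And>j. y j \<in> X" "\<And>j. 0 \<le> a j" "(\<Sum>j\<in>UNIV. a j) = 1"
  shows "D z (\<Sum>j\<in>UNIV. a j *\<^sub>R y j) \<le> (\<Sum>j\<in>UNIV. a j * D z (y j))"
  using bregman assms unfolding bregman_assumption_def by blast

lemma bregman_lower: "x \<in> X \<Longrightarrow> y \<in> X \<Longrightarrow> \<sigma> / 2 * (nrm (x - y))\<^sup>2 \<le> D x y"
  using strongly_convex[of x y] by (simp add: bregman_div_def)

lemma bregman_nonneg: "x \<in> X \<Longrightarrow> y \<in> X \<Longrightarrow> 0 \<le> D x y"
  by (rule order.trans[OF _ bregman_lower]) (use \<sigma>_pos in auto)

lemma convex_U: "convex U"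
  using convex_f by (auto simp: convex_on_def)

lemma objective_Jensen:
  assumes T: "1 \<le> (T::nat)" and z: "\<And>t. t \<in> {1..T} \<Longrightarrow> z t \<in> X"
  shows "objective f \<psi> ((1 / real T) *\<^sub>R (\<Sum>t=1..T. z t)) \<le> (1 / real T) * (\<Sum>t=1..T. objective f \<psi> (z t))"
    and "(1 / real T) *\<^sub>R (\<Sum>t=1..T. z t) \<in> X"
proof -
  have one: "(\<Sum>t=1..T. 1 / real T) = 1" using T by simp
  have J: "h ((1 / real T) *\<^sub>R (\<Sum>t=1..T. z t)) \<le> (1 / real T) * (\<Sum>t=1..T. h (z t))"
    if "convex_on X h" for h
    using convex_on_sum[of "{1..T}" X h "\<lambda>_. 1 / real T" z, OF _ _ that one] T z
    by (simp add: scaleR_sum_right sum_distrib_left)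
  have fX: "convex_on X (f i)" for i using convex_f X_U convex_X convex_on_subset by blast
  have "objective f \<psi> ((1 / real T) *\<^sub>R (\<Sum>t=1..T. z t))
      \<le> (\<Sum>i\<in>UNIV. (1 / real T) * (\<Sum>t=1..T. f i (z t))) + (\<Sum>i\<in>UNIV. (1 / real T) * (\<Sum>t=1..T. \<psi> i (z t)))"
    unfolding objective_def by (intro add_mono sum_mono J fX convex_\<psi>)
  also have "\<dots> = (1 / real T) * (\<Sum>t=1..T. objective f \<psi> (z t))"
    unfolding objective_def sum_distrib_left[symmetric] sum.distrib distrib_left
    by (simp only: sum.swap[of _ _ "{1..T}"])
  finally show "objective f \<psi> ((1 / real T) *\<^sub>R (\<Sum>t=1..T. z t)) \<le> (1 / real T) * (\<Sum>t=1..T. objective f \<psi> (z t))" .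
  show "(1 / real T) *\<^sub>R (\<Sum>t=1..T. z t) \<in> X"
    using convex_sum[of "{1..T}" X "\<lambda>_. 1 / real T" z, OF _ convex_X one] z
    by (simp add: scaleR_sum_right)
qed

text \<open>
  By \<open>trans_mat_positive\<close>, averaging over \<open>mixing_time\<close> rounds shrinks the spread by the factor
  \<open>1 - mixing_rate\<close>.
\<close>

definition mixing_time :: nat where "mixing_time = (CARD('m) + 1) * B"
definition mixing_rate :: real where "mixing_rate = \<eta> ^ mixing_time"

lemma mixing_rate: "0 < mixing_rate" "mixing_rate < 1"
  using net_params[OF net] by (auto simp: mixing_rate_def mixing_time_def power_less_one_iff)

end

text \<open>
  One trajectory of the algorithm, at a fixed sample point. The estimates on it take the bounds on the
  noise and on its weighted partial sums as hypotheses, which will hold with high probability.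
\<close>

locale dcsmd_path = dcsmd_problem nrm X U f \<psi> Phi dPhi W xstar B \<eta> G G\<psi> \<sigma>
  for nrm :: "real^'n \<Rightarrow> real"
    and X U and f \<psi> :: "'m::finite \<Rightarrow> real^'n \<Rightarrow> real" and Phi dPhi
    and W :: "nat \<Rightarrow> real^'m^'m" and xstar B \<eta> G G\<psi> \<sigma> +
  fixes \<alpha> :: "nat \<Rightarrow> real" and x y g \<xi> :: "'m \<Rightarrow> nat \<Rightarrow> real^'n"
  assumes \<alpha>_pos: "\<And>t. 0 < \<alpha> t" and \<alpha>_antimono: "\<And>s t. s \<le> t \<Longrightarrow> \<alpha> t \<le> \<alpha> s"
    and x_init: "\<And>i. x i 1 \<in> X"
    and y_def: "\<And>t i. 1 \<le> t \<Longrightarrow> y i t = (\<Sum>j\<in>UNIV. W t $ i $ j *\<^sub>R x j t)"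
    and g_sub: "\<And>t i. 1 \<le> t \<Longrightarrow> g i t \<in> subdifferential U (f i) (x i t)"
    and x_step: "\<And>t i. 1 \<le> t \<Longrightarrow>
      is_arg_min (\<lambda>z. (g i t - \<xi> i t) \<bullet> z + 1 / \<alpha> t * bregman_div Phi dPhi z (y i t) + \<psi> i z)
        (\<lambda>z. z \<in> X) (x i (t + 1))"
begin

definition Z :: "nat \<Rightarrow> real" where "Z t = (\<Sum>i\<in>UNIV. D xstar (x i t))"
definition noise :: "nat \<Rightarrow> real" where "noise t = (\<Sum>i\<in>UNIV. \<xi> i t \<bullet> (y i t - xstar))"
definition gap :: "'m \<Rightarrow> nat \<Rightarrow> real" where "gap l t = objective f \<psi> (x l t) - objective f \<psi> xstar"
definition disagreement :: "nat \<Rightarrow> real" where "disagreement t = spread nrm (\<lambda>i. x i t)"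

lemma W_stochastic: "1 \<le> t \<Longrightarrow> doubly_stochastic (W t)"
  by (rule net_stochastic[OF net])

lemma x_in_X: "1 \<le> t \<Longrightarrow> x i t \<in> X"
proof (induction t rule: dec_induct)
  case base then show ?case by (rule x_init)
next
  case (step t)
  have "x i (t + 1) \<in> X" using x_step[OF step(1)] by (rule is_arg_min_mem)
  then show ?case by simp
qed

lemma y_in_X: "1 \<le> t \<Longrightarrow> y i t \<in> X"
  unfolding y_def using W_stochastic[of t] x_in_X convex_X
  by (intro convex_sum) (auto simp: doubly_stochastic_def)

lemma x_interior:
  assumes t: "1 \<le> t"
  shows "x i t \<in> interior U"
  using subsetD[OF X_U x_in_X[OF t]] g_sub[OF t] subgradient_bound[OF x_in_X[OF t]]
  by (rule bounded_subdifferential_imp_interior[OF nrm convex_U])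

lemma gap_nonneg: "1 \<le> t \<Longrightarrow> 0 \<le> gap l t"
  using minimal[OF x_in_X] by (simp add: gap_def)

lemma Z_nonneg: "1 \<le> t \<Longrightarrow> 0 \<le> Z t"
  unfolding Z_def by (intro sum_nonneg bregman_nonneg xstar x_in_X)

lemma disagreement_nonneg: "0 \<le> disagreement t"
  unfolding disagreement_def by (rule spread_nonneg[OF nrm])

lemma disagreement_y: "1 \<le> t \<Longrightarrow> nrm (y i t - x l t) \<le> disagreement t"
proof -
  assume t: "1 \<le> t"
  have w: "\<And>j. 0 \<le> W t $ i $ j" "(\<Sum>j\<in>UNIV. W t $ i $ j) = 1"
    using W_stochastic[OF t] by (auto simp: doubly_stochastic_def)
  have "y i t - x l t = (\<Sum>j\<in>UNIV. W t $ i $ j *\<^sub>R (x j t - x l t))"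
    using t w by (simp add: y_def scaleR_diff_right sum_subtractf scaleR_sum_left[symmetric])
  also have "nrm \<dots> \<le> (\<Sum>j\<in>UNIV. W t $ i $ j * disagreement t)"
    using w by (intro order.trans[OF nrm_sum[OF nrm]] sum_mono)
      (auto simp: nrm_scaleR[OF nrm] disagreement_def intro!: mult_left_mono spread_ge)
  finally show ?thesis using w by (simp add: sum_distrib_right[symmetric])
qed

lemma Z_average: "1 \<le> t \<Longrightarrow> (\<Sum>i\<in>UNIV. D xstar (y i t)) \<le> Z t"
proof -
  assume t: "1 \<le> t"
  note w = W_stochastic[OF t, unfolded doubly_stochastic_def]
  have "(\<Sum>i\<in>UNIV. D xstar (y i t)) \<le> (\<Sum>i\<in>UNIV. \<Sum>j\<in>UNIV. W t $ i $ j * D xstar (x j t))"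
    unfolding y_def[OF t] using w x_in_X[OF t] by (intro sum_mono bregman_average xstar) auto
  also have "\<dots> = (\<Sum>j\<in>UNIV. (\<Sum>i\<in>UNIV. W t $ i $ j) * D xstar (x j t))"
    by (subst sum.swap) (simp add: sum_distrib_right)
  finally show ?thesis using w by (simp add: Z_def)
qed

text \<open>
  The distance of \<open>y i t\<close> to the minimiser is controlled by the potential itself: on an
  unbounded domain this is the only bound on the coefficients of the noise.
\<close>

lemma y_distance: "1 \<le> t \<Longrightarrow> nrm (y i t - xstar) \<le> sqrt (2 / \<sigma>) * sqrt (Z t)"
proof -
  assume t: "1 \<le> t"
  have "\<sigma> / 2 * (nrm (y i t - xstar))\<^sup>2 \<le> D xstar (y i t)"
    using bregman_lower[OF xstar y_in_X[OF t], of i] nrm_minus_commute[OF nrm] by simp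
  also have "\<dots> \<le> (\<Sum>i\<in>UNIV. D xstar (y i t))"
    by (intro member_le_sum bregman_nonneg xstar y_in_X t) auto
  also have "\<dots> \<le> Z t" by (rule Z_average[OF t])
  finally have "(nrm (y i t - xstar))\<^sup>2 \<le> 2 / \<sigma> * Z t"
    using \<sigma>_pos by (simp add: field_simps)
  then have "nrm (y i t - xstar) \<le> sqrt (2 / \<sigma> * Z t)" by (rule real_le_rsqrt)
  then show ?thesis by (simp only: real_sqrt_mult)
qed

text \<open>
  The factor that, multiplied by the stepsize, bounds the displacement of an agent when all noise
  vectors have dual norm at most \<open>K\<close>.
\<close>

definition drift :: "real \<Rightarrow> real" where "drift K = (G + K + G\<psi>) / \<sigma>"

lemma displacement:
  assumes t: "1 \<le> t" and K: "dual_norm nrm (\<xi> i t) \<le> K"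
  shows "nrm (x i (t + 1) - y i t) \<le> \<alpha> t * drift K"
proof -
  have "dual_norm nrm (g i t - \<xi> i t) \<le> G + K"
    using dual_norm_diff[OF nrm, of "g i t" "\<xi> i t"] K
      subgradient_bound[OF x_in_X[OF t] g_sub[OF t], of i] by linarith
  from mirror_step_displacement[OF nrm convex_X convex_\<psi> y_in_X[OF t] \<alpha>_pos derivative
      x_step[OF t] \<sigma>_pos strongly_convex \<psi>_lipschitz _ this]
  show ?thesis using x_in_X[of "t + 1" i] y_in_X[OF t] G\<psi>_pos by (auto simp: drift_def)
qed

text \<open>
  The gap is measured at the iterate of one fixed agent \<open>l\<close>, since the theorem concerns the average of a
  single agent. Moving \<open>f i\<close> and \<open>\<psi> i\<close> from the iterates of agent \<open>i\<close> to those of \<open>l\<close> costs the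
  disagreement. The noise is paired with \<open>y i t - xstar\<close>, which is known before the noise is drawn; the
  remaining pairing with the displacement is of second order in the stepsize.
\<close>

lemma agent_step:
  assumes t: "1 \<le> t" and K: "dual_norm nrm (\<xi> i t) \<le> K"
  shows "D xstar (x i (t + 1)) \<le> D xstar (y i t)
    + \<alpha> t * (f i xstar + \<psi> i xstar - (f i (x l t) + \<psi> i (x l t)) + \<xi> i t \<bullet> (y i t - xstar)
      + (2 * G + G\<psi>) * disagreement t + \<alpha> t * \<sigma> * (drift K)\<^sup>2)"
proof -
  let ?p = "x i (t + 1)" and ?y = "y i t" and ?V = "disagreement t" and ?w = "g i t - \<xi> i t"
  have p: "?p \<in> X" using x_in_X[of "t + 1"] by simp
  note y = y_in_X[OF t, of i]
  define A where "A = ?w \<bullet> (?p - xstar) + \<psi> i ?p - \<psi> i xstar"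
  define R where "R = f i xstar + \<psi> i xstar - (f i (x l t) + \<psi> i (x l t)) + \<xi> i t \<bullet> (?y - xstar)
    + (2 * G + G\<psi>) * ?V + \<alpha> t * \<sigma> * (drift K)\<^sup>2"
  have opt: "\<alpha> t * A \<le> D xstar ?y - D xstar ?p - D ?p ?y" unfolding A_def
    using mirror_step_optimality[OF convex_X convex_\<psi> xstar \<alpha>_pos derivative[OF p] x_step[OF t]]
      three_point_identity[of dPhi ?p ?y xstar Phi] by linarith
  have disp: "nrm (?p - ?y) \<le> \<alpha> t * drift K" by (rule displacement[OF t K])
  have K0: "0 \<le> K" using K dual_norm_nonneg[OF nrm, of "\<xi> i t"] by linarith
  have dw: "dual_norm nrm ?w \<le> G + K"
    using dual_norm_diff[OF nrm, of "g i t" "\<xi> i t"] K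
      subgradient_bound[OF x_in_X[OF t] g_sub[OF t], of i] by linarith
  have "\<bar>?w \<bullet> (?p - ?y)\<bar> \<le> (G + K) * (\<alpha> t * drift K)"
    by (rule order.trans[OF dual_norm_holder[OF nrm] mult_mono[OF dw disp]])
      (use G_pos K0 nrm_nonneg[OF nrm] in auto)
  moreover have "\<bar>\<psi> i ?p - \<psi> i ?y\<bar> \<le> G\<psi> * (\<alpha> t * drift K)"
    by (rule order.trans[OF \<psi>_lipschitz[OF p y] mult_left_mono[OF disp]]) (use G\<psi>_pos in auto)
  moreover have "\<bar>\<psi> i ?y - \<psi> i (x l t)\<bar> \<le> G\<psi> * ?V"
    by (rule order.trans[OF \<psi>_lipschitz[OF y x_in_X[OF t]] mult_left_mono[OF disagreement_y[OF t]]])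
      (use G\<psi>_pos in auto)
  moreover have "f i (x i t) + g i t \<bullet> (xstar - x i t) \<le> f i xstar"
    using g_sub[OF t, of i] xstar X_U by (auto simp: subdifferential_def)
  moreover have "\<bar>g i t \<bullet> (?y - x i t)\<bar> \<le> G * ?V"
    by (rule order.trans[OF dual_norm_holder[OF nrm]
          mult_mono[OF subgradient_bound[OF x_in_X[OF t] g_sub[OF t]] disagreement_y[OF t]]])
      (use G_pos nrm_nonneg[OF nrm] in auto)
  moreover have "f i (x l t) - G * nrm (x i t - x l t) \<le> f i (x i t)"
    using x_in_X[OF t] X_U
    by (intro subgradient_lipschitz_interior[OF nrm convex_f x_interior[OF t]] subgradient_bound) auto
  moreover have "G * nrm (x i t - x l t) \<le> G * ?V"
    using G_pos spread_ge[of nrm "\<lambda>i. x i t" i l] by (simp add: disagreement_def)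
  moreover have "(G + K) * (\<alpha> t * drift K) + G\<psi> * (\<alpha> t * drift K) = \<alpha> t * \<sigma> * (drift K)\<^sup>2"
  proof -
    have "G + K + G\<psi> = \<sigma> * drift K" using \<sigma>_pos by (simp add: drift_def)
    then have "(G + K + G\<psi>) * (\<alpha> t * drift K) = \<sigma> * drift K * (\<alpha> t * drift K)" by (rule arg_cong)
    then show ?thesis by (simp add: power2_eq_square algebra_simps)
  qed
  moreover have "?w \<bullet> (?p - xstar) = ?w \<bullet> (?p - ?y) + g i t \<bullet> (?y - x i t)
      - g i t \<bullet> (xstar - x i t) - \<xi> i t \<bullet> (?y - xstar)"
    by (simp add: inner_diff_left inner_diff_right)
  moreover have "(2 * G + G\<psi>) * ?V = 2 * (G * ?V) + G\<psi> * ?V" by (simp add: distrib_right)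
  moreover define c1 c2 c3 v1 v2 where "c1 = (G + K) * (\<alpha> t * drift K)"
    and "c2 = G\<psi> * (\<alpha> t * drift K)" and "c3 = \<alpha> t * \<sigma> * (drift K)\<^sup>2"
    and "v1 = G * ?V" and "v2 = G\<psi> * ?V"
  ultimately have AR: "- A \<le> R" unfolding A_def R_def c1_def[symmetric] c2_def[symmetric]
    c3_def[symmetric] v1_def[symmetric] v2_def[symmetric] by argo
  have "- (\<alpha> t * A) \<le> \<alpha> t * R"
    using mult_left_mono[OF AR less_imp_le[OF \<alpha>_pos[of t]]] by simp
  then have "D xstar ?p \<le> D xstar ?y + \<alpha> t * R"
    using opt bregman_nonneg[OF p y] by linarith
  then show ?thesis unfolding R_def .
qed

lemma Z_step:
  assumes t: "1 \<le> t" and K: "\<And>i. dual_norm nrm (\<xi> i t) \<le> K"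
  shows "Z (t + 1) \<le> Z t - \<alpha> t * gap l t + \<alpha> t * noise t
    + (real CARD('m) * (2 * G + G\<psi>) * (\<alpha> t * disagreement t)
      + real CARD('m) * \<sigma> * (drift K)\<^sup>2 * (\<alpha> t)\<^sup>2)"
proof -
  define c where "c = (2 * G + G\<psi>) * disagreement t + \<alpha> t * \<sigma> * (drift K)\<^sup>2"
  define u where "u i = f i xstar + \<psi> i xstar - (f i (x l t) + \<psi> i (x l t))" for i
  have gap: "(\<Sum>i\<in>UNIV. u i) = - gap l t"
    by (simp add: u_def gap_def objective_def sum.distrib sum_subtractf)
  have "Z (t + 1) \<le> (\<Sum>i\<in>UNIV. D xstar (y i t) + \<alpha> t * (u i + \<xi> i t \<bullet> (y i t - xstar) + c))"
    unfolding Z_def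
    by (intro sum_mono order.trans[OF agent_step[OF t K, where l = l]]) (simp add: u_def c_def add.assoc)
  also have "\<dots> = (\<Sum>i\<in>UNIV. D xstar (y i t)) + \<alpha> t * ((\<Sum>i\<in>UNIV. u i) + noise t + real CARD('m) * c)"
    by (simp add: sum.distrib sum_distrib_left[symmetric] noise_def)
  also have "\<dots> = (\<Sum>i\<in>UNIV. D xstar (y i t)) - \<alpha> t * gap l t + \<alpha> t * noise t
    + (real CARD('m) * (2 * G + G\<psi>) * (\<alpha> t * disagreement t)
      + real CARD('m) * \<sigma> * (drift K)\<^sup>2 * (\<alpha> t)\<^sup>2)"
    unfolding gap by (simp add: c_def power2_eq_square algebra_simps)
  finally show ?thesis
    by (rule order.trans) (intro add_right_mono diff_right_mono Z_average[OF t])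
qed

text \<open>
  The error of a consensus round is the displacement, itself of order \<open>\<alpha> t\<close>. Weighted by \<open>\<alpha> t\<close>, the
  disagreement therefore costs no more than the squared stepsizes.
\<close>

lemma weighted_disagreement:
  assumes K: "\<And>i t. 1 \<le> t \<Longrightarrow> t \<le> T \<Longrightarrow> dual_norm nrm (\<xi> i t) \<le> K"
  shows "mixing_rate * (\<Sum>t=1..T. \<alpha> t * disagreement t)
    \<le> real mixing_time * (\<alpha> 1 * disagreement 1) + 4 * real mixing_time * drift K * (\<Sum>t=1..T. (\<alpha> t)\<^sup>2)"
proof (cases "1 \<le> T")
  case True
  define e where "e t = \<alpha> t * drift K" for t
  have "0 \<le> K" using K[of 1 undefined] True dual_norm_nonneg[OF nrm, of "\<xi> undefined 1"] by linarith
  then have drift: "0 \<le> drift K" using G_pos G\<psi>_pos \<sigma>_pos by (simp add: drift_def)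
  then have e0: "0 \<le> e t" for t using \<alpha>_pos[of t] by (simp add: e_def)
  let ?x = "\<lambda>t i. x i t"
  have err: "nrm (x i (t + 1) - (\<Sum>j\<in>UNIV. W t $ i $ j *\<^sub>R x j t)) \<le> e t"
    if "1 \<le> t" "t \<le> T" for t i
    using displacement[OF that(1) K[OF that]] that(1) by (simp add: y_def e_def)
  have contr: "disagreement (s + mixing_time)
      \<le> (1 - mixing_rate) * disagreement s + 2 * (\<Sum>t=s..<s+mixing_time. e t)"
    if "1 \<le> s" "s + mixing_time \<le> T" for s
    unfolding disagreement_def
    by (rule spread_after_mixing[OF nrm, where x = ?x and W = W and j = undefined])
      (use that err W_stochastic mixing_rate trans_mat_positive[OF net that(1), folded mixing_time_def]
        in \<open>auto simp: mixing_rate_def\<close>)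
  have growth: "disagreement (1 + k) \<le> disagreement 1 + 2 * (\<Sum>t=1..<1+k. e t)"
    if "1 + k \<le> T" for k
    using spread_after_mixing[OF nrm, where x = ?x and W = W and s = 1 and k = k and e = e
        and \<epsilon> = 0 and j = undefined] that err W_stochastic trans_mat_stochastic(1)[of 1 W]
    by (simp add: disagreement_def)
  have main: "mixing_rate * (\<Sum>t=1..T. \<alpha> t * disagreement t)
      \<le> real mixing_time * (\<alpha> 1 * disagreement 1) + 4 * real mixing_time * (\<Sum>t=1..<T. \<alpha> t * e t)"
    by (rule weighted_sum_of_window_contraction)
      (use contr growth disagreement_nonneg e0 \<alpha>_pos \<alpha>_antimono mixing_rate in \<open>auto intro: less_imp_le\<close>)
  have "(\<Sum>t=1..<T. \<alpha> t * e t) \<le> (\<Sum>t=1..T. \<alpha> t * e t)"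
    using e0 \<alpha>_pos by (intro sum_mono2) (auto intro: mult_nonneg_nonneg less_imp_le)
  moreover have "(\<Sum>t=1..T. \<alpha> t * e t) = drift K * (\<Sum>t=1..T. (\<alpha> t)\<^sup>2)"
    by (simp add: e_def sum_distrib_left power2_eq_square algebra_simps)
  ultimately have "(\<Sum>t=1..<T. \<alpha> t * e t) \<le> drift K * (\<Sum>t=1..T. (\<alpha> t)\<^sup>2)"
    by (rule order.trans[OF _ eq_refl])
  then have "4 * real mixing_time * (\<Sum>t=1..<T. \<alpha> t * e t)
      \<le> 4 * real mixing_time * (drift K * (\<Sum>t=1..T. (\<alpha> t)\<^sup>2))"
    by (intro mult_left_mono) auto
  with main have "mixing_rate * (\<Sum>t=1..T. \<alpha> t * disagreement t)
      \<le> real mixing_time * (\<alpha> 1 * disagreement 1)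
        + 4 * real mixing_time * (drift K * (\<Sum>t=1..T. (\<alpha> t)\<^sup>2))"
    by linarith
  then show ?thesis by (simp only: mult.assoc)
qed (use disagreement_nonneg \<alpha>_pos[of 1] in \<open>simp add: less_imp_le\<close>)

end

section \<open>The square-root potential\<close>

lemma sqrt_increment_le:
  fixes a d :: real
  assumes "0 < a" "0 \<le> a + d"
  shows "sqrt (a + d) \<le> sqrt a + d / (2 * sqrt a)"
proof (rule real_le_lsqrt)
  have "0 \<le> (2 * a + d) / (2 * sqrt a)" using assms by simp
  also have "\<dots> = sqrt a + d / (2 * sqrt a)"
    using assms real_sqrt_mult_self[of a] by (simp add: add_divide_distrib real_div_sqrt)
  finally show "0 \<le> sqrt a + d / (2 * sqrt a)" .
  have "(sqrt a + d / (2 * sqrt a))\<^sup>2 = a + d + (d / (2 * sqrt a))\<^sup>2"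
    using assms by (simp add: power2_sum)
  then show "a + d \<le> (sqrt a + d / (2 * sqrt a))\<^sup>2" by simp
qed

context dcsmd_path
begin

text \<open>
  The normalisation of the noise. Dividing by it bounds the coefficients of the noise, and the summand
  \<open>A\<close> keeps the division of the deterministic errors under control.
\<close>

definition level :: "real \<Rightarrow> nat \<Rightarrow> real" where "level A t = sqrt (Z t + A)"

text \<open>
  Bounds the sum over \<open>t \<le> T\<close> of the last two terms of \<open>Z_step\<close> when all noise vectors have dual norm
  at most \<open>K\<close>.
\<close>

definition total_error :: "real \<Rightarrow> nat \<Rightarrow> real" where
  "total_error K T = real CARD('m) * (2 * G + G\<psi>)
      * ((real mixing_time * (\<alpha> 1 * disagreement 1)
          + 4 * real mixing_time * drift K * (\<Sum>t=1..T. (\<alpha> t)\<^sup>2)) / mixing_rate)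
    + real CARD('m) * \<sigma> * (drift K)\<^sup>2 * (\<Sum>t=1..T. (\<alpha> t)\<^sup>2)"

lemma level_pos: "1 \<le> t \<Longrightarrow> 0 < A \<Longrightarrow> 0 < level A t"
  using Z_nonneg[of t] by (simp add: level_def)

text \<open>
  Concavity of the square root turns \<open>Z_step\<close> into a recursion for \<open>level A\<close> with drift
  \<open>\<alpha> t * gap l t / (2 * level A t)\<close>. Unrolled, it bounds the levels and the sum of the drifts by the
  same quantity, and the product of the two bounds the weighted gaps.
\<close>

lemma weighted_gap_bound:
  assumes A: "0 < A"
    and K: "\<And>i t. 1 \<le> t \<Longrightarrow> t \<le> T \<Longrightarrow> dual_norm nrm (\<xi> i t) \<le> K"
    and a: "\<And>k. k \<le> T \<Longrightarrow> (\<Sum>t=1..k. \<alpha> t * (noise t / level A t)) \<le> a"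
  shows "(\<Sum>t=1..T. \<alpha> t * gap l t)
    \<le> 2 * (sqrt (Z 1) + sqrt A + a / 2 + total_error K T / (2 * sqrt A))\<^sup>2" (is "_ \<le> 2 * ?Q\<^sup>2")
proof -
  define b where "b t = real CARD('m) * (2 * G + G\<psi>) * (\<alpha> t * disagreement t)
      + real CARD('m) * \<sigma> * (drift K)\<^sup>2 * (\<alpha> t)\<^sup>2" for t
  have b0: "0 \<le> b t" for t
    using G_pos G\<psi>_pos \<sigma>_pos \<alpha>_pos[of t] disagreement_nonneg by (simp add: b_def)
  have step: "level A (t + 1) + \<alpha> t * gap l t / (2 * level A t)
      \<le> level A t + \<alpha> t * (noise t / level A t) / 2 + b t / (2 * sqrt A)"
    if t: "1 \<le> t" "t \<le> T" for t
  proof -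
    let ?H = "level A t" and ?d = "\<alpha> t * noise t + b t - \<alpha> t * gap l t"
    have H: "0 < ?H" by (rule level_pos[OF t(1) A])
    have ZA: "0 < Z t + A" using Z_nonneg[OF t(1)] A by simp
    have "Z (t + 1) + A \<le> Z t + A + ?d"
      using Z_step[OF t(1) K[OF t], of l] by (simp add: b_def)
    then have "level A (t + 1) \<le> sqrt (Z t + A + ?d)" unfolding level_def by (rule real_sqrt_le_mono)
    also have "\<dots> \<le> ?H + ?d / (2 * ?H)"
      unfolding level_def
      by (rule sqrt_increment_le[OF ZA])
        (use \<open>Z (t + 1) + A \<le> Z t + A + ?d\<close> Z_nonneg[of "t + 1"] A in simp)
    also have "?d / (2 * ?H) = \<alpha> t * (noise t / ?H) / 2 + b t / (2 * ?H) - \<alpha> t * gap l t / (2 * ?H)"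
      using H by (simp add: add_divide_distrib diff_divide_distrib)
    finally have main: "level A (t + 1) + \<alpha> t * gap l t / (2 * ?H)
        \<le> ?H + \<alpha> t * (noise t / ?H) / 2 + b t / (2 * ?H)" by linarith
    have "sqrt A \<le> ?H" unfolding level_def using Z_nonneg[OF t(1)] by simp
    then have "b t / (2 * ?H) \<le> b t / (2 * sqrt A)" using b0[of t] A H by (intro divide_left_mono) auto
    then show ?thesis using main by linarith
  qed
  have unrolled: "level A (k + 1) + (\<Sum>t=1..k. \<alpha> t * gap l t / (2 * level A t))
      \<le> level A 1 + (\<Sum>t=1..k. \<alpha> t * (noise t / level A t)) / 2 + (\<Sum>t=1..k. b t) / (2 * sqrt A)"
    if "k \<le> T" for k
    using that
  proof (induction k)
    case (Suc k)
    then show ?case using step[of "Suc k"] by (simp add: add_divide_distrib)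
  qed simp
  have "(\<Sum>t=1..T. \<alpha> t * disagreement t)
      \<le> (real mixing_time * (\<alpha> 1 * disagreement 1)
          + 4 * real mixing_time * drift K * (\<Sum>t=1..T. (\<alpha> t)\<^sup>2)) / mixing_rate"
    using weighted_disagreement[OF K] mixing_rate(1) by (simp add: le_divide_eq mult.commute)
  then have bT: "(\<Sum>t=1..T. b t) \<le> total_error K T"
    unfolding b_def total_error_def sum.distrib sum_distrib_left[symmetric]
    using G_pos G\<psi>_pos by (intro add_right_mono mult_left_mono) auto
  have gap_term: "0 \<le> \<alpha> t * gap l t / (2 * level A t)" if "1 \<le> t" for t
    using gap_nonneg[OF that] \<alpha>_pos[of t] level_pos[OF that A] by simp
  have Q: "level A (k + 1) + (\<Sum>t=1..k. \<alpha> t * gap l t / (2 * level A t)) \<le> ?Q" if k: "k \<le> T" for k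
  proof -
    have "(\<Sum>t=1..k. b t) \<le> (\<Sum>t=1..T. b t)" using k b0 by (intro sum_mono2) auto
    then have "(\<Sum>t=1..k. b t) / (2 * sqrt A) \<le> total_error K T / (2 * sqrt A)"
      using bT A by (intro divide_right_mono) auto
    moreover have "level A 1 \<le> sqrt (Z 1) + sqrt A"
      unfolding level_def by (rule sqrt_add_le_add_sqrt) (use Z_nonneg[of 1] A in auto)
    ultimately show ?thesis using unrolled[OF k] a[OF k] by linarith
  qed
  have level_Q: "level A t \<le> ?Q" if t: "t \<in> {1..T}" for t
  proof -
    have "0 \<le> (\<Sum>t=1..t - 1. \<alpha> t * gap l t / (2 * level A t))" by (intro sum_nonneg gap_term) auto
    moreover have "t - 1 \<le> T" "t - 1 + 1 = t" using t by auto
    ultimately show ?thesis using Q[of "t - 1"] by simp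
  qed
  have Q0: "0 \<le> ?Q" using Q[of 0] level_pos[of 1 A] A by simp
  have "(\<Sum>t=1..T. \<alpha> t * gap l t) = (\<Sum>t=1..T. \<alpha> t * gap l t / (2 * level A t) * (2 * level A t))"
    using level_pos[OF _ A] by (intro sum.cong) (auto simp: less_imp_neq[symmetric])
  also have "\<dots> \<le> (\<Sum>t=1..T. \<alpha> t * gap l t / (2 * level A t) * (2 * ?Q))"
    using level_Q gap_term by (intro sum_mono mult_left_mono) auto
  also have "\<dots> = (\<Sum>t=1..T. \<alpha> t * gap l t / (2 * level A t)) * (2 * ?Q)"
    by (simp only: sum_distrib_right)
  also have "\<dots> \<le> ?Q * (2 * ?Q)"
    using Q[of T] level_pos[of "T + 1" A] A Q0 by (intro mult_right_mono) auto
  also have "\<dots> = 2 * ?Q\<^sup>2" by (simp only: power2_eq_square mult.left_commute)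
  finally show ?thesis .
qed

lemma average_gap_bound:
  assumes T: "1 \<le> T"
  shows "objective f \<psi> ((1 / real T) *\<^sub>R (\<Sum>t=1..T. x l t)) - objective f \<psi> xstar
    \<le> (\<Sum>t=1..T. \<alpha> t * gap l t) / (real T * \<alpha> T)"
proof -
  have "(\<Sum>t=1..T. gap l t) \<le> (\<Sum>t=1..T. \<alpha> t * gap l t / \<alpha> T)"
  proof (intro sum_mono)
    fix t assume t: "t \<in> {1..T}"
    have "\<alpha> T * gap l t \<le> \<alpha> t * gap l t"
      using t \<alpha>_antimono gap_nonneg by (intro mult_right_mono) auto
    then show "gap l t \<le> \<alpha> t * gap l t / \<alpha> T" using \<alpha>_pos[of T] by (simp add: le_divide_eq mult.commute)
  qed
  also have "\<dots> = (\<Sum>t=1..T. \<alpha> t * gap l t) / \<alpha> T" by (simp add: sum_divide_distrib)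
  finally have sum: "(\<Sum>t=1..T. gap l t) \<le> (\<Sum>t=1..T. \<alpha> t * gap l t) / \<alpha> T" .
  have "objective f \<psi> ((1 / real T) *\<^sub>R (\<Sum>t=1..T. x l t)) - objective f \<psi> xstar
      \<le> (1 / real T) * (\<Sum>t=1..T. objective f \<psi> (x l t)) - objective f \<psi> xstar"
    using objective_Jensen(1)[OF T, of "\<lambda>t. x l t"] x_in_X by simp
  also have "\<dots> = (\<Sum>t=1..T. gap l t) / real T"
    using T by (simp add: gap_def sum_subtractf field_simps)
  also have "\<dots> \<le> (\<Sum>t=1..T. \<alpha> t * gap l t) / \<alpha> T / real T"
    using sum T by (intro divide_right_mono) auto
  finally show ?thesis by (simp add: mult.commute)
qed

end

section \<open>Clipped sub-Weibull noise\<close>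

text \<open>
  For negative \<open>z\<close> the second order term carries no exponential factor. This is what makes clipping from
  above sufficient for an exponential moment bound.
\<close>

lemma exp_le_quadratic:
  fixes z :: real
  shows "exp z \<le> 1 + z + z\<^sup>2 / 2 * exp (max z 0)"
proof (cases "0 \<le> z")
  case True
  obtain t where t: "\<bar>t\<bar> \<le> \<bar>z\<bar>" "exp z = (\<Sum>m<2. z ^ m / fact m) + exp t / fact 2 * z ^ 2"
    using Maclaurin_exp_le[of z 2] by auto
  have "exp t * z\<^sup>2 \<le> exp z * z\<^sup>2" using t(1) True by (intro mult_right_mono) auto
  moreover have "exp z = 1 + z + exp t * z\<^sup>2 / 2" using t(2) by (simp add: numeral_2_eq_2)
  ultimately show ?thesis using True by (simp add: mult.commute)
next
  case False
  define w where "w = - z"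
  have w: "0 < w" using False by (simp add: w_def)
  \<comment> \<open>the quadratic Taylor polynomials at \<open>w\<close> and \<open>- w\<close> are almost reciprocal\<close>
  have "(1 - w + w\<^sup>2 / 2) * (1 + w + w\<^sup>2 / 2) = 1 + w ^ 4 / 4"
    by (simp add: algebra_simps power2_eq_square power4_eq_xxxx)
  then have "1 \<le> (1 - w + w\<^sup>2 / 2) * (1 + w + w\<^sup>2 / 2)" by simp
  also have "\<dots> \<le> (1 - w + w\<^sup>2 / 2) * exp w"
  proof (rule mult_left_mono)
    show "1 + w + w\<^sup>2 / 2 \<le> exp w" using exp_lower_Taylor_quadratic[of w] w by simp
    have "0 \<le> (1 - w)\<^sup>2 + 1" by simp
    then show "0 \<le> 1 - w + w\<^sup>2 / 2" by (simp add: power2_eq_square algebra_simps)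
  qed
  finally have "exp (- w) \<le> 1 - w + w\<^sup>2 / 2" by (simp add: exp_minus field_simps)
  then show ?thesis using False by (simp add: w_def)
qed

text \<open>
  Stems from \<open>z ^ n \<le> fact n * exp z\<close> at \<open>z = w / 2\<close>, where \<open>n\<close> is \<open>2 * \<theta>\<close> rounded up.
\<close>

definition subweibull_const :: "real \<Rightarrow> real" where
  "subweibull_const \<theta> = 1 + fact (nat \<lceil>2 * \<theta>\<rceil>) * 2 ^ nat \<lceil>2 * \<theta>\<rceil>"

lemma subweibull_const_pos: "0 < subweibull_const \<theta>"
  by (simp add: subweibull_const_def add_pos_nonneg)

lemma powr_le_exp:
  fixes w \<theta> :: real
  assumes "0 \<le> w" "0 \<le> \<theta>"
  shows "w powr (2 * \<theta>) \<le> subweibull_const \<theta> * exp (w / 2)"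
proof -
  define n where "n = nat \<lceil>2 * \<theta>\<rceil>"
  have n: "2 * \<theta> \<le> real n" using assms by (simp add: n_def)
  have e: "z ^ n / fact n \<le> exp z" if "0 \<le> z" for z :: real
  proof -
    have "z ^ n /\<^sub>R fact n \<le> (\<Sum>k. z ^ k /\<^sub>R fact k)"
      using sum_le_suminf[OF summable_exp_generic, of "{n}" z] that by simp
    also have "\<dots> = exp z" by (simp only: exp_def)
    finally show ?thesis by (simp only: real_scaleR_def divide_inverse mult.commute)
  qed
  have "w powr (2 * \<theta>) \<le> 1 + w ^ n"
  proof (cases "w \<le> 1")
    case True
    have "w powr (2 * \<theta>) \<le> 1 powr (2 * \<theta>)" using assms True by (intro powr_mono2) auto
    then show ?thesis using assms by (simp add: add_increasing2)
  next
    case False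
    then have "w powr (2 * \<theta>) \<le> w powr real n" using n by (intro powr_mono) auto
    then show ?thesis using False by (simp add: powr_realpow)
  qed
  also have "w ^ n = fact n * 2 ^ n * ((w / 2) ^ n / fact n)" by (simp add: power_divide)
  also have "\<dots> \<le> fact n * 2 ^ n * exp (w / 2)"
    using assms by (intro mult_left_mono e) auto
  also have "(1::real) \<le> exp (w / 2)" using assms by simp
  finally show ?thesis by (simp add: subweibull_const_def n_def distrib_right)
qed

text \<open>
  Clipping at \<open>L powr \<theta>\<close> trades the growth \<open>u\<close> for \<open>u powr (1 / \<theta>)\<close>, which the tail assumption
  controls, at the price of a factor \<open>L powr (\<theta> - 1)\<close>. For \<open>\<theta> \<le> 1\<close> the tails are already
  subexponential and nothing is paid.
\<close>

lemma truncation_le: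
  fixes u L \<theta> :: real
  assumes u: "0 \<le> u" and L: "1 \<le> L" and \<theta>: "1 / 2 \<le> \<theta>"
  shows "min u (L powr \<theta>) \<le> (1 + u powr (1 / \<theta>)) * L powr (max 0 (\<theta> - 1))"
proof (cases "\<theta> \<le> 1")
  case True
  have "u \<le> 1 + u powr (1 / \<theta>)"
  proof (cases "u \<le> 1")
    case False
    then have "u powr 1 \<le> u powr (1 / \<theta>)" using True \<theta> by (intro powr_mono) (auto simp: field_simps)
    then show ?thesis using False by simp
  qed (simp add: add_increasing2)
  then show ?thesis using True L by simp
next
  case False
  then have p: "1 / \<theta> < 1" by simp
  have "min u (L powr \<theta>) \<le> u powr (1 / \<theta>) * L powr (\<theta> - 1)"
  proof (cases "u \<le> L powr \<theta>")
    case True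
    have "u = u powr (1 / \<theta>) * u powr (1 - 1 / \<theta>)" using u by (simp flip: powr_add)
    also have "u powr (1 - 1 / \<theta>) \<le> (L powr \<theta>) powr (1 - 1 / \<theta>)"
      using True u p by (intro powr_mono2) auto
    also have "(L powr \<theta>) powr (1 - 1 / \<theta>) = L powr (\<theta> - 1)"
      using False by (simp add: powr_powr right_diff_distrib)
    finally have "u \<le> u powr (1 / \<theta>) * L powr (\<theta> - 1)" by (simp add: mult_left_mono)
    then show ?thesis by simp
  next
    case u_large: False
    have "L = (L powr \<theta>) powr (1 / \<theta>)" using L False by (simp add: powr_powr)
    also have "\<dots> \<le> u powr (1 / \<theta>)" using u_large False by (intro powr_mono2) auto
    finally have "L * L powr (\<theta> - 1) \<le> u powr (1 / \<theta>) * L powr (\<theta> - 1)" by (intro mult_right_mono) auto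
    moreover have "L * L powr (\<theta> - 1) = L powr \<theta>" using L by (simp add: powr_mult_base)
    ultimately show ?thesis by simp
  qed
  also have "\<dots> \<le> (1 + u powr (1 / \<theta>)) * L powr (max 0 (\<theta> - 1))"
    using False by (simp add: mult_right_mono)
  finally show ?thesis .
qed

text \<open>
  The right-hand side is linear in \<open>x\<close> itself, not in the clipped variable: clipping from above lowers
  \<open>x\<close>, so that the mean-zero property of \<open>x\<close> can be used after taking expectations. In the second
  order term, one half of the exponent \<open>u powr (1 / \<theta>)\<close> pays for the square of \<open>u\<close> and the other half
  for the exponential of the clipped variable.
\<close>

lemma exp_truncated_le:
  fixes x u L \<theta> r s :: real
  assumes u: "0 \<le> u" and L: "1 \<le> L" and \<theta>: "1 / 2 \<le> \<theta>" and r: "0 \<le> r" and x: "\<bar>x\<bar> \<le> r * u"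
    and s: "0 \<le> s" "s * r * L powr (max 0 (\<theta> - 1)) \<le> 1 / 2"
  shows "exp (s * min x (r * L powr \<theta>))
    \<le> 1 + s * x + s\<^sup>2 * (r\<^sup>2 * subweibull_const \<theta>) * exp (u powr (1 / \<theta>))"
proof -
  define w where "w = u powr (1 / \<theta>)"
  define x' where "x' = min x (r * L powr \<theta>)"
  have w: "0 \<le> w" by (simp add: w_def)
  have cap: "0 \<le> r * L powr \<theta>" using r by simp
  have x'_abs: "\<bar>x'\<bar> \<le> r * u" using x cap by (auto simp: x'_def min_def)
  have sq: "(s * x')\<^sup>2 \<le> s\<^sup>2 * (r\<^sup>2 * u\<^sup>2)"
    using power_mono[OF x'_abs, of 2] by (simp add: power_mult_distrib mult_left_mono)
  have "x' \<le> r * min u (L powr \<theta>)"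
    using x r by (auto simp: x'_def min_def abs_le_iff)
  also have "\<dots> \<le> r * ((1 + w) * L powr (max 0 (\<theta> - 1)))"
    unfolding w_def by (intro mult_left_mono truncation_le u L \<theta> r)
  finally have "s * x' \<le> s * (r * ((1 + w) * L powr (max 0 (\<theta> - 1))))"
    using s(1) by (rule mult_left_mono)
  also have "\<dots> = s * r * L powr (max 0 (\<theta> - 1)) * (1 + w)" by (simp add: mult_ac)
  also have "\<dots> \<le> 1 / 2 * (1 + w)" using s(2) w by (intro mult_right_mono) auto
  finally have mx: "max (s * x') 0 \<le> (1 + w) / 2" using w by simp
  have "u\<^sup>2 = w powr (2 * \<theta>)"
    using u \<theta> by (cases "u = 0") (simp_all add: w_def powr_powr)
  also have "\<dots> \<le> subweibull_const \<theta> * exp (w / 2)" using w \<theta> by (intro powr_le_exp) auto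
  finally have u2: "u\<^sup>2 \<le> subweibull_const \<theta> * exp (w / 2)" .
  have half: "exp (1 / 2 :: real) \<le> 2" using exp_bound[of "1 / 2"] by (simp add: power2_eq_square)
  have "(s * x')\<^sup>2 / 2 * exp (max (s * x') 0)
      \<le> (s\<^sup>2 * (r\<^sup>2 * (subweibull_const \<theta> * exp (w / 2)))) / 2 * (exp (1 / 2) * exp (w / 2))"
  proof (intro mult_mono divide_right_mono)
    show "(s * x')\<^sup>2 \<le> s\<^sup>2 * (r\<^sup>2 * (subweibull_const \<theta> * exp (w / 2)))"
      by (rule order.trans[OF sq]) (intro mult_left_mono u2, auto)
    show "exp (max (s * x') 0) \<le> exp (1 / 2) * exp (w / 2)"
      using mx by (simp flip: exp_add add: add_divide_distrib)
  qed (use subweibull_const_pos[of \<theta>] in auto)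
  also have "\<dots> = s\<^sup>2 * (r\<^sup>2 * subweibull_const \<theta>) * (exp (1 / 2) / 2) * (exp (w / 2) * exp (w / 2))"
    by (simp add: mult_ac)
  also have "exp (w / 2) * exp (w / 2) = exp w" by (simp flip: exp_add)
  also have "s\<^sup>2 * (r\<^sup>2 * subweibull_const \<theta>) * (exp (1 / 2) / 2) * exp w
      \<le> s\<^sup>2 * (r\<^sup>2 * subweibull_const \<theta>) * 1 * exp w"
    using half subweibull_const_pos[of \<theta>] by (intro mult_right_mono mult_left_mono) auto
  finally have "(s * x')\<^sup>2 / 2 * exp (max (s * x') 0) \<le> s\<^sup>2 * (r\<^sup>2 * subweibull_const \<theta>) * exp w"
    by simp
  moreover have "exp (s * x') \<le> 1 + s * x' + (s * x')\<^sup>2 / 2 * exp (max (s * x') 0)"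
    by (rule exp_le_quadratic)
  moreover have "s * x' \<le> s * x" using s(1) by (intro mult_left_mono) (auto simp: x'_def)
  ultimately show ?thesis unfolding x'_def[symmetric] w_def[symmetric] by linarith
qed

text \<open>
  The weight \<open>Y\<close> expresses the conditioning on \<open>F\<close> through integrals: it will be the
  exponential of the earlier increments, which is bounded because clipped increments are bounded above.
\<close>

lemma truncated_noise_mgf:
  fixes \<xi> v :: "'w \<Rightarrow> real^'n"
  assumes P: "prob_space M" and sub: "subalgebra M F"
    and \<xi>: "\<And>k. integrable M (\<lambda>\<omega>. \<xi> \<omega> $ k)"
      "\<And>k. AE \<omega> in M. real_cond_exp M F (\<lambda>\<omega>. \<xi> \<omega> $ k) \<omega> = 0"
    and v: "v \<in> borel_measurable F" "\<And>\<omega>. \<omega> \<in> space M \<Longrightarrow> norm (v \<omega>) \<le> c"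
    and u: "u \<in> borel_measurable M" "\<And>\<omega>. 0 \<le> u \<omega>"
    and tail: "AE \<omega> in M. nn_cond_exp M F (\<lambda>\<omega>. ennreal (exp (u \<omega> powr (1 / \<theta>)))) \<omega> \<le> 2"
    and dom: "\<And>\<omega>. \<omega> \<in> space M \<Longrightarrow> \<bar>\<xi> \<omega> \<bullet> v \<omega>\<bar> \<le> r * u \<omega>"
    and L: "1 \<le> L" and \<theta>: "1 / 2 \<le> \<theta>" and r: "0 \<le> r"
    and s: "0 \<le> s" "s * r * L powr (max 0 (\<theta> - 1)) \<le> 1 / 2"
    and Y: "Y \<in> borel_measurable F" "\<And>\<omega>. 0 \<le> Y \<omega>" "\<And>\<omega>. \<omega> \<in> space M \<Longrightarrow> Y \<omega> \<le> b"
  shows "(\<integral>\<^sup>+\<omega>. ennreal (Y \<omega> * exp (s * min (\<xi> \<omega> \<bullet> v \<omega>) (r * L powr \<theta>))) \<partial>M)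
    \<le> ennreal (exp (2 * s\<^sup>2 * (r\<^sup>2 * subweibull_const \<theta>))) * (\<integral>\<^sup>+\<omega>. ennreal (Y \<omega>) \<partial>M)"
proof -
  interpret P: prob_space M by (rule P)
  interpret S: sigma_finite_subalgebra M F
    by (rule finite_measure_subalgebra_is_sigma_finite)
      (simp add: finite_measure_subalgebra_def finite_measure_subalgebra_axioms_def sub P.finite_measure_axioms)
  define C where "C = r\<^sup>2 * subweibull_const \<theta>"
  have C: "0 \<le> C" using subweibull_const_pos[of \<theta>] by (simp add: C_def)
  define E where "E \<omega> = exp (u \<omega> powr (1 / \<theta>))" for \<omega>
  have [measurable]: "u \<in> borel_measurable M" by (rule u)
  have YM [measurable]: "Y \<in> borel_measurable M" using Y(1) sub by (rule measurable_from_subalg[rotated])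
  have EM [measurable]: "E \<in> borel_measurable M" unfolding E_def by measurable
  have Yint: "integrable M Y"
    by (rule P.integrable_const_bound[where B = b]) (use Y YM in auto)
  have YE: "(\<integral>\<^sup>+\<omega>. ennreal (Y \<omega> * E \<omega>) \<partial>M) \<le> 2 * (\<integral>\<^sup>+\<omega>. ennreal (Y \<omega>) \<partial>M)"
  proof -
    have "(\<integral>\<^sup>+\<omega>. ennreal (Y \<omega> * E \<omega>) \<partial>M) = (\<integral>\<^sup>+\<omega>. ennreal (Y \<omega>) * ennreal (E \<omega>) \<partial>M)"
      using Y(2) by (intro nn_integral_cong) (simp add: ennreal_mult E_def)
    also have "\<dots> = (\<integral>\<^sup>+\<omega>. ennreal (Y \<omega>) * nn_cond_exp M F (\<lambda>\<omega>. ennreal (E \<omega>)) \<omega> \<partial>M)"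
      by (rule S.nn_cond_exp_intg[symmetric]) (use Y(1) in measurable)
    also have "\<dots> \<le> (\<integral>\<^sup>+\<omega>. ennreal (Y \<omega>) * 2 \<partial>M)"
    proof (rule nn_integral_mono_AE)
      show "AE \<omega> in M. ennreal (Y \<omega>) * nn_cond_exp M F (\<lambda>\<omega>. ennreal (E \<omega>)) \<omega> \<le> ennreal (Y \<omega>) * 2"
        using tail by eventually_elim (simp add: E_def mult_left_mono)
    qed
    also have "\<dots> = 2 * (\<integral>\<^sup>+\<omega>. ennreal (Y \<omega>) \<partial>M)"
      by (simp add: nn_integral_multc mult.commute)
    finally show ?thesis .
  qed
  have Yfin: "(\<integral>\<^sup>+\<omega>. ennreal (Y \<omega>) \<partial>M) = ennreal (\<integral>\<omega>. Y \<omega> \<partial>M)"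
    by (rule nn_integral_eq_integral[OF Yint]) (use Y(2) in auto)
  have YEint: "integrable M (\<lambda>\<omega>. Y \<omega> * E \<omega>)"
  proof (rule integrableI_nonneg)
    show "(\<integral>\<^sup>+\<omega>. ennreal (Y \<omega> * E \<omega>) \<partial>M) < \<infinity>"
      using YE unfolding Yfin by (rule order.strict_trans1) (simp add: ennreal_mult_less_top)
  qed (use Y(2) in \<open>auto simp: E_def\<close>)
  have YE': "(\<integral>\<omega>. Y \<omega> * E \<omega> \<partial>M) \<le> 2 * (\<integral>\<omega>. Y \<omega> \<partial>M)"
  proof -
    have "ennreal (\<integral>\<omega>. Y \<omega> * E \<omega> \<partial>M) = (\<integral>\<^sup>+\<omega>. ennreal (Y \<omega> * E \<omega>) \<partial>M)"
      by (rule nn_integral_eq_integral[symmetric, OF YEint]) (use Y(2) in \<open>auto simp: E_def\<close>)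
    also have "\<dots> \<le> ennreal (2 * (\<integral>\<omega>. Y \<omega> \<partial>M))"
      using YE unfolding Yfin by (simp add: ennreal_mult' ennreal_numeral[symmetric] del: ennreal_numeral)
    finally show ?thesis
      by (subst (asm) ennreal_le_iff) (use Y(2) in \<open>auto intro!: integral_nonneg\<close>)
  qed
  have comp: "integrable M (\<lambda>\<omega>. Y \<omega> * v \<omega> $ k * \<xi> \<omega> $ k)"
    "(\<integral>\<omega>. Y \<omega> * v \<omega> $ k * \<xi> \<omega> $ k \<partial>M) = 0" for k
  proof -
    have c: "0 \<le> c" using v(2) P.not_empty norm_ge_zero order.trans by blast
    have [measurable]: "(\<lambda>\<omega>. v \<omega> $ k) \<in> borel_measurable F"
      by (rule measurable_compose[OF v(1)]) (intro borel_measurable_continuous_onI continuous_intros)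
    have Yv: "(\<lambda>\<omega>. Y \<omega> * v \<omega> $ k) \<in> borel_measurable F" using Y(1) by measurable
    have Yv': "(\<lambda>\<omega>. Y \<omega> * v \<omega> $ k) \<in> borel_measurable M"
      using Yv sub by (rule measurable_from_subalg[rotated])
    have \<xi>M: "(\<lambda>\<omega>. \<xi> \<omega> $ k) \<in> borel_measurable M" using \<xi>(1) by (rule borel_measurable_integrable)
    show int: "integrable M (\<lambda>\<omega>. Y \<omega> * v \<omega> $ k * \<xi> \<omega> $ k)"
    proof (rule Bochner_Integration.integrable_bound)
      show "integrable M (\<lambda>\<omega>. (b * c) * \<xi> \<omega> $ k)" using \<xi>(1) by simp
      show "(\<lambda>\<omega>. Y \<omega> * v \<omega> $ k * \<xi> \<omega> $ k) \<in> borel_measurable M" using Yv' \<xi>M by measurable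
      show "AE \<omega> in M. norm (Y \<omega> * v \<omega> $ k * \<xi> \<omega> $ k) \<le> norm (b * c * \<xi> \<omega> $ k)"
      proof (rule AE_I2)
        fix \<omega> assume \<omega>: "\<omega> \<in> space M"
        have "0 \<le> b" using Y(2,3)[of \<omega>] \<omega> order.trans by blast
        have "\<bar>v \<omega> $ k\<bar> \<le> c" using component_le_norm_cart[of "v \<omega>" k] v(2)[OF \<omega>] by linarith
        then have "Y \<omega> * \<bar>v \<omega> $ k\<bar> \<le> b * c" using Y(2,3) \<omega> c \<open>0 \<le> b\<close> by (intro mult_mono) auto
        then have "Y \<omega> * \<bar>v \<omega> $ k\<bar> * \<bar>\<xi> \<omega> $ k\<bar> \<le> b * c * \<bar>\<xi> \<omega> $ k\<bar>" by (rule mult_right_mono) simp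
        then show "norm (Y \<omega> * v \<omega> $ k * \<xi> \<omega> $ k) \<le> norm (b * c * \<xi> \<omega> $ k)"
          using Y(2)[of \<omega>] c \<open>0 \<le> b\<close> by (simp add: abs_mult)
      qed
    qed
    have "(\<integral>\<omega>. Y \<omega> * v \<omega> $ k * \<xi> \<omega> $ k \<partial>M)
        = (\<integral>\<omega>. Y \<omega> * v \<omega> $ k * real_cond_exp M F (\<lambda>\<omega>. \<xi> \<omega> $ k) \<omega> \<partial>M)"
      by (rule S.real_cond_exp_intg(2)[symmetric, OF int Yv \<xi>M])
    also have "\<dots> = (\<integral>\<omega>. 0 \<partial>M)"
      by (rule integral_cong_AE) (use Yv' \<xi>(2)[of k] in auto)
    finally show "(\<integral>\<omega>. Y \<omega> * v \<omega> $ k * \<xi> \<omega> $ k \<partial>M) = 0" by simp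
  qed
  have lin: "Y \<omega> * (\<xi> \<omega> \<bullet> v \<omega>) = (\<Sum>k\<in>UNIV. Y \<omega> * v \<omega> $ k * \<xi> \<omega> $ k)" for \<omega>
    by (simp add: inner_vec_def sum_distrib_left mult_ac)
  have Xint: "integrable M (\<lambda>\<omega>. Y \<omega> * (\<xi> \<omega> \<bullet> v \<omega>))" and X0: "(\<integral>\<omega>. Y \<omega> * (\<xi> \<omega> \<bullet> v \<omega>) \<partial>M) = 0"
    unfolding lin using comp by (auto simp: integral_sum)
  have "(\<integral>\<^sup>+\<omega>. ennreal (Y \<omega> * exp (s * min (\<xi> \<omega> \<bullet> v \<omega>) (r * L powr \<theta>))) \<partial>M)
      \<le> (\<integral>\<^sup>+\<omega>. ennreal (Y \<omega> + s * (Y \<omega> * (\<xi> \<omega> \<bullet> v \<omega>)) + s\<^sup>2 * C * (Y \<omega> * E \<omega>)) \<partial>M)"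
  proof (intro nn_integral_mono ennreal_leI)
    fix \<omega> assume "\<omega> \<in> space M"
    from exp_truncated_le[OF u(2) L \<theta> r dom[OF this] s]
    have "Y \<omega> * exp (s * min (\<xi> \<omega> \<bullet> v \<omega>) (r * L powr \<theta>))
        \<le> Y \<omega> * (1 + s * (\<xi> \<omega> \<bullet> v \<omega>) + s\<^sup>2 * C * E \<omega>)"
      unfolding C_def E_def using Y(2) by (rule mult_left_mono)
    then show "Y \<omega> * exp (s * min (\<xi> \<omega> \<bullet> v \<omega>) (r * L powr \<theta>))
        \<le> Y \<omega> + s * (Y \<omega> * (\<xi> \<omega> \<bullet> v \<omega>)) + s\<^sup>2 * C * (Y \<omega> * E \<omega>)"
      by (simp add: algebra_simps)
  qed
  also have "\<dots> = ennreal (\<integral>\<omega>. Y \<omega> + s * (Y \<omega> * (\<xi> \<omega> \<bullet> v \<omega>)) + s\<^sup>2 * C * (Y \<omega> * E \<omega>) \<partial>M)"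
  proof (rule nn_integral_eq_integral)
    show "integrable M (\<lambda>\<omega>. Y \<omega> + s * (Y \<omega> * (\<xi> \<omega> \<bullet> v \<omega>)) + s\<^sup>2 * C * (Y \<omega> * E \<omega>))"
      using Yint Xint YEint by simp
    show "AE \<omega> in M. 0 \<le> Y \<omega> + s * (Y \<omega> * (\<xi> \<omega> \<bullet> v \<omega>)) + s\<^sup>2 * C * (Y \<omega> * E \<omega>)"
    proof (rule AE_I2)
      fix \<omega> assume "\<omega> \<in> space M"
      from exp_truncated_le[OF u(2) L \<theta> r dom[OF this] s]
      have "0 \<le> 1 + s * (\<xi> \<omega> \<bullet> v \<omega>) + s\<^sup>2 * C * E \<omega>"
        unfolding C_def E_def by (rule order.trans[OF less_imp_le[OF exp_gt_zero]])
      from mult_left_mono[OF this Y(2)]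
      show "0 \<le> Y \<omega> + s * (Y \<omega> * (\<xi> \<omega> \<bullet> v \<omega>)) + s\<^sup>2 * C * (Y \<omega> * E \<omega>)"
        by (simp add: algebra_simps)
    qed
  qed
  also have "(\<integral>\<omega>. Y \<omega> + s * (Y \<omega> * (\<xi> \<omega> \<bullet> v \<omega>)) + s\<^sup>2 * C * (Y \<omega> * E \<omega>) \<partial>M)
      = (\<integral>\<omega>. Y \<omega> \<partial>M) + s\<^sup>2 * C * (\<integral>\<omega>. Y \<omega> * E \<omega> \<partial>M)"
    using Yint Xint YEint X0 by simp
  also have "ennreal \<dots> \<le> ennreal (exp (2 * s\<^sup>2 * C) * (\<integral>\<omega>. Y \<omega> \<partial>M))"
  proof (rule ennreal_leI)
    have "(\<integral>\<omega>. Y \<omega> \<partial>M) + s\<^sup>2 * C * (\<integral>\<omega>. Y \<omega> * E \<omega> \<partial>M)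
        \<le> (\<integral>\<omega>. Y \<omega> \<partial>M) + s\<^sup>2 * C * (2 * (\<integral>\<omega>. Y \<omega> \<partial>M))"
      using YE' C by (intro add_left_mono mult_left_mono) auto
    also have "\<dots> = (1 + 2 * s\<^sup>2 * C) * (\<integral>\<omega>. Y \<omega> \<partial>M)" by (simp add: algebra_simps)
    also have "\<dots> \<le> exp (2 * s\<^sup>2 * C) * (\<integral>\<omega>. Y \<omega> \<partial>M)"
      using Y(2) by (intro mult_right_mono exp_ge_add_one_self Bochner_Integration.integral_nonneg)
    finally show "(\<integral>\<omega>. Y \<omega> \<partial>M) + s\<^sup>2 * C * (\<integral>\<omega>. Y \<omega> * E \<omega> \<partial>M)
        \<le> exp (2 * s\<^sup>2 * C) * (\<integral>\<omega>. Y \<omega> \<partial>M)" .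
  qed
  finally show ?thesis unfolding C_def Yfin by (simp add: ennreal_mult')
qed

text \<open>
  The exponential supermartingale argument. The hypothesis on the increments is stated for bounded
  weights, since boundedness of the partial exponentials follows from the bound on the increments.
\<close>

lemma adapted_sum_chernoff:
  fixes d :: "nat \<Rightarrow> 'w \<Rightarrow> real"
  assumes P: "prob_space M" and fil: "filtration (space M) Fil" and sub: "\<And>t. subalgebra M (Fil t)"
    and d: "\<And>t. 1 \<le> t \<Longrightarrow> d t \<in> borel_measurable (Fil t)"
    and bd: "\<And>t \<omega>. 1 \<le> t \<Longrightarrow> \<omega> \<in> space M \<Longrightarrow> d t \<omega> \<le> b"
    and step: "\<And>t Y b. 1 \<le> t \<Longrightarrow> Y \<in> borel_measurable (Fil (t - 1)) \<Longrightarrow> (\<And>\<omega>. 0 \<le> Y \<omega>) \<Longrightarrow>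
      (\<And>\<omega>. \<omega> \<in> space M \<Longrightarrow> Y \<omega> \<le> b) \<Longrightarrow>
      (\<integral>\<^sup>+\<omega>. ennreal (Y \<omega> * exp (d t \<omega>)) \<partial>M) \<le> ennreal (exp (c t)) * (\<integral>\<^sup>+\<omega>. ennreal (Y \<omega>) \<partial>M)"
  shows "measure M {\<omega>\<in>space M. a \<le> (\<Sum>t=1..k. d t \<omega>)} \<le> exp ((\<Sum>t=1..k. c t) - a)"
proof -
  interpret P: prob_space M by (rule P)
  have S: "(\<lambda>\<omega>. \<Sum>t=1..k. d t \<omega>) \<in> borel_measurable (Fil k)" for k
  proof (rule borel_measurable_sum)
    fix t assume t: "t \<in> {1..k}"
    have "subalgebra (Fil k) (Fil t)"
      using t filtration.space_F[OF fil] filtration.sets_F_mono[OF fil, of t k] by (auto simp: subalgebra_def)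
    then show "d t \<in> borel_measurable (Fil k)" using d[of t] t by (auto intro: measurable_from_subalg)
  qed
  have mgf: "(\<integral>\<^sup>+\<omega>. ennreal (exp (\<Sum>t=1..k. d t \<omega>)) \<partial>M) \<le> ennreal (exp (\<Sum>t=1..k. c t))" for k
  proof (induction k)
    case 0
    then show ?case by (simp add: P.emeasure_space_1)
  next
    case (Suc k)
    have "(\<integral>\<^sup>+\<omega>. ennreal (exp (\<Sum>t=1..Suc k. d t \<omega>)) \<partial>M)
        = (\<integral>\<^sup>+\<omega>. ennreal (exp (\<Sum>t=1..k. d t \<omega>) * exp (d (Suc k) \<omega>)) \<partial>M)"
      by (simp add: exp_add)
    also have "\<dots> \<le> ennreal (exp (c (Suc k))) * (\<integral>\<^sup>+\<omega>. ennreal (exp (\<Sum>t=1..k. d t \<omega>)) \<partial>M)"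
    proof (rule step)
      show "(\<lambda>\<omega>. exp (\<Sum>t=1..k. d t \<omega>)) \<in> borel_measurable (Fil (Suc k - 1))"
        using S[of k] by simp
      show "exp (\<Sum>t=1..k. d t \<omega>) \<le> exp (\<Sum>t=1..k. b)" if "\<omega> \<in> space M" for \<omega>
        using bd that by (simp only: exp_le_cancel_iff) (intro sum_mono, auto)
    qed auto
    also have "\<dots> \<le> ennreal (exp (c (Suc k))) * ennreal (exp (\<Sum>t=1..k. c t))"
      by (rule mult_left_mono[OF Suc]) simp
    also have "\<dots> = ennreal (exp (\<Sum>t=1..Suc k. c t))"
      by (simp add: exp_add ennreal_mult'[symmetric] mult.commute)
    finally show ?case .
  qed
  have SM: "(\<lambda>\<omega>. \<Sum>t=1..k. d t \<omega>) \<in> borel_measurable M"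
    using S[of k] sub by (rule measurable_from_subalg[rotated])
  note [measurable] = SM
  let ?u = "\<lambda>\<omega>. ennreal (exp (\<Sum>t=1..k. d t \<omega>))"
  have "emeasure M {\<omega>\<in>space M. a \<le> (\<Sum>t=1..k. d t \<omega>)}
      \<le> emeasure M {\<omega>\<in>space M. 1 \<le> ennreal (exp (- a)) * ?u \<omega>}"
  proof (intro emeasure_mono subsetI CollectI)
    fix \<omega> assume "\<omega> \<in> {\<omega>\<in>space M. a \<le> (\<Sum>t=1..k. d t \<omega>)}"
    then have "\<omega> \<in> space M" "1 \<le> exp (- a) * exp (\<Sum>t=1..k. d t \<omega>)" by (simp_all flip: exp_add)
    then show "\<omega> \<in> space M \<and> 1 \<le> ennreal (exp (- a)) * ?u \<omega>"
      by (simp add: ennreal_mult'[symmetric] ennreal_ge_1)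
  qed measurable
  also have "\<dots> \<le> ennreal (exp (- a)) * (\<integral>\<^sup>+\<omega>. ?u \<omega> * indicator (space M) \<omega> \<partial>M)"
    by (rule nn_integral_Markov_inequality) measurable
  also have "(\<integral>\<^sup>+\<omega>. ?u \<omega> * indicator (space M) \<omega> \<partial>M) = (\<integral>\<^sup>+\<omega>. ?u \<omega> \<partial>M)"
    by (rule nn_integral_cong) simp
  also have "ennreal (exp (- a)) * (\<integral>\<^sup>+\<omega>. ?u \<omega> \<partial>M) \<le> ennreal (exp (- a)) * ennreal (exp (\<Sum>t=1..k. c t))"
    by (rule mult_left_mono[OF mgf]) simp
  also have "\<dots> = ennreal (exp ((\<Sum>t=1..k. c t) - a))"
    by (simp add: ennreal_mult'[symmetric] exp_add[symmetric])
  finally show ?thesis by (simp add: P.emeasure_eq_measure)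
qed

lemma subweibull_tail:
  assumes P: "prob_space M" and sub: "subalgebra M F"
    and u: "u \<in> borel_measurable M" "\<And>\<omega>. 0 \<le> u \<omega>"
    and tail: "AE \<omega> in M. nn_cond_exp M F (\<lambda>\<omega>. ennreal (exp (u \<omega> powr (1 / \<theta>)))) \<omega> \<le> 2"
    and \<theta>: "0 < \<theta>" and L: "0 \<le> L"
  shows "measure M {\<omega>\<in>space M. L powr \<theta> < u \<omega>} \<le> 2 * exp (- L)"
proof -
  interpret P: prob_space M by (rule P)
  interpret S: sigma_finite_subalgebra M F
    by (rule finite_measure_subalgebra_is_sigma_finite)
      (simp add: finite_measure_subalgebra_def finite_measure_subalgebra_axioms_def sub P.finite_measure_axioms)
  have [measurable]: "u \<in> borel_measurable M" by (rule u)
  let ?E = "\<lambda>\<omega>. ennreal (exp (u \<omega> powr (1 / \<theta>)))"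
  have "emeasure M {\<omega>\<in>space M. L powr \<theta> < u \<omega>}
      \<le> emeasure M {\<omega>\<in>space M. 1 \<le> ennreal (exp (- L)) * ?E \<omega>}"
  proof (intro emeasure_mono subsetI CollectI)
    fix \<omega> assume \<omega>: "\<omega> \<in> {\<omega>\<in>space M. L powr \<theta> < u \<omega>}"
    have "L = (L powr \<theta>) powr (1 / \<theta>)" using L \<theta> by (simp add: powr_powr)
    also have "\<dots> \<le> u \<omega> powr (1 / \<theta>)" using \<omega> \<theta> by (intro powr_mono2) auto
    finally have "1 \<le> exp (- L) * exp (u \<omega> powr (1 / \<theta>))" by (simp flip: exp_add)
    then show "\<omega> \<in> space M \<and> 1 \<le> ennreal (exp (- L)) * ?E \<omega>"
      using \<omega> by (simp add: ennreal_mult'[symmetric] ennreal_ge_1)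
  qed measurable
  also have "\<dots> \<le> ennreal (exp (- L)) * (\<integral>\<^sup>+\<omega>. ?E \<omega> * indicator (space M) \<omega> \<partial>M)"
    by (rule nn_integral_Markov_inequality) measurable
  also have "(\<integral>\<^sup>+\<omega>. ?E \<omega> * indicator (space M) \<omega> \<partial>M) = (\<integral>\<^sup>+\<omega>. 1 * ?E \<omega> \<partial>M)"
    by (rule nn_integral_cong) simp
  also have "\<dots> = (\<integral>\<^sup>+\<omega>. 1 * nn_cond_exp M F ?E \<omega> \<partial>M)"
    by (rule S.nn_cond_exp_intg[symmetric]) auto
  also have "\<dots> \<le> (\<integral>\<^sup>+\<omega>. 2 \<partial>M)"
    by (rule nn_integral_mono_AE) (use tail in auto)
  also have "\<dots> = ennreal 2" by (simp add: P.emeasure_space_1)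
  finally have "emeasure M {\<omega>\<in>space M. L powr \<theta> < u \<omega>} \<le> ennreal (exp (- L)) * ennreal 2"
    by (simp add: mult_left_mono)
  also have "\<dots> = ennreal (2 * exp (- L))"
    by (subst ennreal_mult[symmetric]) (auto simp: mult.commute)
  finally show ?thesis by (simp add: P.emeasure_eq_measure)
qed

section \<open>Measurability along the run\<close>

text \<open>
  The functions of the problem are continuous only on \<open>X\<close> or on the interior of \<open>U\<close>, which contain
  the iterates.
\<close>

lemma borel_measurable_compose_continuous_on:
  fixes F :: "real^'n \<Rightarrow> real"
  assumes "continuous_on S F" "h \<in> borel_measurable N" "\<And>\<omega>. \<omega> \<in> space N \<Longrightarrow> h \<omega> \<in> S"
  shows "(\<lambda>\<omega>. F (h \<omega>)) \<in> borel_measurable N"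
proof -
  have "h \<in> N \<rightarrow>\<^sub>M restrict_space borel S" using assms(2,3) by (intro measurable_restrict_space2) auto
  then show ?thesis
    by (rule measurable_compose[OF _ borel_measurable_continuous_on_restrict[OF assms(1)]])
qed

context dcsmd_problem
begin

lemma continuous_Phi: "continuous_on X Phi"
  using derivative by (rule has_derivative_continuous_on)

text \<open>
  The map \<open>dPhi\<close> represents the derivative within \<open>X\<close> and may be arbitrary in the directions
  orthogonal to \<open>X\<close>, so it need not be measurable. The pairing that occurs in the divergence is a
  directional derivative along a segment in \<open>X\<close>, hence a limit of measurable difference quotients.
\<close>

lemma borel_measurable_bregman:
  assumes h: "h \<in> borel_measurable N" and hX: "\<And>\<omega>. \<omega> \<in> space N \<Longrightarrow> h \<omega> \<in> X"
  shows "(\<lambda>\<omega>. D xstar (h \<omega>)) \<in> borel_measurable N"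
proof -
  let ?s = "\<lambda>n. inverse (real (Suc n))"
  let ?q = "\<lambda>n \<omega>. (Phi (h \<omega> + ?s n *\<^sub>R (xstar - h \<omega>)) - Phi (h \<omega>)) / ?s n"
  have s: "filterlim ?s (at_right 0) sequentially"
    unfolding filterlim_at using LIMSEQ_inverse_real_of_nat by (auto simp: inverse_positive_iff_positive)
  have meas: "?q n \<in> borel_measurable N" for n
  proof -
    have "h \<omega> + ?s n *\<^sub>R (xstar - h \<omega>) \<in> X" if "\<omega> \<in> space N" for \<omega>
    proof -
      have "(1 - ?s n) *\<^sub>R h \<omega> + ?s n *\<^sub>R xstar \<in> X"
        using convex_X hX[OF that] xstar by (auto simp: convex_alt inverse_le_1_iff)
      then show ?thesis by (simp add: algebra_simps)
    qed
    moreover have "(\<lambda>\<omega>. h \<omega> + ?s n *\<^sub>R (xstar - h \<omega>)) \<in> borel_measurable N" using h by measurable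
    ultimately have "(\<lambda>\<omega>. Phi (h \<omega> + ?s n *\<^sub>R (xstar - h \<omega>))) \<in> borel_measurable N"
      by (intro borel_measurable_compose_continuous_on[OF continuous_Phi])
    moreover have "(\<lambda>\<omega>. Phi (h \<omega>)) \<in> borel_measurable N"
      by (rule borel_measurable_compose_continuous_on[OF continuous_Phi h hX])
    ultimately show ?thesis by measurable
  qed
  have lim: "(\<lambda>n. ?q n \<omega>) \<longlonglongrightarrow> dPhi (h \<omega>) \<bullet> (xstar - h \<omega>)" if "\<omega> \<in> space N" for \<omega>
    using filterlim_compose[OF directional_derivative_within_convex[OF convex_X hX[OF that] xstar
        derivative[OF hX[OF that]]] s] .
  have "(\<lambda>\<omega>. dPhi (h \<omega>) \<bullet> (xstar - h \<omega>)) \<in> borel_measurable N"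
    by (rule borel_measurable_LIMSEQ_real[OF lim meas])
  moreover have "(\<lambda>\<omega>. Phi (h \<omega>)) \<in> borel_measurable N"
    by (rule borel_measurable_compose_continuous_on[OF continuous_Phi h hX])
  ultimately show ?thesis unfolding bregman_div_def by measurable
qed

lemma borel_measurable_objective:
  assumes h: "h \<in> borel_measurable N" and hX: "\<And>\<omega>. \<omega> \<in> space N \<Longrightarrow> h \<omega> \<in> X"
    and hU: "\<And>\<omega>. \<omega> \<in> space N \<Longrightarrow> h \<omega> \<in> interior U"
  shows "(\<lambda>\<omega>. objective f \<psi> (h \<omega>)) \<in> borel_measurable N"
proof -
  have "continuous_on (interior U) (f i)" for i
    using convex_f[of i] convex_U interior_subset
    by (intro convex_on_continuous open_interior) (blast intro: convex_on_subset convex_interior)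
  then have 1: "(\<lambda>\<omega>. f i (h \<omega>)) \<in> borel_measurable N" for i
    by (rule borel_measurable_compose_continuous_on[OF _ h hU])
  have "continuous_on X (\<psi> i)" for i
  proof -
    obtain K where K: "K > 0" "\<And>z. nrm z \<le> K * norm z" using nrm_upper[OF nrm] by auto
    have "\<bar>\<psi> i z - \<psi> i w\<bar> \<le> (G\<psi> * K) * dist z w" if "z \<in> X" "w \<in> X" for z w
      using order.trans[OF \<psi>_lipschitz[OF that] mult_left_mono[OF K(2)[of "z - w"] less_imp_le[OF G\<psi>_pos]]]
      by (simp add: dist_norm mult.assoc)
    then have "(G\<psi> * K)-lipschitz_on X (\<psi> i)"
      using K G\<psi>_pos by (intro lipschitz_onI) (auto simp: dist_real_def)
    then show ?thesis by (rule lipschitz_on_continuous_on)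
  qed
  then have 2: "(\<lambda>\<omega>. \<psi> i (h \<omega>)) \<in> borel_measurable N" for i
    by (rule borel_measurable_compose_continuous_on[OF _ h hX])
  show ?thesis unfolding objective_def using 1 2 by measurable
qed

end

section \<open>The random run\<close>

abbreviation (input) stepsize :: "nat \<Rightarrow> real" where "stepsize t \<equiv> 1 / sqrt (real t + 1)"

lemma stepsize_square: "(stepsize t)\<^sup>2 = 1 / (real t + 1)"
  by (simp add: power_divide)

lemma stepsize_le_1: "stepsize t \<le> 1"
  by simp

lemma sum_stepsize_square_le: "(\<Sum>t=1..T. (stepsize t)\<^sup>2) \<le> ln (real T + 1)"
proof (induction T)
  case (Suc T)
  have "ln (real T + 1) - ln (real T + 2) \<le> (real T + 1 - (real T + 2)) / (real T + 2)"
    by (rule ln_diff_le) auto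
  then have "(stepsize (Suc T))\<^sup>2 \<le> ln (real (Suc T) + 1) - ln (real T + 1)"
    unfolding stepsize_square by (simp add: add.commute)
  moreover have "(\<Sum>t=1..Suc T. (stepsize t)\<^sup>2) = (\<Sum>t=1..T. (stepsize t)\<^sup>2) + (stepsize (Suc T))\<^sup>2"
    by (rule sum.cl_ivl_Suc[THEN trans]) simp
  ultimately show ?case using Suc by linarith
qed simp

locale dcsmd_random = dcsmd_problem nrm X U f \<psi> Phi dPhi W xstar B \<eta> G G\<psi> \<sigma>
  for nrm :: "real^'n \<Rightarrow> real"
    and X U and f \<psi> :: "'m::finite \<Rightarrow> real^'n \<Rightarrow> real" and Phi dPhi
    and W :: "nat \<Rightarrow> real^'m^'m" and xstar B \<eta> G G\<psi> \<sigma> +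
  fixes x1 :: "'m \<Rightarrow> real^'n" and \<theta> \<kappa> :: real and M :: "'w measure" and Fil
    and x y g \<xi> :: "'m \<Rightarrow> nat \<Rightarrow> 'w \<Rightarrow> real^'n"
  assumes x1: "\<And>i. x1 i \<in> X" and \<theta>: "1 / 2 \<le> \<theta>" and \<kappa>: "0 < \<kappa>"
    and run: "dcsmd_run X U f \<psi> Phi dPhi W stepsize x1 M Fil x y g \<xi>"
    and tail: "noise_assumption nrm \<theta> \<kappa> M Fil \<xi>"
begin

lemma prob: "prob_space M"
  and filtration: "filtration (space M) Fil"
  and sub: "subalgebra M (Fil t)"
  and start: "\<omega> \<in> space M \<Longrightarrow> x i 1 \<omega> = x1 i"
  using run by (simp_all add: dcsmd_run_def)

lemma
  assumes "1 \<le> t"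
  shows x_meas: "x i t \<in> borel_measurable (Fil (t - 1))"
    and \<xi>_meas: "\<xi> i t \<in> borel_measurable (Fil t)"
    and \<xi>_int: "integrable M (\<lambda>\<omega>. \<xi> i t \<omega> $ k)"
    and \<xi>_mean: "AE \<omega> in M. real_cond_exp M (Fil (t - 1)) (\<lambda>\<omega>. \<xi> i t \<omega> $ k) \<omega> = 0"
    and y_eq: "\<omega> \<in> space M \<Longrightarrow> y i t \<omega> = (\<Sum>j\<in>UNIV. W t $ i $ j *\<^sub>R x j t \<omega>)"
    and g_eq: "\<omega> \<in> space M \<Longrightarrow> g i t \<omega> \<in> subdifferential U (f i) (x i t \<omega>)"
    and x_next: "\<omega> \<in> space M \<Longrightarrow> is_arg_min
      (\<lambda>z. (g i t \<omega> - \<xi> i t \<omega>) \<bullet> z + 1 / stepsize t * D z (y i t \<omega>) + \<psi> i z)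
      (\<lambda>z. z \<in> X) (x i (t + 1) \<omega>)"
  using run assms unfolding dcsmd_run_def by blast+

text \<open>
  This is the only link between the stochastic run and the pathwise estimates.
\<close>

lemma path:
  assumes \<omega>: "\<omega> \<in> space M"
  shows "dcsmd_path nrm X U f \<psi> Phi dPhi W xstar B \<eta> G G\<psi> \<sigma> stepsize
    (\<lambda>i t. x i t \<omega>) (\<lambda>i t. y i t \<omega>) (\<lambda>i t. g i t \<omega>) (\<lambda>i t. \<xi> i t \<omega>)"
proof
  show "stepsize t \<le> stepsize s" if "s \<le> t" for s t :: nat
    using that by (intro divide_left_mono) auto
  show "x i 1 \<omega> \<in> X" for i using start[OF \<omega>] x1 by simp
  show "0 < stepsize t" for t by simp
qed (use y_eq g_eq x_next \<omega> in blast)+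

lemma space_Fil: "space (Fil t) = space M"
  using sub[of t] by (simp add: subalgebra_def)

lemma from_Fil: "h \<in> borel_measurable (Fil t) \<Longrightarrow> h \<in> borel_measurable M"
  by (rule measurable_from_subalg[OF sub])

lemma x_X: "1 \<le> t \<Longrightarrow> \<omega> \<in> space M \<Longrightarrow> x i t \<omega> \<in> X"
  using dcsmd_path.x_in_X[OF path] by blast

lemma y_meas:
  assumes t: "1 \<le> t"
  shows "y i t \<in> borel_measurable (Fil (t - 1))"
proof -
  have "(\<lambda>\<omega>. \<Sum>j\<in>UNIV. W t $ i $ j *\<^sub>R x j t \<omega>) \<in> borel_measurable (Fil (t - 1))"
    using x_meas[OF t] by measurable
  then show ?thesis
    by (rule measurable_cong[THEN iffD1, rotated]) (use y_eq[OF t] space_Fil in auto)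
qed

lemma dual_noise_meas:
  assumes t: "1 \<le> t"
  shows "(\<lambda>\<omega>. dual_norm nrm (\<xi> i t \<omega>)) \<in> borel_measurable M"
  using from_Fil[OF \<xi>_meas[OF t]]
  by (rule measurable_compose[OF _ borel_measurable_continuous_onI[OF continuous_on_dual_norm[OF nrm]]])

text \<open>
  The pathwise \<open>level\<close> as a function of the sample point. It is measurable with respect to the past, like
  the \<open>direction\<close> with which the noise is paired.
\<close>

definition level_at :: "real \<Rightarrow> nat \<Rightarrow> 'w \<Rightarrow> real" where
  "level_at A t \<omega> = sqrt ((\<Sum>i\<in>UNIV. D xstar (x i t \<omega>)) + A)"

definition direction :: "real \<Rightarrow> 'm \<Rightarrow> nat \<Rightarrow> 'w \<Rightarrow> real^'n" where
  "direction A i t \<omega> = (1 / level_at A t \<omega>) *\<^sub>R (y i t \<omega> - xstar)"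

definition noise_scale :: real where "noise_scale = sqrt (2 / \<sigma>) * \<kappa>"

lemma noise_scale_pos: "0 < noise_scale"
  using \<sigma>_pos \<kappa> by (simp add: noise_scale_def)

lemma direction_meas:
  assumes t: "1 \<le> t"
  shows "direction A i t \<in> borel_measurable (Fil (t - 1))"
proof -
  have "(\<lambda>\<omega>. D xstar (x i t \<omega>)) \<in> borel_measurable (Fil (t - 1))" for i
    using x_meas[OF t] x_X[OF t] by (intro borel_measurable_bregman) (auto simp: space_Fil)
  then have "level_at A t \<in> borel_measurable (Fil (t - 1))" unfolding level_at_def by measurable
  then show ?thesis unfolding direction_def using y_meas[OF t] by measurable
qed

lemma nrm_direction:
  assumes t: "1 \<le> t" and \<omega>: "\<omega> \<in> space M" and A: "0 < A"
  shows "nrm (direction A i t \<omega>) \<le> sqrt (2 / \<sigma>)"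
proof -
  interpret p: dcsmd_path nrm X U f \<psi> Phi dPhi W xstar B \<eta> G G\<psi> \<sigma> stepsize
    "\<lambda>i t. x i t \<omega>" "\<lambda>i t. y i t \<omega>" "\<lambda>i t. g i t \<omega>" "\<lambda>i t. \<xi> i t \<omega>" by (rule path[OF \<omega>])
  have level_at: "level_at A t \<omega> = p.level A t" by (simp add: level_at_def p.level_def p.Z_def)
  have pos: "0 < p.level A t" by (rule p.level_pos[OF t A])
  have "nrm (y i t \<omega> - xstar) \<le> sqrt (2 / \<sigma>) * sqrt (p.Z t)" by (rule p.y_distance[OF t])
  also have "\<dots> \<le> sqrt (2 / \<sigma>) * p.level A t"
    unfolding p.level_def using A \<sigma>_pos by (intro mult_left_mono) auto
  finally show ?thesis using pos
    by (simp add: direction_def nrm_scaleR[OF nrm] level_at divide_le_eq)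
qed

lemma noise_component_bound:
  assumes t: "1 \<le> t" and \<omega>: "\<omega> \<in> space M" and A: "0 < A"
  shows "\<bar>\<xi> i t \<omega> \<bullet> direction A i t \<omega>\<bar> \<le> noise_scale * (dual_norm nrm (\<xi> i t \<omega>) / \<kappa>)"
proof -
  have "\<bar>\<xi> i t \<omega> \<bullet> direction A i t \<omega>\<bar> \<le> dual_norm nrm (\<xi> i t \<omega>) * sqrt (2 / \<sigma>)"
    by (rule order.trans[OF dual_norm_holder[OF nrm] mult_left_mono[OF nrm_direction[OF t \<omega> A]]])
      (rule dual_norm_nonneg[OF nrm])
  then show ?thesis using \<kappa> by (simp add: noise_scale_def mult.commute)
qed

text \<open>
  The sum over the agents of the normalised inner products, clipped from above. No inner
  product exceeds the threshold as long as the noise has dual norm at most \<open>\<kappa> * L powr \<theta>\<close>.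
\<close>

definition clipped :: "real \<Rightarrow> real \<Rightarrow> nat \<Rightarrow> 'w \<Rightarrow> real" where
  "clipped A L t \<omega> = (\<Sum>i\<in>UNIV. min (\<xi> i t \<omega> \<bullet> direction A i t \<omega>) (noise_scale * L powr \<theta>))"

lemma clipped_meas:
  assumes t: "1 \<le> t"
  shows "clipped A L t \<in> borel_measurable (Fil t)"
proof -
  have "subalgebra (Fil t) (Fil (t - 1))"
    using filtration.space_F[OF filtration] filtration.sets_F_mono[OF filtration, of "t - 1" t]
    by (auto simp: subalgebra_def)
  then have "direction A i t \<in> borel_measurable (Fil t)" for i
    using direction_meas[OF t] by (rule measurable_from_subalg)
  then show ?thesis unfolding clipped_def using \<xi>_meas[OF t] by measurable
qed

text \<open>
  The noise vectors of different agents may depend on each other. Jensen's inequality for the exponential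
  reduces their sum to single agents, with the exponent multiplied by the number of agents.
\<close>

lemma clipped_mgf:
  assumes t: "1 \<le> t" and A: "0 < A" and L: "1 \<le> L"
    and s: "0 \<le> s" "real CARD('m) * s * noise_scale * L powr (max 0 (\<theta> - 1)) \<le> 1 / 2"
    and Y: "Y \<in> borel_measurable (Fil (t - 1))" "\<And>\<omega>. 0 \<le> Y \<omega>" "\<And>\<omega>. \<omega> \<in> space M \<Longrightarrow> Y \<omega> \<le> b"
  shows "(\<integral>\<^sup>+\<omega>. ennreal (Y \<omega> * exp (s * clipped A L t \<omega>)) \<partial>M)
    \<le> ennreal (exp (2 * (real CARD('m) * s)\<^sup>2 * (noise_scale\<^sup>2 * subweibull_const \<theta>)))
      * (\<integral>\<^sup>+\<omega>. ennreal (Y \<omega>) \<partial>M)"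
proof -
  let ?m = "real CARD('m)"
  let ?X = "\<lambda>i \<omega>. min (\<xi> i t \<omega> \<bullet> direction A i t \<omega>) (noise_scale * L powr \<theta>)"
  let ?R = "ennreal (exp (2 * (?m * s)\<^sup>2 * (noise_scale\<^sup>2 * subweibull_const \<theta>))) * (\<integral>\<^sup>+\<omega>. ennreal (Y \<omega>) \<partial>M)"
  obtain c where c: "c > 0" "\<And>z. c * norm z \<le> nrm z" using nrm_lower[OF nrm] by auto
  have norm_dir: "norm (direction A i t \<omega>) \<le> sqrt (2 / \<sigma>) / c" if "\<omega> \<in> space M" for i \<omega>
    using order.trans[OF c(2) nrm_direction[OF t that A]] c(1) by (simp add: le_divide_eq mult.commute)
  have single: "(\<integral>\<^sup>+\<omega>. ennreal (Y \<omega> * exp ((?m * s) * ?X i \<omega>)) \<partial>M) \<le> ?R" for i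
  proof (rule truncated_noise_mgf[OF prob sub \<xi>_int[OF t] \<xi>_mean[OF t] direction_meas[OF t] norm_dir])
    show "(\<lambda>\<omega>. dual_norm nrm (\<xi> i t \<omega>) / \<kappa>) \<in> borel_measurable M"
      using dual_noise_meas[OF t] by measurable
    show "0 \<le> dual_norm nrm (\<xi> i t \<omega>) / \<kappa>" for \<omega> using dual_norm_nonneg[OF nrm] \<kappa> by simp
    show "AE \<omega> in M. nn_cond_exp M (Fil (t - 1))
        (\<lambda>\<omega>. ennreal (exp ((dual_norm nrm (\<xi> i t \<omega>) / \<kappa>) powr (1 / \<theta>)))) \<omega> \<le> 2"
      using tail t by (simp add: noise_assumption_def)
  qed (use noise_component_bound[OF t _ A] L \<theta> noise_scale_pos s Y in auto)
  have jensen: "exp (s * clipped A L t \<omega>) \<le> (\<Sum>i\<in>UNIV. (1 / ?m) * exp ((?m * s) * ?X i \<omega>))" for \<omega>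
  proof -
    have "exp (\<Sum>i\<in>(UNIV :: 'm set). (1 / ?m) *\<^sub>R ((?m * s) * ?X i \<omega>))
        \<le> (\<Sum>i\<in>UNIV. (1 / ?m) * exp ((?m * s) * ?X i \<omega>))"
      by (rule convex_on_sum[OF _ _ exp_convex]) auto
    then show ?thesis by (simp add: clipped_def sum_distrib_left)
  qed
  have Xm: "(\<lambda>\<omega>. Y \<omega> * exp ((?m * s) * ?X i \<omega>)) \<in> borel_measurable M" for i
    using from_Fil[OF Y(1)] from_Fil[OF \<xi>_meas[OF t, of i]] from_Fil[OF direction_meas[OF t, of A i]]
    by measurable
  have "(\<integral>\<^sup>+\<omega>. ennreal (Y \<omega> * exp (s * clipped A L t \<omega>)) \<partial>M)
      \<le> (\<integral>\<^sup>+\<omega>. (\<Sum>i\<in>UNIV. ennreal (1 / ?m) * ennreal (Y \<omega> * exp ((?m * s) * ?X i \<omega>))) \<partial>M)"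
  proof (rule nn_integral_mono)
    fix \<omega>
    have "Y \<omega> * exp (s * clipped A L t \<omega>) \<le> Y \<omega> * (\<Sum>i\<in>UNIV. (1 / ?m) * exp ((?m * s) * ?X i \<omega>))"
      by (rule mult_left_mono[OF jensen Y(2)])
    also have "\<dots> = (\<Sum>i\<in>UNIV. (1 / ?m) * (Y \<omega> * exp ((?m * s) * ?X i \<omega>)))"
      by (simp only: sum_distrib_left mult.left_commute)
    finally have "ennreal (Y \<omega> * exp (s * clipped A L t \<omega>))
        \<le> ennreal (\<Sum>i\<in>UNIV. (1 / ?m) * (Y \<omega> * exp ((?m * s) * ?X i \<omega>)))" by (rule ennreal_leI)
    also have "\<dots> = (\<Sum>i\<in>UNIV. ennreal ((1 / ?m) * (Y \<omega> * exp ((?m * s) * ?X i \<omega>))))"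
      by (rule sum_ennreal[symmetric]) (simp add: Y(2))
    also have "\<dots> = (\<Sum>i\<in>UNIV. ennreal (1 / ?m) * ennreal (Y \<omega> * exp ((?m * s) * ?X i \<omega>)))"
      by (intro sum.cong refl ennreal_mult) (simp_all add: Y(2))
    finally show "ennreal (Y \<omega> * exp (s * clipped A L t \<omega>))
        \<le> (\<Sum>i\<in>UNIV. ennreal (1 / ?m) * ennreal (Y \<omega> * exp ((?m * s) * ?X i \<omega>)))" .
  qed
  also have "\<dots> = (\<Sum>i\<in>UNIV. ennreal (1 / ?m) * (\<integral>\<^sup>+\<omega>. ennreal (Y \<omega> * exp ((?m * s) * ?X i \<omega>)) \<partial>M))"
    using Xm by (subst nn_integral_sum) (auto intro!: sum.cong nn_integral_cmult)
  also have "\<dots> \<le> (\<Sum>i\<in>(UNIV :: 'm set). ennreal (1 / ?m) * ?R)"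
    by (intro sum_mono mult_left_mono single) auto
  also have "\<dots> = ennreal (?m * (1 / ?m)) * ?R"
    by (simp only: sum_constant ennreal_of_nat_eq_real_of_nat ennreal_mult' of_nat_0_le_iff mult.assoc)
  also have "\<dots> = ?R" by simp
  finally show ?thesis .
qed

definition noise_level :: "real \<Rightarrow> real" where "noise_level L = \<kappa> * L powr \<theta>"

text \<open>
  The threshold for which the Chernoff bound with the exponent
  \<open>1 / (2 * CARD('m) * noise_scale * L powr max 0 (\<theta> - 1))\<close>, the largest that
  \<open>clipped_mgf\<close> admits for stepsizes up to 1, yields probability \<open>\<delta> / (2 * T)\<close>.
\<close>

definition deviation :: "nat \<Rightarrow> real \<Rightarrow> real \<Rightarrow> real" where
  "deviation T \<delta> L = 2 * real CARD('m) * noise_scale * L powr (max 0 (\<theta> - 1))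
    * (subweibull_const \<theta> * (\<Sum>t=1..T. (stepsize t)\<^sup>2) + ln (2 * real T / \<delta>))"

text \<open>
  Half of \<open>\<delta>\<close> is spent on large noise vectors and half on the partial sums. The union over \<open>k\<close>
  replaces a maximal inequality; its cost, a factor \<open>T\<close> inside the logarithm, is absorbed by the rate.
\<close>

definition good_event :: "nat \<Rightarrow> real \<Rightarrow> real \<Rightarrow> real \<Rightarrow> 'w set" where
  "good_event T \<delta> A L = {\<omega>\<in>space M.
     (\<forall>t\<in>{1..T}. \<forall>i. dual_norm nrm (\<xi> i t \<omega>) \<le> noise_level L) \<and>
     (\<forall>k\<in>{1..T}. (\<Sum>t=1..k. stepsize t * clipped A L t \<omega>) \<le> deviation T \<delta> L)}"

lemma large_noise_prob:
  assumes t: "1 \<le> t" and L: "0 \<le> L"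
  shows "measure M {\<omega>\<in>space M. noise_level L < dual_norm nrm (\<xi> i t \<omega>)} \<le> 2 * exp (- L)"
proof -
  have "measure M {\<omega>\<in>space M. L powr \<theta> < dual_norm nrm (\<xi> i t \<omega>) / \<kappa>} \<le> 2 * exp (- L)"
  proof (rule subweibull_tail[OF prob sub])
    show "(\<lambda>\<omega>. dual_norm nrm (\<xi> i t \<omega>) / \<kappa>) \<in> borel_measurable M"
      using dual_noise_meas[OF t] by measurable
    show "AE \<omega> in M. nn_cond_exp M (Fil (t - 1))
        (\<lambda>\<omega>. ennreal (exp ((dual_norm nrm (\<xi> i t \<omega>) / \<kappa>) powr (1 / \<theta>)))) \<omega> \<le> 2"
      using tail t by (simp add: noise_assumption_def)
  qed (use dual_norm_nonneg[OF nrm] \<kappa> \<theta> L in auto)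
  then show ?thesis using \<kappa> by (simp add: noise_level_def less_divide_eq mult.commute)
qed

lemma large_deviation_prob:
  assumes A: "0 < A" and L: "1 \<le> L" and k: "1 \<le> k" "k \<le> T" and \<delta>: "0 < \<delta>"
  shows "measure M {\<omega>\<in>space M. deviation T \<delta> L \<le> (\<Sum>t=1..k. stepsize t * clipped A L t \<omega>)}
    \<le> \<delta> / (2 * real T)"
proof -
  let ?m = "real CARD('m)" and ?Lp = "L powr (max 0 (\<theta> - 1))" and ?r = noise_scale and ?C = "subweibull_const \<theta>"
  define p where "p = ?m * ?r * ?Lp"
  define lam where "lam = 1 / (2 * p)"
  have Lp: "1 \<le> ?Lp" using L by (rule ge_one_powr_ge_zero) simp
  have pos: "0 < p" unfolding p_def using noise_scale_pos Lp by (intro mult_pos_pos) auto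
  have "lam * p = 1 / 2" using pos by (simp add: lam_def)
  moreover have "?m * lam * ?r * ?Lp = lam * p" by (simp only: p_def mult_ac)
  moreover have "0 < lam" using pos by (simp add: lam_def)
  ultimately have lam: "0 < lam" "?m * lam * ?r * ?Lp = 1 / 2" by (simp_all only:)
  have lam1: "?m * lam * ?r \<le> 1 / 2"
  proof -
    have "?m * lam * ?r * 1 \<le> ?m * lam * ?r * ?Lp"
      using lam(1) noise_scale_pos Lp by (intro mult_left_mono) auto
    then show ?thesis using lam(2) by simp
  qed
  have markov: "measure M {\<omega>\<in>space M. lam * deviation T \<delta> L \<le> (\<Sum>t=1..k. lam * (stepsize t * clipped A L t \<omega>))}
      \<le> exp ((\<Sum>t=1..k. ?C * (stepsize t)\<^sup>2) - lam * deviation T \<delta> L)"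
  proof (rule adapted_sum_chernoff[OF prob filtration sub])
    fix t :: nat assume t: "1 \<le> t"
    show "(\<lambda>\<omega>. lam * (stepsize t * clipped A L t \<omega>)) \<in> borel_measurable (Fil t)"
      using clipped_meas[OF t, of A L] by measurable
    { fix \<omega>
      have "clipped A L t \<omega> \<le> (\<Sum>i\<in>(UNIV::'m set). ?r * L powr \<theta>)"
        unfolding clipped_def by (intro sum_mono) auto
      then have c: "clipped A L t \<omega> \<le> ?m * (?r * L powr \<theta>)" by simp
      have "stepsize t * clipped A L t \<omega> \<le> 1 * (?m * (?r * L powr \<theta>))"
        by (rule order.trans[OF mult_left_mono[OF c] mult_right_mono[OF stepsize_le_1]])
          (use noise_scale_pos in auto)
      then show "lam * (stepsize t * clipped A L t \<omega>) \<le> lam * (?m * (?r * L powr \<theta>))"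
        using lam(1) by (intro mult_left_mono) auto }
    fix Y :: "'w \<Rightarrow> real" and b
    assume Y: "Y \<in> borel_measurable (Fil (t - 1))" "\<And>\<omega>. 0 \<le> Y \<omega>" "\<And>\<omega>. \<omega> \<in> space M \<Longrightarrow> Y \<omega> \<le> b"
    let ?s = "lam * stepsize t"
    have s0: "0 \<le> ?s" using lam(1) by simp
    have "?s \<le> lam" using lam(1) mult_left_mono[OF stepsize_le_1[of t], of lam] by simp
    then have "?m * ?s * ?r * ?Lp \<le> ?m * lam * ?r * ?Lp"
      using noise_scale_pos by (intro mult_right_mono mult_left_mono) auto
    then have s: "?m * ?s * ?r * ?Lp \<le> 1 / 2" using lam(2) by simp
    have "2 * (?m * ?s)\<^sup>2 * (?r\<^sup>2 * ?C) = 2 * (?m * lam * ?r)\<^sup>2 * (?C * (stepsize t)\<^sup>2)"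
      by (simp only: power_mult_distrib mult_ac)
    also have "\<dots> \<le> 2 * (1 / 2)\<^sup>2 * (?C * (stepsize t)\<^sup>2)"
      using lam1 lam(1) noise_scale_pos subweibull_const_pos[of \<theta>]
      by (intro mult_right_mono mult_left_mono power_mono) auto
    also have "\<dots> \<le> 1 * (?C * (stepsize t)\<^sup>2)"
      using subweibull_const_pos[of \<theta>]
      by (intro mult_right_mono mult_nonneg_nonneg) (auto simp: power2_eq_square)
    finally have c: "2 * (?m * ?s)\<^sup>2 * (?r\<^sup>2 * ?C) \<le> ?C * (stepsize t)\<^sup>2" by (simp only: mult_1)
    have "(\<integral>\<^sup>+\<omega>. ennreal (Y \<omega> * exp (lam * (stepsize t * clipped A L t \<omega>))) \<partial>M)
        \<le> ennreal (exp (2 * (?m * ?s)\<^sup>2 * (?r\<^sup>2 * ?C))) * (\<integral>\<^sup>+\<omega>. ennreal (Y \<omega>) \<partial>M)"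
      using clipped_mgf[OF t A L s0 s Y] by (simp only: mult.assoc)
    also have "\<dots> \<le> ennreal (exp (?C * (stepsize t)\<^sup>2)) * (\<integral>\<^sup>+\<omega>. ennreal (Y \<omega>) \<partial>M)"
      using c by (intro mult_right_mono ennreal_leI) auto
    finally show "(\<integral>\<^sup>+\<omega>. ennreal (Y \<omega> * exp (lam * (stepsize t * clipped A L t \<omega>))) \<partial>M)
        \<le> ennreal (exp (?C * (stepsize t)\<^sup>2)) * (\<integral>\<^sup>+\<omega>. ennreal (Y \<omega>) \<partial>M)" .
  qed
  have "lam * deviation T \<delta> L = ?C * (\<Sum>t=1..T. (stepsize t)\<^sup>2) + ln (2 * real T / \<delta>)"
  proof -
    have "deviation T \<delta> L = 2 * p * (?C * (\<Sum>t=1..T. (stepsize t)\<^sup>2) + ln (2 * real T / \<delta>))"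
      by (simp only: deviation_def p_def mult_ac)
    then show ?thesis using pos by (simp add: lam_def)
  qed
  moreover have "(\<Sum>t=1..k. ?C * (stepsize t)\<^sup>2) \<le> ?C * (\<Sum>t=1..T. (stepsize t)\<^sup>2)"
    unfolding sum_distrib_left using k subweibull_const_pos[of \<theta>] by (intro sum_mono2) auto
  ultimately have "(\<Sum>t=1..k. ?C * (stepsize t)\<^sup>2) - lam * deviation T \<delta> L \<le> - ln (2 * real T / \<delta>)"
    by linarith
  then have "exp ((\<Sum>t=1..k. ?C * (stepsize t)\<^sup>2) - lam * deviation T \<delta> L) \<le> exp (- ln (2 * real T / \<delta>))"
    by (simp only: exp_le_cancel_iff)
  also have "exp (- ln (2 * real T / \<delta>)) = \<delta> / (2 * real T)"
    using \<delta> k by (simp add: exp_minus)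
  finally have "measure M {\<omega>\<in>space M. lam * deviation T \<delta> L
      \<le> (\<Sum>t=1..k. lam * (stepsize t * clipped A L t \<omega>))} \<le> \<delta> / (2 * real T)"
    by (rule order.trans[OF markov])
  moreover have "lam * deviation T \<delta> L \<le> (\<Sum>t=1..k. lam * (stepsize t * clipped A L t \<omega>))
      \<longleftrightarrow> deviation T \<delta> L \<le> (\<Sum>t=1..k. stepsize t * clipped A L t \<omega>)" for \<omega>
    unfolding sum_distrib_left[symmetric] using lam(1) by (rule mult_le_cancel_left_pos)
  ultimately show ?thesis by (simp only:)
qed

end

section \<open>The good event and the final rate\<close>

context dcsmd_problem
begin

text \<open>
  The following constants depend on the problem, the network, the initial points and the tail parameters
  only. First, \<open>log_growth\<close> is the price for replacing \<open>ln (4 * CARD('m) * T / \<delta>)\<close> by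
  \<open>ln (T / \<delta>)\<close>. The others multiply the logarithmic factors in the bounds for the deviation of the
  noise, the drift, the deterministic errors, the level and the final rate.
\<close>

definition log_growth :: real where "log_growth = 1 + ln (4 * real CARD('m))"

definition noise_coeff :: "real \<Rightarrow> real \<Rightarrow> real" where
  "noise_coeff \<theta> \<kappa> = 2 * real CARD('m) * (sqrt (2 / \<sigma>) * \<kappa>) * log_growth powr (max 0 (\<theta> - 1))
    * (2 * subweibull_const \<theta> + 2)"

definition drift_coeff :: "real \<Rightarrow> real \<Rightarrow> real" where
  "drift_coeff \<theta> \<kappa> = (G + \<kappa> * log_growth powr \<theta> + G\<psi>) / \<sigma>"

definition error_coeff :: "('m \<Rightarrow> real^'n) \<Rightarrow> real \<Rightarrow> real \<Rightarrow> real" where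
  "error_coeff x1 \<theta> \<kappa> = real CARD('m) * (2 * G + G\<psi>)
      * ((real mixing_time * spread nrm x1 + 8 * real mixing_time * drift_coeff \<theta> \<kappa>) / mixing_rate)
    + 2 * real CARD('m) * \<sigma> * (drift_coeff \<theta> \<kappa>)\<^sup>2"

definition level_coeff :: "('m \<Rightarrow> real^'n) \<Rightarrow> real \<Rightarrow> real \<Rightarrow> real" where
  "level_coeff x1 \<theta> \<kappa> = sqrt (\<Sum>i\<in>UNIV. D xstar (x1 i)) + 1 + noise_coeff \<theta> \<kappa> / 2 + error_coeff x1 \<theta> \<kappa> / 2"

definition rate_coeff :: "('m \<Rightarrow> real^'n) \<Rightarrow> real \<Rightarrow> real \<Rightarrow> real" where
  "rate_coeff x1 \<theta> \<kappa> = 8 * (level_coeff x1 \<theta> \<kappa>)\<^sup>2"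

lemma card_ge_1: "1 \<le> real CARD('m)"
proof -
  have "0 < CARD('m)" by (rule zero_less_card_finite)
  then show ?thesis by linarith
qed

lemma log_growth_ge_1: "1 \<le> log_growth"
proof -
  have "0 \<le> ln (4 * real CARD('m))" by (rule ln_ge_zero) (use card_ge_1 in linarith)
  then show ?thesis by (simp add: log_growth_def)
qed

lemma coeff_nonneg:
  assumes "0 < \<kappa>"
  shows "0 \<le> noise_coeff \<theta> \<kappa>" "0 \<le> drift_coeff \<theta> \<kappa>" "0 \<le> error_coeff x1 \<theta> \<kappa>"
proof -
  show 1: "0 \<le> noise_coeff \<theta> \<kappa>"
    unfolding noise_coeff_def using assms \<sigma>_pos subweibull_const_pos[of \<theta>]
    by (intro mult_nonneg_nonneg) auto
  show 2: "0 \<le> drift_coeff \<theta> \<kappa>"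
    unfolding drift_coeff_def using assms \<sigma>_pos G_pos G\<psi>_pos by (intro divide_nonneg_pos) auto
  show "0 \<le> error_coeff x1 \<theta> \<kappa>"
    unfolding error_coeff_def using 2 mixing_rate(1) \<sigma>_pos G_pos G\<psi>_pos spread_nonneg[OF nrm, of x1]
    by (intro add_nonneg_nonneg mult_nonneg_nonneg divide_nonneg_pos) auto
qed

lemma level_coeff_ge_1:
  assumes "0 < \<kappa>" "\<And>i. x1 i \<in> X"
  shows "1 \<le> level_coeff x1 \<theta> \<kappa>"
  using coeff_nonneg[OF assms(1)] assms(2) xstar
  by (auto simp: level_coeff_def intro!: add_increasing add_increasing2 sum_nonneg bregman_nonneg)

end

context dcsmd_random
begin

lemma good_event_prob:
  assumes A: "0 < A" and L: "1 \<le> L" "L = ln (4 * real CARD('m) * real T / \<delta>)"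
    and T: "1 \<le> T" and \<delta>: "0 < \<delta>"
  shows "good_event T \<delta> A L \<in> sets M" "1 - \<delta> \<le> measure M (good_event T \<delta> A L)"
proof -
  interpret P: prob_space M by (rule prob)
  let ?m = "real CARD('m)"
  let ?I = "{1..T} \<times> (UNIV :: 'm set)"
  define N where "N = (\<lambda>(t, i). {\<omega>\<in>space M. noise_level L < dual_norm nrm (\<xi> i t \<omega>)})"
  define S where "S k = {\<omega>\<in>space M. deviation T \<delta> L < (\<Sum>t=1..k. stepsize t * clipped A L t \<omega>)}" for k
  define S' where "S' k = {\<omega>\<in>space M. deviation T \<delta> L \<le> (\<Sum>t=1..k. stepsize t * clipped A L t \<omega>)}" for k
  have sumM: "(\<lambda>\<omega>. \<Sum>t=1..k. stepsize t * clipped A L t \<omega>) \<in> borel_measurable M" for k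
    using from_Fil[OF clipped_meas] by (intro borel_measurable_sum borel_measurable_times) auto
  have NM: "N p \<in> sets M" if "p \<in> ?I" for p
  proof -
    obtain t i where p: "p = (t, i)" by (cases p)
    then have "1 \<le> t" using that by auto
    note [measurable] = dual_noise_meas[OF this, of i]
    show ?thesis unfolding N_def p prod.case by measurable
  qed
  have SM: "S k \<in> sets M" "S' k \<in> sets M" for k
    unfolding S_def S'_def using sumM[of k] by measurable
  let ?B = "(\<Union>p\<in>?I. N p) \<union> (\<Union>k\<in>{1..T}. S k)"
  have good: "good_event T \<delta> A L = space M - ?B"
  proof -
    have "\<omega> \<in> good_event T \<delta> A L \<longleftrightarrow> \<omega> \<in> space M \<and> (\<forall>p\<in>?I. \<omega> \<notin> N p) \<and> (\<forall>k\<in>{1..T}. \<omega> \<notin> S k)" for \<omega>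
      unfolding good_event_def N_def S_def by (auto simp: not_less)
    then show ?thesis by blast
  qed
  have BM: "?B \<in> sets M" using NM SM by (intro sets.Un sets.finite_UN) auto
  then show "good_event T \<delta> A L \<in> sets M" unfolding good by (rule sets.compl_sets)
  have "measure M (\<Union>p\<in>?I. N p) \<le> (\<Sum>p\<in>?I. measure M (N p))"
    using NM by (intro P.finite_measure_subadditive_finite) auto
  also have "\<dots> \<le> (\<Sum>p\<in>?I. 2 * exp (- L))"
    using large_noise_prob L(1) by (intro sum_mono) (auto simp: N_def)
  also have "\<dots> = ?m * real T * (2 * exp (- L))" by (simp add: card_cartesian_product)
  also have "exp (- L) = \<delta> / (4 * ?m * real T)"
    using \<delta> T card_ge_1 by (simp add: L(2) exp_minus)
  also have "?m * real T * (2 * (\<delta> / (4 * ?m * real T))) = \<delta> / 2"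
    using T card_ge_1 by (simp add: field_simps)
  finally have 1: "measure M (\<Union>p\<in>?I. N p) \<le> \<delta> / 2" .
  have "measure M (\<Union>k\<in>{1..T}. S k) \<le> (\<Sum>k\<in>{1..T}. measure M (S k))"
    using SM by (intro P.finite_measure_subadditive_finite) auto
  also have "\<dots> \<le> (\<Sum>k\<in>{1..T}. \<delta> / (2 * real T))"
  proof (rule sum_mono)
    fix k assume k: "k \<in> {1..T}"
    have "measure M (S k) \<le> measure M (S' k)"
      by (rule P.finite_measure_mono) (use SM in \<open>auto simp: S_def S'_def\<close>)
    also have "\<dots> \<le> \<delta> / (2 * real T)"
      unfolding S'_def using k by (intro large_deviation_prob A L(1) \<delta>) auto
    finally show "measure M (S k) \<le> \<delta> / (2 * real T)" .
  qed
  also have "\<dots> = \<delta> / 2" using T by simp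
  finally have 2: "measure M (\<Union>k\<in>{1..T}. S k) \<le> \<delta> / 2" .
  have "measure M ?B \<le> measure M (\<Union>p\<in>?I. N p) + measure M (\<Union>k\<in>{1..T}. S k)"
    using NM SM by (intro measure_Un_le sets.finite_UN) auto
  then show "1 - \<delta> \<le> measure M (good_event T \<delta> A L)"
    unfolding good using 1 2 P.prob_compl[OF BM] by linarith
qed

text \<open>
  The values of \<open>drift\<close> and \<open>total_error\<close> on the good event. They are the same for all trajectories,
  since these start at the same points.
\<close>

definition event_drift :: "real \<Rightarrow> real" where
  "event_drift L = (G + noise_level L + G\<psi>) / \<sigma>"

definition event_error :: "nat \<Rightarrow> real \<Rightarrow> real" where
  "event_error T L = real CARD('m) * (2 * G + G\<psi>)
      * ((real mixing_time * (stepsize 1 * spread nrm x1)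
          + 4 * real mixing_time * event_drift L * (\<Sum>t=1..T. (stepsize t)\<^sup>2)) / mixing_rate)
    + real CARD('m) * \<sigma> * (event_drift L)\<^sup>2 * (\<Sum>t=1..T. (stepsize t)\<^sup>2)"

text \<open>
  On the good event clipping has no effect, and the pathwise bound applies.
\<close>

lemma gap_on_good_event:
  assumes \<omega>: "\<omega> \<in> good_event T \<delta> A L" and T: "1 \<le> T" and A: "0 < A" and dev: "0 \<le> deviation T \<delta> L"
  shows "objective f \<psi> ((1 / real T) *\<^sub>R (\<Sum>t=1..T. x l t \<omega>)) - objective f \<psi> xstar
    \<le> 2 * (sqrt (\<Sum>i\<in>UNIV. D xstar (x1 i)) + sqrt A + deviation T \<delta> L / 2
        + event_error T L / (2 * sqrt A))\<^sup>2 / (real T * stepsize T)"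
proof -
  have \<omega>M: "\<omega> \<in> space M" using \<omega> by (simp add: good_event_def)
  interpret p: dcsmd_path nrm X U f \<psi> Phi dPhi W xstar B \<eta> G G\<psi> \<sigma> stepsize
    "\<lambda>i t. x i t \<omega>" "\<lambda>i t. y i t \<omega>" "\<lambda>i t. g i t \<omega>" "\<lambda>i t. \<xi> i t \<omega>" by (rule path[OF \<omega>M])
  have small: "dual_norm nrm (\<xi> i t \<omega>) \<le> noise_level L" if "1 \<le> t" "t \<le> T" for i t
    using \<omega> that by (simp add: good_event_def)
  have unclipped: "clipped A L t \<omega> = p.noise t / p.level A t" if t: "1 \<le> t" "t \<le> T" for t
  proof -
    have "\<xi> i t \<omega> \<bullet> direction A i t \<omega> \<le> noise_scale * L powr \<theta>" for i
    proof -
      have "dual_norm nrm (\<xi> i t \<omega>) / \<kappa> \<le> L powr \<theta>"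
        using small[OF t, of i] \<kappa> by (simp add: noise_level_def divide_le_eq mult.commute)
      then have "noise_scale * (dual_norm nrm (\<xi> i t \<omega>) / \<kappa>) \<le> noise_scale * L powr \<theta>"
        using noise_scale_pos by (intro mult_left_mono) auto
      then show ?thesis using noise_component_bound[OF t(1) \<omega>M A, of i] by linarith
    qed
    then have "clipped A L t \<omega> = (\<Sum>i\<in>UNIV. \<xi> i t \<omega> \<bullet> direction A i t \<omega>)"
      unfolding clipped_def by (intro sum.cong) (auto simp: min_def)
    then show ?thesis
      by (simp add: direction_def level_at_def p.noise_def p.level_def p.Z_def sum_divide_distrib)
  qed
  have sums: "(\<Sum>t=1..k. stepsize t * (p.noise t / p.level A t)) \<le> deviation T \<delta> L" if k: "k \<le> T" for k
  proof (cases "1 \<le> k")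
    case True
    have "(\<Sum>t=1..k. stepsize t * (p.noise t / p.level A t)) = (\<Sum>t=1..k. stepsize t * clipped A L t \<omega>)"
      using k by (intro sum.cong) (auto simp: unclipped)
    then show ?thesis using \<omega> True k by (simp add: good_event_def)
  qed (use dev in simp)
  have init: "p.Z 1 = (\<Sum>i\<in>UNIV. D xstar (x1 i))" "p.disagreement 1 = spread nrm x1"
    using start[OF \<omega>M] by (simp_all add: p.Z_def p.disagreement_def)
  have err: "p.total_error (noise_level L) T = event_error T L"
    by (simp only: p.total_error_def event_error_def p.drift_def event_drift_def init)
  have "objective f \<psi> ((1 / real T) *\<^sub>R (\<Sum>t=1..T. x l t \<omega>)) - objective f \<psi> xstar
      \<le> (\<Sum>t=1..T. stepsize t * p.gap l t) / (real T * stepsize T)"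
    by (rule p.average_gap_bound[OF T])
  also have "\<dots> \<le> 2 * (sqrt (p.Z 1) + sqrt A + deviation T \<delta> L / 2
        + p.total_error (noise_level L) T / (2 * sqrt A))\<^sup>2 / (real T * stepsize T)"
    by (intro divide_right_mono p.weighted_gap_bound A small sums) auto
  finally show ?thesis unfolding init err .
qed

definition confidence_level :: "nat \<Rightarrow> real \<Rightarrow> real" where
  "confidence_level T \<delta> = ln (4 * real CARD('m) * real T / \<delta>)"

lemma log_estimates:
  assumes T: "10 \<le> T" and \<delta>: "0 < \<delta>" "\<delta> < 1"
  shows "2 \<le> ln (real T)" "0 < ln (1 / \<delta>)" "ln (real T / \<delta>) = ln (real T) + ln (1 / \<delta>)"
    "1 \<le> confidence_level T \<delta>" "confidence_level T \<delta> \<le> log_growth * ln (real T / \<delta>)"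
    "ln (2 * real T / \<delta>) \<le> 2 * ln (real T) + ln (1 / \<delta>)"
    "(\<Sum>t=1..T. (stepsize t)\<^sup>2) \<le> 2 * ln (real T)"
proof -
  have "exp 2 = exp 1 * exp (1::real)" by (simp flip: exp_add)
  also have "\<dots> \<le> 3 * 3" using exp_le by (intro mult_mono) auto
  also have "\<dots> \<le> real T" using T by simp
  finally show lT: "2 \<le> ln (real T)" using T by (simp add: ln_ge_iff)
  show d: "0 < ln (1 / \<delta>)" using \<delta> by simp
  show eq: "ln (real T / \<delta>) = ln (real T) + ln (1 / \<delta>)" using \<delta> T by (simp add: ln_div)
  have m: "1 \<le> 4 * real CARD('m)" using card_ge_1 by linarith
  then have m0: "0 \<le> ln (4 * real CARD('m))" by (rule ln_ge_zero)
  have cl: "confidence_level T \<delta> = ln (4 * real CARD('m)) + ln (real T / \<delta>)"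
    unfolding confidence_level_def times_divide_eq_right[symmetric]
    using m T \<delta> by (intro ln_mult_pos divide_pos_pos) auto
  show "1 \<le> confidence_level T \<delta>" using cl m0 eq lT d by linarith
  have "ln (4 * real CARD('m)) * 1 \<le> ln (4 * real CARD('m)) * ln (real T / \<delta>)"
    using m0 eq lT d by (intro mult_left_mono) auto
  then show "confidence_level T \<delta> \<le> log_growth * ln (real T / \<delta>)"
    by (simp add: cl log_growth_def distrib_right)
  have "ln (2 * real T / \<delta>) = ln 2 + ln (real T / \<delta>)"
    unfolding times_divide_eq_right[symmetric] using T \<delta> by (intro ln_mult_pos divide_pos_pos) auto
  then show "ln (2 * real T / \<delta>) \<le> 2 * ln (real T) + ln (1 / \<delta>)"
    using eq lT ln_2_less_1 by linarith
  have "real T * 10 \<le> real T * real T" using T by (intro mult_left_mono) auto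
  then have "real T + 1 \<le> (real T)\<^sup>2" using T unfolding power2_eq_square by linarith
  then have "ln (real T + 1) \<le> ln ((real T)\<^sup>2)" by (rule ln_mono) auto
  also have "\<dots> = 2 * ln (real T)" using T by (simp add: ln_realpow)
  finally show "(\<Sum>t=1..T. (stepsize t)\<^sup>2) \<le> 2 * ln (real T)"
    by (rule order.trans[OF sum_stepsize_square_le])
qed

text \<open>
  The theorem bounds the error by a multiple of the sum of the squares of the following two scales,
  divided by \<open>sqrt T\<close>. The level constant is taken to be \<open>A = (main_scale T \<delta>)\<^sup>2\<close>, which balances
  \<open>sqrt A\<close> with the deterministic errors divided by \<open>sqrt A\<close>.
\<close>

definition main_scale :: "nat \<Rightarrow> real \<Rightarrow> real" where
  "main_scale T \<delta> = ln (real T / \<delta>) powr \<theta> * ln (real T)"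

definition deviation_scale :: "nat \<Rightarrow> real \<Rightarrow> real" where
  "deviation_scale T \<delta> = ln (1 / \<delta>) * ln (real T / \<delta>) powr (max 0 (\<theta> - 1))"

context
  fixes T :: nat and \<delta> :: real
  assumes T: "10 \<le> T" and \<delta>: "0 < \<delta>" "\<delta> < 1"
begin

lemma scales_pos: "1 \<le> main_scale T \<delta>" "0 \<le> deviation_scale T \<delta>"
    "ln (real T / \<delta>) powr (max 0 (\<theta> - 1)) * ln (real T) \<le> main_scale T \<delta>"
    "1 \<le> ln (real T / \<delta>) powr \<theta>"
proof -
  note e = log_estimates[OF T \<delta>]
  have l: "1 \<le> ln (real T / \<delta>)" using e(1-3) by linarith
  then show p: "1 \<le> ln (real T / \<delta>) powr \<theta>" using \<theta> by (intro ge_one_powr_ge_zero) auto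
  have "1 * 1 \<le> ln (real T / \<delta>) powr \<theta> * ln (real T)" using p e(1) by (intro mult_mono) auto
  then show "1 \<le> main_scale T \<delta>" by (simp add: main_scale_def)
  show "0 \<le> deviation_scale T \<delta>" unfolding deviation_scale_def using e(2) by (intro mult_nonneg_nonneg) auto
  show "ln (real T / \<delta>) powr (max 0 (\<theta> - 1)) * ln (real T) \<le> main_scale T \<delta>"
    unfolding main_scale_def using l e(1) \<theta> by (intro mult_right_mono powr_mono) auto
qed

lemma confidence_powr:
  assumes "0 \<le> b"
  shows "confidence_level T \<delta> powr b \<le> log_growth powr b * ln (real T / \<delta>) powr b"
proof -
  note e = log_estimates[OF T \<delta>]
  have "confidence_level T \<delta> powr b \<le> (log_growth * ln (real T / \<delta>)) powr b"
    using e assms by (intro powr_mono2) auto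
  also have "\<dots> = log_growth powr b * ln (real T / \<delta>) powr b"
    using e(1-3) log_growth_ge_1 by (intro powr_mult)
  finally show ?thesis .
qed

lemma deviation_bound:
  "0 \<le> deviation T \<delta> (confidence_level T \<delta>)"
  "deviation T \<delta> (confidence_level T \<delta>) \<le> noise_coeff \<theta> \<kappa> * (main_scale T \<delta> + deviation_scale T \<delta>)"
proof -
  note e = log_estimates[OF T \<delta>] and C = subweibull_const_pos[of \<theta>]
  let ?b = "max 0 (\<theta> - 1)" and ?C = "subweibull_const \<theta>" and ?d = "ln (1 / \<delta>)" and ?l = "ln (real T)"
  let ?S = "\<Sum>t=1..T. (stepsize t)\<^sup>2" and ?p = "ln (real T / \<delta>) powr max 0 (\<theta> - 1)"
  let ?k = "2 * real CARD('m) * noise_scale"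
  have k: "0 \<le> ?k" using noise_scale_pos by simp
  have "0 \<le> ln (2 * real T / \<delta>)" using T \<delta> by (intro ln_ge_zero) (simp add: le_divide_eq)
  then have inner0: "0 \<le> ?C * ?S + ln (2 * real T / \<delta>)"
    using C by (intro add_nonneg_nonneg mult_nonneg_nonneg sum_nonneg) auto
  then show "0 \<le> deviation T \<delta> (confidence_level T \<delta>)"
    unfolding deviation_def using noise_scale_pos by (intro mult_nonneg_nonneg) auto
  have "?C * ?S \<le> ?C * (2 * ?l)" using C e(7) by (intro mult_left_mono) auto
  then have "?C * ?S + ln (2 * real T / \<delta>) \<le> (2 * ?C + 2) * ?l + ?d"
    using e(6) by (simp add: algebra_simps)
  also have "\<dots> \<le> (2 * ?C + 2) * (?l + ?d)"
  proof -
    have "0 \<le> (2 * ?C + 1) * ?d" using C e(2) by (intro mult_nonneg_nonneg) auto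
    then show ?thesis by (simp add: algebra_simps)
  qed
  finally have inner: "?C * ?S + ln (2 * real T / \<delta>) \<le> (2 * ?C + 2) * (?l + ?d)" .
  have "deviation T \<delta> (confidence_level T \<delta>)
      \<le> ?k * (log_growth powr ?b * ?p) * ((2 * ?C + 2) * (?l + ?d))"
    unfolding deviation_def
    by (intro mult_mono mult_left_mono confidence_powr inner inner0 mult_nonneg_nonneg k) auto
  also have "\<dots> = noise_coeff \<theta> \<kappa> * (?p * ?l + deviation_scale T \<delta>)"
    by (simp add: noise_coeff_def noise_scale_def deviation_scale_def algebra_simps)
  also have "\<dots> \<le> noise_coeff \<theta> \<kappa> * (main_scale T \<delta> + deviation_scale T \<delta>)"
    using scales_pos(3) coeff_nonneg(1)[OF \<kappa>] by (intro mult_left_mono) auto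
  finally show "deviation T \<delta> (confidence_level T \<delta>)
      \<le> noise_coeff \<theta> \<kappa> * (main_scale T \<delta> + deviation_scale T \<delta>)" .
qed

lemma event_error_bound:
  "event_error T (confidence_level T \<delta>) \<le> error_coeff x1 \<theta> \<kappa> * (main_scale T \<delta>)\<^sup>2"
proof -
  note e = log_estimates[OF T \<delta>]
  let ?p = "ln (real T / \<delta>) powr \<theta>" and ?P = "main_scale T \<delta>" and ?l = "ln (real T)"
  let ?E = "event_drift (confidence_level T \<delta>)" and ?c = "drift_coeff \<theta> \<kappa>"
  let ?S = "\<Sum>t=1..T. (stepsize t)\<^sup>2"
  have c0: "0 \<le> ?c" by (rule coeff_nonneg(2)[OF \<kappa>])
  have E0: "0 \<le> ?E"
    using G_pos G\<psi>_pos \<sigma>_pos \<kappa> by (simp add: event_drift_def noise_level_def)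
  have S0: "0 \<le> ?S" by (intro sum_nonneg) auto
  have P1: "1 \<le> ?P" by (rule scales_pos(1))
  have PP: "?P \<le> ?P\<^sup>2" using P1 by (simp add: self_le_power)
  have E: "?E \<le> ?c * ?p"
  proof -
    have "\<kappa> * confidence_level T \<delta> powr \<theta> \<le> \<kappa> * (log_growth powr \<theta> * ?p)"
      using \<kappa> \<theta> by (intro mult_left_mono confidence_powr) auto
    moreover have "G * 1 \<le> G * ?p" "G\<psi> * 1 \<le> G\<psi> * ?p"
      using G_pos G\<psi>_pos scales_pos(4) by (auto intro!: mult_left_mono)
    ultimately have "G + noise_level (confidence_level T \<delta>) + G\<psi> \<le> (G + \<kappa> * log_growth powr \<theta> + G\<psi>) * ?p"
      by (simp add: noise_level_def algebra_simps)
    then show ?thesis using \<sigma>_pos by (simp add: event_drift_def drift_coeff_def divide_right_mono)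
  qed
  have "?E * ?S \<le> (?c * ?p) * (2 * ?l)" by (rule mult_mono[OF E e(7)]) (use c0 S0 in auto)
  also have "\<dots> = 2 * ?c * ?P" by (simp add: main_scale_def)
  also have "\<dots> \<le> 2 * ?c * ?P\<^sup>2" using PP c0 by (intro mult_left_mono) auto
  finally have ES: "?E * ?S \<le> 2 * ?c * ?P\<^sup>2" .
  have "?E\<^sup>2 * ?S \<le> (?c * ?p)\<^sup>2 * (2 * ?l)"
    using E E0 e(7) S0 by (intro mult_mono power_mono) auto
  also have "\<dots> \<le> (?c * ?p)\<^sup>2 * (2 * ?l\<^sup>2)"
    using e(1) by (intro mult_left_mono) (auto simp: self_le_power)
  also have "\<dots> = 2 * ?c\<^sup>2 * ?P\<^sup>2" by (simp add: main_scale_def power_mult_distrib)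
  finally have E2S: "?E\<^sup>2 * ?S \<le> 2 * ?c\<^sup>2 * ?P\<^sup>2" .
  have "stepsize 1 * spread nrm x1 \<le> 1 * spread nrm x1"
    by (intro mult_right_mono spread_nonneg[OF nrm] stepsize_le_1)
  also have "\<dots> \<le> spread nrm x1 * ?P\<^sup>2"
    using mult_left_mono[OF order.trans[OF P1 PP] spread_nonneg[OF nrm, of x1]] by simp
  finally have V: "stepsize 1 * spread nrm x1 \<le> spread nrm x1 * ?P\<^sup>2" .
  have bracket: "real mixing_time * (stepsize 1 * spread nrm x1) + 4 * real mixing_time * ?E * ?S
      \<le> (real mixing_time * spread nrm x1 + 8 * real mixing_time * ?c) * ?P\<^sup>2"
  proof -
    have "real mixing_time * (stepsize 1 * spread nrm x1) \<le> real mixing_time * (spread nrm x1 * ?P\<^sup>2)"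
      by (rule mult_left_mono[OF V]) simp
    moreover have "4 * real mixing_time * (?E * ?S) \<le> 4 * real mixing_time * (2 * ?c * ?P\<^sup>2)"
      by (rule mult_left_mono[OF ES]) simp
    ultimately show ?thesis by (simp only: distrib_right mult.assoc)
  qed
  have "event_error T (confidence_level T \<delta>)
      \<le> real CARD('m) * (2 * G + G\<psi>)
          * ((real mixing_time * spread nrm x1 + 8 * real mixing_time * ?c) * ?P\<^sup>2 / mixing_rate)
        + real CARD('m) * \<sigma> * (2 * ?c\<^sup>2 * ?P\<^sup>2)"
    unfolding event_error_def mult.assoc[of "real CARD('m) * \<sigma>"]
    using G_pos G\<psi>_pos \<sigma>_pos mixing_rate(1)
    by (intro add_mono mult_left_mono divide_right_mono bracket E2S) auto
  also have "\<dots> = error_coeff x1 \<theta> \<kappa> * ?P\<^sup>2" by (simp add: error_coeff_def algebra_simps)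
  finally show ?thesis .
qed

lemma level_bound:
  defines "Q \<equiv> sqrt (\<Sum>i\<in>UNIV. D xstar (x1 i)) + sqrt ((main_scale T \<delta>)\<^sup>2)
    + deviation T \<delta> (confidence_level T \<delta>) / 2
    + event_error T (confidence_level T \<delta>) / (2 * sqrt ((main_scale T \<delta>)\<^sup>2))"
  shows "0 \<le> Q" "Q \<le> level_coeff x1 \<theta> \<kappa> * (main_scale T \<delta> + deviation_scale T \<delta>)"
proof -
  let ?P = "main_scale T \<delta>" and ?R = "deviation_scale T \<delta>"
  let ?z = "sqrt (\<Sum>i\<in>UNIV. D xstar (x1 i))"
  note s = scales_pos
  have z: "0 \<le> ?z" using x1 xstar by (auto intro!: sum_nonneg bregman_nonneg)
  have root: "sqrt (?P\<^sup>2) = ?P" using s(1) by simp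
  have err0: "0 \<le> event_error T (confidence_level T \<delta>)"
    unfolding event_error_def event_drift_def noise_level_def
    using G_pos G\<psi>_pos \<sigma>_pos \<kappa> mixing_rate(1) spread_nonneg[OF nrm, of x1]
    by (intro add_nonneg_nonneg mult_nonneg_nonneg divide_nonneg_pos sum_nonneg) auto
  show "0 \<le> Q" unfolding Q_def root using z s(1) deviation_bound(1) err0
    by (intro add_nonneg_nonneg divide_nonneg_pos) auto
  have "event_error T (confidence_level T \<delta>) / (2 * ?P) \<le> error_coeff x1 \<theta> \<kappa> * ?P\<^sup>2 / (2 * ?P)"
    using event_error_bound s(1) by (intro divide_right_mono) auto
  also have "\<dots> = error_coeff x1 \<theta> \<kappa> / 2 * ?P" using s(1) by (simp add: power2_eq_square)
  also have "\<dots> \<le> error_coeff x1 \<theta> \<kappa> / 2 * (?P + ?R)"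
    using s(2) coeff_nonneg(3)[OF \<kappa>] by (intro mult_left_mono) auto
  finally have 1: "event_error T (confidence_level T \<delta>) / (2 * ?P) \<le> error_coeff x1 \<theta> \<kappa> / 2 * (?P + ?R)" .
  have 2: "?z * 1 \<le> ?z * (?P + ?R)" using z s by (intro mult_left_mono) auto
  have 3: "deviation T \<delta> (confidence_level T \<delta>) / 2 \<le> noise_coeff \<theta> \<kappa> / 2 * (?P + ?R)"
    using deviation_bound(2) by simp
  have "Q \<le> ?z * (?P + ?R) + 1 * (?P + ?R) + noise_coeff \<theta> \<kappa> / 2 * (?P + ?R)
      + error_coeff x1 \<theta> \<kappa> / 2 * (?P + ?R)"
    unfolding Q_def root by (intro add_mono 1 3) (use 2 s(2) in auto)
  also have "\<dots> = level_coeff x1 \<theta> \<kappa> * (?P + ?R)"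
    by (simp only: level_coeff_def distrib_right)
  finally show "Q \<le> level_coeff x1 \<theta> \<kappa> * (?P + ?R)" .
qed

lemma final_rate:
  assumes "0 \<le> Q" "Q \<le> level_coeff x1 \<theta> \<kappa> * (main_scale T \<delta> + deviation_scale T \<delta>)"
  shows "2 * Q\<^sup>2 / (real T * stepsize T) \<le> rate_coeff x1 \<theta> \<kappa>
      * (ln (real T / \<delta>) powr (2 * \<theta>) * (ln (real T))\<^sup>2 / sqrt (real T)
        + (ln (1 / \<delta>))\<^sup>2 * ln (real T / \<delta>) powr (2 * max 0 (\<theta> - 1)) / sqrt (real T))"
proof -
  let ?P = "main_scale T \<delta>" and ?R = "deviation_scale T \<delta>" and ?c = "level_coeff x1 \<theta> \<kappa>"
  have T0: "0 < real T" using T by simp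
  have "Q\<^sup>2 \<le> ?c\<^sup>2 * (?P + ?R)\<^sup>2" using power_mono[OF assms(2,1), of 2] by (simp add: power_mult_distrib)
  also have "\<dots> \<le> ?c\<^sup>2 * (2 * (?P\<^sup>2 + ?R\<^sup>2))"
  proof (rule mult_left_mono)
    have "0 \<le> (?P - ?R)\<^sup>2" by simp
    then show "(?P + ?R)\<^sup>2 \<le> 2 * (?P\<^sup>2 + ?R\<^sup>2)" by (simp add: power2_sum power2_diff)
  qed simp
  finally have "2 * Q\<^sup>2 \<le> 2 * (?c\<^sup>2 * (2 * (?P\<^sup>2 + ?R\<^sup>2)))" by (rule mult_left_mono) simp
  also have "\<dots> = 4 * ?c\<^sup>2 * (?P\<^sup>2 + ?R\<^sup>2)" by simp
  finally have Q: "2 * Q\<^sup>2 \<le> 4 * ?c\<^sup>2 * (?P\<^sup>2 + ?R\<^sup>2)" .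
  have "sqrt (real T + 1) \<le> sqrt (4 * real T)" using T by (intro real_sqrt_le_mono) auto
  then have "1 / (real T * stepsize T) \<le> 2 * sqrt (real T) / real T"
    using T0 by (simp add: real_sqrt_mult divide_right_mono)
  also have "\<dots> = 2 / sqrt (real T)" using T0 by (simp add: field_simps)
  finally have a: "1 / (real T * stepsize T) \<le> 2 / sqrt (real T)" .
  have "2 * Q\<^sup>2 / (real T * stepsize T) = 2 * Q\<^sup>2 * (1 / (real T * stepsize T))" by simp
  also have "\<dots> \<le> 4 * ?c\<^sup>2 * (?P\<^sup>2 + ?R\<^sup>2) * (2 / sqrt (real T))"
    by (rule mult_mono[OF Q a]) auto
  also have "\<dots> = rate_coeff x1 \<theta> \<kappa> * (?P\<^sup>2 / sqrt (real T) + ?R\<^sup>2 / sqrt (real T))"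
    by (simp add: rate_coeff_def algebra_simps add_divide_distrib)
  also have "?P\<^sup>2 = ln (real T / \<delta>) powr (2 * \<theta>) * (ln (real T))\<^sup>2"
    by (simp add: main_scale_def power_mult_distrib power2_eq_square[of "_ powr _"] powr_add[symmetric])
  also have "?R\<^sup>2 = (ln (1 / \<delta>))\<^sup>2 * ln (real T / \<delta>) powr (2 * max 0 (\<theta> - 1))"
    by (simp only: deviation_scale_def power_mult_distrib power2_eq_square[of "_ powr _"] powr_add[symmetric] mult_2)
  finally show ?thesis .
qed

lemma high_probability_rate:
  "1 - \<delta> \<le> \<P>(\<omega> in M.
    objective f \<psi> ((1 / real T) *\<^sub>R (\<Sum>t = 1..T. x l t \<omega>)) - objective f \<psi> xstar
    \<le> rate_coeff x1 \<theta> \<kappa> * (ln (real T / \<delta>) powr (2 * \<theta>) * (ln (real T))\<^sup>2 / sqrt (real T)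
        + (ln (1 / \<delta>))\<^sup>2 * ln (real T / \<delta>) powr (2 * max 0 (\<theta> - 1)) / sqrt (real T)))"
  (is "_ \<le> \<P>(\<omega> in M. ?h \<omega> \<le> ?b)")
proof -
  interpret P: prob_space M by (rule prob)
  let ?A = "(main_scale T \<delta>)\<^sup>2" and ?L = "confidence_level T \<delta>"
  let ?avg = "\<lambda>\<omega>. (1 / real T) *\<^sub>R (\<Sum>t = 1..T. x l t \<omega>)"
  have T1: "1 \<le> T" using T by simp
  have A: "0 < ?A" using scales_pos(1) by simp
  note good = good_event_prob[OF A log_estimates(4)[OF T \<delta>] confidence_level_def T1 \<delta>(1)]
  have avg_M: "?avg \<in> borel_measurable M"
    using from_Fil[OF x_meas] by (intro borel_measurable_scaleR borel_measurable_sum) auto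
  have avg_X: "?avg \<omega> \<in> X" if "\<omega> \<in> space M" for \<omega>
    using objective_Jensen(2)[OF T1, of "\<lambda>t. x l t \<omega>"] x_X that by auto
  have avg_U: "?avg \<omega> \<in> interior U" if "\<omega> \<in> space M" for \<omega>
    using convex_sum[of "{1..T}" "interior U" "\<lambda>_. 1 / real T" "\<lambda>t. x l t \<omega>"]
      dcsmd_path.x_interior[OF path[OF that]] convex_interior[OF convex_U] T1
    by (simp add: scaleR_sum_right)
  note [measurable] = borel_measurable_objective[OF avg_M avg_X avg_U]
  have "good_event T \<delta> ?A ?L \<subseteq> {\<omega>\<in>space M. ?h \<omega> \<le> ?b}"
  proof
    fix \<omega> assume \<omega>: "\<omega> \<in> good_event T \<delta> ?A ?L"
    have "?h \<omega> \<le> ?b"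
      by (rule order.trans[OF gap_on_good_event[OF \<omega> T1 A deviation_bound(1)] final_rate[OF level_bound]])
    then show "\<omega> \<in> {\<omega>\<in>space M. ?h \<omega> \<le> ?b}" using \<omega> by (simp add: good_event_def)
  qed
  moreover have "{\<omega>\<in>space M. ?h \<omega> \<le> ?b} \<in> sets M" by measurable
  ultimately have "measure M (good_event T \<delta> ?A ?L) \<le> measure M {\<omega>\<in>space M. ?h \<omega> \<le> ?b}"
    by (rule P.finite_measure_mono)
  then show ?thesis using good(2) by linarith
qed

end

end

theorem theorem2:
  fixes nrm :: "real^'n \<Rightarrow> real"
    and X U :: "(real^'n) set"
    and f \<psi> :: "'m::finite \<Rightarrow> real^'n \<Rightarrow> real"
    and Phi :: "real^'n \<Rightarrow> real" and dPhi :: "real^'n \<Rightarrow> real^'n"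
    and W :: "nat \<Rightarrow> real^'m^'m"
    and x1 :: "'m \<Rightarrow> real^'n" and xstar :: "real^'n"
    and B :: nat and \<eta> \<theta> \<kappa> G G\<psi> \<sigma> :: real
  assumes "is_norm nrm"
    and "closed X" and "convex X" and "X \<subseteq> U"
    and "\<And>i. convex_on U (f i)"
    and "xstar \<in> X" and "\<And>z. z \<in> X \<Longrightarrow> objective f \<psi> z \<ge> objective f \<psi> xstar"
    and "\<And>i. x1 i \<in> X"
    and "network_assumption W B \<eta>"
    and "boundedness_assumption nrm X U f \<psi> G G\<psi>"
    and "bregman_assumption TYPE('m) nrm X Phi dPhi \<sigma>"
    and "\<theta> \<ge> 1 / 2" and "\<kappa> > 0"
  shows "\<exists>C>0. \<forall>(M :: 'w measure) Fil x y g \<xi>.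
    dcsmd_run X U f \<psi> Phi dPhi W (\<lambda>t. 1 / sqrt (real t + 1)) x1 M Fil x y g \<xi> \<and>
    noise_assumption nrm \<theta> \<kappa> M Fil \<xi> \<longrightarrow>
    (\<forall>l. \<forall>T\<ge>10. \<forall>\<delta>. 0 < \<delta> \<and> \<delta> < 1 \<longrightarrow>
       \<P>(\<omega> in M.
          objective f \<psi> ((1 / real T) *\<^sub>R (\<Sum>t = 1..T. x l t \<omega>)) - objective f \<psi> xstar
          \<le> C * (ln (real T / \<delta>) powr (2 * \<theta>) * (ln (real T))\<^sup>2 / sqrt (real T)
                + (ln (1 / \<delta>))\<^sup>2 * ln (real T / \<delta>) powr (2 * max 0 (\<theta> - 1)) / sqrt (real T)))
       \<ge> 1 - \<delta>)"
proof -
  interpret dcsmd_problem nrm X U f \<psi> Phi dPhi W xstar B \<eta> G G\<psi> \<sigma>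
    using assms by unfold_locales
  show ?thesis
  proof (intro exI[of _ "rate_coeff x1 \<theta> \<kappa>"] conjI allI impI)
    show "0 < rate_coeff x1 \<theta> \<kappa>"
      using level_coeff_ge_1[of \<kappa> x1 \<theta>] assms by (simp add: rate_coeff_def)
  next
    fix M :: "'w measure" and Fil x y g \<xi> l and T :: nat and \<delta> :: real
    assume run: "dcsmd_run X U f \<psi> Phi dPhi W (\<lambda>t. 1 / sqrt (real t + 1)) x1 M Fil x y g \<xi> \<and>
      noise_assumption nrm \<theta> \<kappa> M Fil \<xi>" and T: "10 \<le> T" and \<delta>: "0 < \<delta> \<and> \<delta> < 1"
    interpret dcsmd_random nrm X U f \<psi> Phi dPhi W xstar B \<eta> G G\<psi> \<sigma> x1 \<theta> \<kappa> M Fil x y g \<xi>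
      using assms run by unfold_locales auto
    show "\<P>(\<omega> in M.
        objective f \<psi> ((1 / real T) *\<^sub>R (\<Sum>t = 1..T. x l t \<omega>)) - objective f \<psi> xstar
        \<le> rate_coeff x1 \<theta> \<kappa> * (ln (real T / \<delta>) powr (2 * \<theta>) * (ln (real T))\<^sup>2 / sqrt (real T)
            + (ln (1 / \<delta>))\<^sup>2 * ln (real T / \<delta>) powr (2 * max 0 (\<theta> - 1)) / sqrt (real T)))
      \<ge> 1 - \<delta>"
      using high_probability_rate[OF T] \<delta> by blast
  qed
qed

end
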